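(* Let $M\ge2$ and $a$ be integers with $1\le a\le M-1$, and let $\zeta_M:=e^{2\pi i/M}$. For generic $z',z''\in\mathbb{C}$ (i.e. such that none of the Appell–Lerch series and theta quotients below has a pole), \[ \begin{aligned} \overline{D}_2(a,M)+\overline{D}_2(a-1,M)={}&\chi(a=1)+2(-1)^aq^{-a^2}m\!\left((-1)^{M+1}q^{M^2-2Ma},q^{2M^2},z'\right)+2(-1)^aq^{-a^2+2a-1}m\!\left((-1)^{M+1}q^{M^2-2M(a-1)},q^{2M^2},z''\right)\\ &+2\Psi^M_a(q,-1,z';q^2)-2\Psi^M_{a-1}(q,-1,z'';q^2)+\frac{2}{M}\sum_{j=1}^{M-1}\zeta_M^{-aj}(1-\zeta_M^j)\,\Delta(\zeta_M^jq,q,-1;q^2). \end{aligned} \]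
   Context: Throughout $q$ is a complex number with $0<|q|<1$. $(x;q)_\infty:=\prod_{k\ge0}(1-xq^k)$, $j(z;q):=(z;q)_\infty(q/z;q)_\infty(q;q)_\infty$. $\chi(X)=1$ if $X$ is true and $0$ otherwise. Appell–Lerch series: $m(x,q,z):=\frac{1}{j(z;q)}\sum_{r\in\mathbb{Z}}\frac{(-1)^rq^{\binom r2}z^r}{1-q^{r-1}xz}$ (for nonzero $x,z$ with $z,xz$ not integral powers of $q$). $\Delta(x,z_1,z_0;q):=\frac{z_0\,(q;q)_\infty^3\, j(z_1/z_0;q)\,j(xz_0z_1;q)}{j(z_0;q)\,j(z_1;q)\,j(xz_0;q)\,j(xz_1;q)}$. For integers $n\ge1$, $k$: $\Psi^n_k(x,z,z';q):=-\frac{x^kz^{k+1}(q^{n^2};q^{n^2})_\infty^3}{j(z;q)\,j(z';q^{n^2})}\sum_{t=0}^{n-1}\frac{q^{\binom{t+1}{2}+kt}(-z)^t\, j\!\left(-q^{\binom{n+1}{2}+nk+nt}(-z)^n/z';q^{n^2}\right) j\!\left(q^{nt}(xz)^nz';q^{n^2}\right)}{j\!\left(-q^{\binom n2-nk}(-x)^nz';q^{n^2}\right) j\!\left(q^{nt}(xz)^n;q^{n^2}\right)}$; when $q$ is replaced by $q^2$ every occurrence of $q$ is replaced. An overpartition of $n$ is a partition of $n$ in which the first occurrence of each distinct part may be overlined; $\overline{p}(n)$ is their number. For an overpartition $\pi$, let $\ell(\pi)$ be its largest part ($0$ for the empty overpartition), $n(\pi)$ its number of parts, $\pi_o$ the subpartition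 of odd non-overlined parts, and $\chi(\pi)=1$ if the largest part of $\pi$ is odd and non-overlined, $0$ otherwise. The $M_2$-rank is $\lceil \ell(\pi)/2\rceil-n(\pi)+n(\pi_o)-\chi(\pi)$. For integers $a$ and $M\ge2$, $\overline N_2(a,M,n)$ is the number of overpartitions of $n$ with $M_2$-rank congruent to $a$ mod $M$, and $\overline D_2(a,M):=\sum_{n\ge0}\left(\overline N_2(a,M,n)-\frac{\overline p(n)}{M}\right)q^n$. *)

theory Defs
  imports
    "HOL-Analysis.Analysis"
    "HOL-Library.Multiset"
    "HOL-Number_Theory.Cong"
begin

definition qpoch_inf :: "complex \<Rightarrow> complex \<Rightarrow> complex" where
  "qpoch_inf x q = prodinf (\<lambda>k. 1 - x * q ^ k)"

definition jtheta :: "complex \<Rightarrow> complex \<Rightarrow> complex" where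
  "jtheta z q = qpoch_inf z q * qpoch_inf (q / z) q * qpoch_inf q q"

definition appell_lerch :: "complex \<Rightarrow> complex \<Rightarrow> complex \<Rightarrow> complex" where
  "appell_lerch x q z =
     1 / jtheta z q *
       (\<Sum>\<^sub>\<infinity>r\<in>(UNIV :: int set).
          (-1) powi r * q powi (r * (r - 1) div 2) * z powi r / (1 - q powi (r - 1) * x * z))"

text \<open>The zeros of \<open>jtheta\<close> in its first argument (for \<open>0 < norm q < 1\<close>) are the integral
  powers of \<open>q\<close>, so the following are the conditions under which \<open>appell_lerch x q z\<close> is defined.\<close>

definition appell_lerch_defined :: "complex \<Rightarrow> complex \<Rightarrow> complex \<Rightarrow> bool" where
  "appell_lerch_defined x q z \<longleftrightarrow>
     x \<noteq> 0 \<and> z \<noteq> 0 \<and> (\<forall>k :: int. z \<noteq> q powi k) \<and> (\<forall>k :: int. x * z \<noteq> q powi k)"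

definition Delta_quot :: "complex \<Rightarrow> complex \<Rightarrow> complex \<Rightarrow> complex \<Rightarrow> complex" where
  "Delta_quot x z1 z0 q =
     z0 * qpoch_inf q q ^ 3 * jtheta (z1 / z0) q * jtheta (x * z0 * z1) q /
     (jtheta z0 q * jtheta z1 q * jtheta (x * z0) q * jtheta (x * z1) q)"

definition Psi_quot :: "nat \<Rightarrow> int \<Rightarrow> complex \<Rightarrow> complex \<Rightarrow> complex \<Rightarrow> complex \<Rightarrow> complex" where
  "Psi_quot n k x z z' q =
     - (x powi k * z powi (k + 1) * qpoch_inf (q ^ n\<^sup>2) (q ^ n\<^sup>2) ^ 3 /
          (jtheta z q * jtheta z' (q ^ n\<^sup>2))) *
     (\<Sum>t<n.
        q powi (int (Suc t choose 2) + k * int t) * (- z) ^ t *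
        jtheta (- (q powi (int (Suc n choose 2) + int n * k + int n * int t)) * (- z) ^ n / z')
          (q ^ n\<^sup>2) *
        jtheta (q ^ (n * t) * (x * z) ^ n * z') (q ^ n\<^sup>2) /
        (jtheta (- (q powi (int (n choose 2) - int n * k)) * (- x) ^ n * z') (q ^ n\<^sup>2) *
         jtheta (q ^ (n * t) * (x * z) ^ n) (q ^ n\<^sup>2)))"

text \<open>An overpartition is a pair \<open>(P, S)\<close>: \<open>P\<close> is the multiset of all parts, overlined or not, and
  \<open>S\<close> is the set of those part sizes whose first occurrence is overlined.\<close>

type_synonym overpartition = "nat multiset \<times> nat set"

definition overpartitions :: "nat \<Rightarrow> overpartition set" where
  "overpartitions n = {(P, S). 0 \<notin># P \<and> S \<subseteq> set_mset P \<and> sum_mset P = n}"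

definition largest_part :: "overpartition \<Rightarrow> nat" where
  "largest_part \<pi> = Max (insert 0 (set_mset (fst \<pi>)))"

definition num_parts :: "overpartition \<Rightarrow> nat" where
  "num_parts \<pi> = size (fst \<pi>)"

definition odd_nonoverlined :: "overpartition \<Rightarrow> nat multiset" where
  "odd_nonoverlined \<pi> = filter_mset odd (fst \<pi> - mset_set (snd \<pi>))"

text \<open>If the largest size occurs several times, then the largest part is its first occurrence (parts
  listed in non-increasing order); thus it is overlined iff its size is in \<open>S\<close>, even if further
  occurrences of that size are not overlined.\<close>

definition chi_largest :: "overpartition \<Rightarrow> nat" where
  "chi_largest \<pi> = of_bool (odd (largest_part \<pi>) \<and> largest_part \<pi> \<notin> snd \<pi>)"

definition M2_rank :: "overpartition \<Rightarrow> int" where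
  "M2_rank \<pi> = \<lceil>real (largest_part \<pi>) / 2\<rceil> - int (num_parts \<pi>)
     + int (size (odd_nonoverlined \<pi>)) - int (chi_largest \<pi>)"

definition pbar :: "nat \<Rightarrow> nat" where
  "pbar n = card (overpartitions n)"

definition N2bar :: "int \<Rightarrow> nat \<Rightarrow> nat \<Rightarrow> nat" where
  "N2bar a M n = card {\<pi> \<in> overpartitions n. [M2_rank \<pi> = a] (mod int M)}"

definition D2bar :: "int \<Rightarrow> nat \<Rightarrow> complex \<Rightarrow> complex" where
  "D2bar a M q = (\<Sum>n. (of_nat (N2bar a M n) - of_nat (pbar n) / of_nat M) * q ^ n)"

definition zeta :: "nat \<Rightarrow> complex" where
  "zeta M = exp (2 * of_real pi * \<i> / of_nat M)"

text \<open>Genericity of the auxiliary variable \<open>z\<close>, for \<open>0 < norm q < 1\<close>. The Appell--Lerch parameter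
  equals \<open>- ((q\<^sup>2) powi ((M choose 2) - M k)) * (- q) ^ M\<close>, so the two denominators
  of \<open>Psi_quot M k q (-1) z (q\<^sup>2)\<close> that depend on \<open>z\<close> vanish exactly at the values excluded here.
  The remaining denominators of \<open>Psi_quot\<close> and those of
  \<open>Delta_quot ((zeta M) ^ j * q) q (-1) (q\<^sup>2)\<close>, \<open>0 < j < M\<close>, never vanish.\<close>

definition generic :: "nat \<Rightarrow> int \<Rightarrow> complex \<Rightarrow> complex \<Rightarrow> bool" where
  "generic M k q z \<longleftrightarrow>
     appell_lerch_defined ((-1) ^ (M + 1) * q powi ((int M)\<^sup>2 - 2 * int M * k)) (q ^ (2 * M\<^sup>2)) z"

end

theory Submission
  imports Defs
begin

text \<open>For \<open>|z| = 1\<close>, \<open>z \<noteq> 1\<close>, let \<open>R(z)\<close> be the generating function of the M2-rank. Classifying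
  overpartitions by \<open>\<lceil>\<ell>/2\<rceil> - \<chi>\<close> writes \<open>R(z)\<close> as \<open>\<Sum>\<^sub>m z\<^sup>m (F\<^sub>m - F\<^sub>m\<^sub>-\<^sub>1)\<close> with explicit finite products
  \<open>F\<^sub>m\<close>. An iterated contiguous relation, each step of which telescopes, turns this into
  \<open>\<Sum>\<^sub>n q\<^sup>n (-1;q)\<^sub>2\<^sub>n / ((zq\<^sup>2;q\<^sup>2)\<^sub>n (q\<^sup>2/z;q\<^sup>2)\<^sub>n)\<close>. Partial fractions in \<open>z\<close>, whose
  coefficients are summed over \<open>n\<close> by one more telescoping recurrence, then give
  \<open>(1 + z) R(z) = (1 - z) (2 m(zq, q\<^sup>2, q) - 1)\<close>. Summing over the roots of unity \<open>z = \<zeta>\<^sup>j\<close>,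
  replacing \<open>q\<close> by \<open>-1\<close> in the last argument of \<open>m\<close> (which produces the \<open>\<Delta>\<close> terms) and
  splitting the bilateral series for \<open>m\<close> modulo \<open>M\<close> (which produces \<open>\<Psi>\<close>) yields the theorem.

  The formula for changing the last argument of \<open>m\<close> is obtained without complex analysis. Kronecker's
  identity expands the theta quotient as a Laurent series in \<open>w\<close> whose coefficients obey the same
  first-order recurrence as those of \<open>j(z) f(w) - j(w) f(z)\<close>, up to a multiple of a theta series; the
  multiple vanishes because the quotient is zero at \<open>w = z\<close>. Both the triple product and the partial
  fraction expansion of \<open>1 / j\<close> come from finite identities by dominated convergence.\<close>

section \<open>Theta functions and bilateral sums\<close>

text \<open>The M2-rank is \<open>\<lceil>\<ell>/2\<rceil> - \<chi>\<close> minus the number of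
  parts other than the odd non-overlined ones. The first quantity is at most \<open>m\<close>
  exactly when all parts are at most \<open>2 m + 1\<close> and all overlined ones at most
  \<open>2 m\<close>; the second is additive over part sizes. Hence the \<open>F\<^sub>m\<close> are
  products, in which \<open>u = 1 / z\<close> marks the counted parts.

  At \<open>z = -1\<close> the identity for \<open>(1 + z) R(z)\<close> says nothing about
  \<open>R\<close>. Adding the deviations for \<open>a\<close> and \<open>a - 1\<close> is what
  produces the factor \<open>1 + z\<close>.

  The passage from \<open>q\<close> to \<open>-1\<close> in the last argument is forced by the
  splitting modulo \<open>M\<close>, which averages over all \<open>M\<close>-th roots of unity
  including \<open>z = 1\<close>: there \<open>m(q, q^2, q)\<close> has a pole. With
  \<open>-1\<close> the product of the outer arguments has modulus \<open>|q|\<close>, strictly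
  between consecutive powers of \<open>|q^2|\<close>, so no root of unity gives a pole. The term for
  \<open>z = 1\<close> may then be added, because its coefficient contains \<open>1 - z\<close>.

  The same gap serves the change of argument: Kronecker's series converges only in an annulus, and
  quasi-periodicity moves there every point whose modulus is not a power of the modulus of the
  base.\<close>

definition qfac :: "complex \<Rightarrow> complex \<Rightarrow> nat \<Rightarrow> complex" where
  "qfac a q n = (\<Prod>i<n. 1 - a * q ^ i)"

lemma qfac_0 [simp]: "qfac a q 0 = 1"
  by (simp add: qfac_def)

lemma qfac_Suc: "qfac a q (Suc n) = qfac a q n * (1 - a * q ^ n)"
  by (simp add: qfac_def)

lemma qfac_Suc': "qfac a q (Suc n) = (1 - a) * qfac (a * q) q n"
  unfolding qfac_def by (subst prod.lessThan_Suc_shift) (simp add: mult.assoc)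

definition tri :: "int \<Rightarrow> int" where
  "tri r = r * (r - 1) div 2"

text \<open>The product is even, so the division is exact. Identities between such exponents are
  proved after doubling, where they become polynomial identities.\<close>

lemma two_tri: "2 * tri r = r * (r - 1)"
  unfolding tri_def by simp

lemma tri_add1: "tri (r + 1) = tri r + r"
proof -
  have "2 * tri (r + 1) = 2 * (tri r + r)"
    by (simp only: two_tri distrib_left) (simp add: algebra_simps)
  then show ?thesis by simp
qed

lemma tri_neg: "tri (- r) = tri r + r"
proof -
  have "2 * tri (- r) = 2 * (tri r + r)"
    by (simp only: two_tri distrib_left) (simp add: algebra_simps)
  then show ?thesis by simp
qed

lemma tri_add: "tri (r + s) = tri r + tri s + r * s"
proof -
  have "2 * tri (r + s) = 2 * (tri r + tri s + r * s)"
    by (simp only: two_tri distrib_left) (simp add: algebra_simps)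
  then show ?thesis by simp
qed

lemma tri_0 [simp]: "tri 0 = 0" and tri_1 [simp]: "tri 1 = 0"
  by (simp_all add: tri_def)

definition theta_coeff :: "complex \<Rightarrow> int \<Rightarrow> complex" where
  "theta_coeff q r = (-1) powi r * q powi tri r"

lemma theta_coeff_0 [simp]: "theta_coeff q 0 = 1"
  by (simp add: theta_coeff_def)

lemma theta_coeff_add1: "q \<noteq> 0 \<Longrightarrow> theta_coeff q (r + 1) = - (q powi r * theta_coeff q r)"
  by (simp add: theta_coeff_def tri_add1 power_int_add)

lemma theta_coeff_neg: "q \<noteq> 0 \<Longrightarrow> theta_coeff q (- r) = q powi r * theta_coeff q r"
  by (simp add: theta_coeff_def tri_neg power_int_add power_int_minus
      flip: power_int_inverse)

lemma theta_coeff_add: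
  "q \<noteq> 0 \<Longrightarrow> theta_coeff q (r + s) = theta_coeff q r * theta_coeff q s * q powi (r * s)"
  by (simp add: theta_coeff_def tri_add power_int_add)

text \<open>The recurrence runs in both directions because powers of \<open>q\<close> are
  invertible, so one value fixes a solution. It serves to recognise an unknown Laurent series as a
  constant times the theta series.\<close>

lemma theta_coeff_unique:
  assumes "q \<noteq> 0" and "\<And>r. d (r + 1) = - (q powi r * d r)"
  shows "d r = d 0 * theta_coeff q r"
proof (induction r rule: int_induct[where k = 0])
  case base then show ?case by simp
next
  case (step1 i) then show ?case by (simp add: assms theta_coeff_add1)
next
  case (step2 i)
  have "- (q powi (i - 1) * d (i - 1)) = - (q powi (i - 1) * (d 0 * theta_coeff q (i - 1)))"
    using assms(2)[of "i - 1"] theta_coeff_add1[OF assms(1), of "i - 1"] step2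
    by (auto simp: mult_ac)
  then show ?case using assms(1) by (simp add: power_int_eq_0_iff)
qed

section \<open>Sums over the integers: reindexing, products, dominated convergence\<close>

lemma has_sum_int_shift:
  "((\<lambda>r :: int. f (r + c)) has_sum S) UNIV \<longleftrightarrow> (f has_sum S) UNIV"
  by (rule has_sum_reindex_bij_witness[of _ "\<lambda>r. r - c" "\<lambda>r. r + c"]) auto

lemma has_sum_int_neg:
  "((\<lambda>r :: int. f (- r)) has_sum S) UNIV \<longleftrightarrow> (f has_sum S) UNIV"
  by (rule has_sum_reindex_bij_witness[of _ uminus uminus]) auto

lemma infsum_int_shift: "(\<Sum>\<^sub>\<infinity>r :: int. f (r + c)) = (\<Sum>\<^sub>\<infinity>r. f r)"
  by (rule infsum_reindex_bij_witness[of _ "\<lambda>r. r - c" "\<lambda>r. r + c"]) auto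

lemma infsum_int_neg: "(\<Sum>\<^sub>\<infinity>r :: int. f (- r)) = (\<Sum>\<^sub>\<infinity>r. f r)"
  by (rule infsum_reindex_bij_witness[of _ uminus uminus]) auto

lemma summable_on_int_real:
  fixes f :: "int \<Rightarrow> real"
  assumes "\<And>r. 0 \<le> f r" "summable (\<lambda>n. f (int n))" "summable (\<lambda>n. f (- int n))"
  shows "f summable_on UNIV"
proof -
  have "(\<lambda>n. f (int n)) summable_on UNIV" "(\<lambda>n. f (- int n)) summable_on UNIV"
    using assms by (auto simp: summable_on_UNIV_nonneg_real_iff)
  moreover have "inj int" "inj (\<lambda>n. - int n)" by (auto simp: inj_def)
  ultimately have "f summable_on range int" "f summable_on range (\<lambda>n. - int n)"
    by (simp_all add: summable_on_reindex o_def)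
  then have "f summable_on (range int \<union> range (\<lambda>n. - int n))"
    by (rule summable_on_union)
  moreover have "range int \<union> range (\<lambda>n. - int n) = UNIV"
    by (metis (no_types, lifting) UNIV_eq_I Un_iff int_cases2 rangeI)
  ultimately show ?thesis by simp
qed

lemma abs_summable_on_times:
  fixes f :: "'a \<Rightarrow> complex" and g :: "'b \<Rightarrow> complex"
  assumes "(\<lambda>r. norm (f r)) summable_on A" "(\<lambda>r. norm (g r)) summable_on B"
  shows "(\<lambda>x. norm (f (fst x) * g (snd x))) summable_on (A \<times> B)"
proof (rule summable_on_SigmaI)
  show "((\<lambda>s. norm (f (fst (r, s)) * g (snd (r, s)))) has_sum
      (norm (f r) * (\<Sum>\<^sub>\<infinity>s\<in>B. norm (g s)))) B" for r
    using assms(2) by (simp add: norm_mult has_sum_cmult_right has_sum_infsum)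
  show "(\<lambda>r. norm (f r) * (\<Sum>\<^sub>\<infinity>s\<in>B. norm (g s))) summable_on A"
    using assms(1) by (rule summable_on_cmult_left)
qed simp

text \<open>Absolute summability of the double series justifies regrouping it along the lines
  \<open>r + s = N\<close>. This yields the Laurent coefficients of a product.\<close>

lemma infsum_cauchy_product_int:
  fixes f g :: "int \<Rightarrow> complex"
  assumes "(\<lambda>r. norm (f r)) summable_on UNIV" "(\<lambda>r. norm (g r)) summable_on UNIV"
  shows "((\<lambda>N. \<Sum>\<^sub>\<infinity>r. f r * g (N - r)) has_sum (infsum f UNIV * infsum g UNIV)) UNIV"
proof -
  have sp: "(\<lambda>(r, s). norm (f r * g s)) summable_on (UNIV \<times> UNIV)"
    using abs_summable_on_times[OF assms] by (simp add: case_prod_unfold)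
  have sp': "(\<lambda>(r, s). f r * g s) summable_on (UNIV \<times> UNIV)"
    by (rule abs_summable_summable) (use sp in \<open>simp add: case_prod_unfold\<close>)
  have p: "infsum f UNIV * infsum g UNIV = (\<Sum>\<^sub>\<infinity>(r, s)\<in>UNIV \<times> UNIV. f r * g s)"
  proof -
    have "(\<Sum>\<^sub>\<infinity>(r, s)\<in>UNIV \<times> UNIV. f r * g s) = (\<Sum>\<^sub>\<infinity>r. \<Sum>\<^sub>\<infinity>s. f r * g s)"
      using sp' by (subst infsum_Sigma'_banach) auto
    then show ?thesis by (simp add: infsum_cmult_right' infsum_cmult_left')
  qed
  then have hs: "((\<lambda>(r, s). f r * g s) has_sum (infsum f UNIV * infsum g UNIV)) (UNIV \<times> UNIV)"
    using sp' by (simp add: has_sum_infsum)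
  have hs2: "((\<lambda>(N, r). f r * g (N - r)) has_sum (infsum f UNIV * infsum g UNIV)) (UNIV \<times> UNIV)"
    by (rule iffD1[OF has_sum_reindex_bij_witness
          [of _ "\<lambda>(N, r). (r, N - r)" "\<lambda>(r, s). (r + s, r)"] hs]) auto
  then have sm: "(\<lambda>(N, r). f r * g (N - r)) summable_on (UNIV \<times> UNIV)"
    by (rule has_sum_imp_summable)
  show ?thesis
  proof (rule has_sum_SigmaD[OF hs2])
    fix N :: int
    have "(\<lambda>r. f r * g (N - r)) summable_on UNIV"
      using summable_on_SigmaD1[of "\<lambda>N r. f r * g (N - r)" UNIV "\<lambda>_. UNIV" N] sm by simp
    then show "((\<lambda>r. (\<lambda>(N, r). f r * g (N - r)) (N, r)) has_sum
        (\<Sum>\<^sub>\<infinity>r. f r * g (N - r))) UNIV" by simp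
  qed
qed

text \<open>Absolutely convergent sums over \<open>A\<close> are integrals for the counting measure,
  so dominated convergence for integrals carries over.\<close>

lemma infsum_dominated:
  fixes f :: "nat \<Rightarrow> 'a \<Rightarrow> complex"
  assumes h: "h summable_on A" and b: "\<And>n r. r \<in> A \<Longrightarrow> norm (f n r) \<le> h r"
    and l: "\<And>r. r \<in> A \<Longrightarrow> (\<lambda>n. f n r) \<longlonglongrightarrow> g r"
  shows "(\<lambda>n. infsum (f n) A) \<longlonglongrightarrow> infsum g A"
proof -
  have b': "norm (g r) \<le> h r" if "r \<in> A" for r
    using b l that by (intro LIMSEQ_le_const2[OF tendsto_norm[OF l]]) auto
  have h0: "0 \<le> h r" if "r \<in> A" for r
    using b[OF that, of 0] norm_ge_zero order_trans by blast
  have int: "infsum k A = (LINT r|count_space A. k r)" if "\<And>r. r \<in> A \<Longrightarrow> norm (k r) \<le> h r"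
    for k :: "'a \<Rightarrow> complex"
  proof -
    have "(\<lambda>r. norm (k r)) summable_on A"
      by (rule summable_on_comparison_test[OF h]) (use that in auto)
    then show ?thesis
      by (metis abs_summable_equivalent infsetsum_def infsetsum_infsum)
  qed
  have "integrable (count_space A) h"
  proof -
    have "(\<lambda>r. norm (h r)) summable_on A"
      using h by (rule summable_on_cong[THEN iffD1, rotated]) (use h0 in auto)
    then show ?thesis by (metis abs_summable_equivalent Infinite_Set_Sum.abs_summable_on_def)
  qed
  then have "(\<lambda>n. LINT r|count_space A. f n r) \<longlonglongrightarrow> (LINT r|count_space A. g r)"
    by (intro integral_dominated_convergence[where w = h]) (use b l in \<open>auto simp: AE_count_space\<close>)
  then show ?thesis by (simp only: int[OF b] int[OF b'])
qed

text \<open>The ratio of consecutive terms is \<open>c ^ n * d\<close>, which tends to 0 however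
  large \<open>d\<close> is.\<close>

lemma summable_square_powers:
  fixes c :: real
  assumes "0 < c" "c < 1" "0 \<le> d"
  shows "summable (\<lambda>n. c powi tri (int n) * d ^ n)"
proof (cases "d = 0")
  case True
  then show ?thesis by (intro summable_finite[of "{0}"]) auto
next
  case False
  have "(\<lambda>n. c ^ n * d) \<longlonglongrightarrow> 0 * d"
    using assms by (intro tendsto_mult LIMSEQ_power_zero) auto
  then have "eventually (\<lambda>n. c ^ n * d < 1 / 2) sequentially"
    by (rule order_tendstoD) simp
  then obtain N where N: "\<And>n. n \<ge> N \<Longrightarrow> c ^ n * d < 1 / 2"
    by (auto simp: eventually_sequentially)
  show ?thesis
  proof (rule summable_ratio_test[of "1 / 2" N])
    fix n assume n: "n \<ge> N"
    have "c powi tri (int (Suc n)) * d ^ Suc n = (c ^ n * d) * (c powi tri (int n) * d ^ n)"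
      using tri_add1[of "int n"] assms by (simp add: power_int_add add.commute)
    also have "norm \<dots> \<le> 1 / 2 * norm (c powi tri (int n) * d ^ n)"
      unfolding norm_mult[of "c ^ n * d"]
      using N[OF n] assms by (intro mult_right_mono) auto
    finally show "norm (c powi tri (int (Suc n)) * d ^ Suc n)
        \<le> 1 / 2 * norm (c powi tri (int n) * d ^ n)" .
  qed auto
qed

section \<open>Infinite products and theta functions in one base: zeros, quasi-periodicity,
  bounds\<close>

locale nome =
  fixes q :: complex
  assumes q_nz: "q \<noteq> 0" and q_lt1: "norm q < 1"
begin

declare q_nz [simp]

lemma q_pos: "0 < norm q"
  using q_nz by simp

lemma q_powi_nz [simp]: "q powi k \<noteq> 0"
  using q_nz by (simp add: power_int_eq_0_iff)

lemma norm_theta_coeff: "norm (theta_coeff q r) = norm q powi tri r"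
  using q_nz by (simp add: theta_coeff_def norm_mult norm_power_int)

lemma theta_coeff_nz [simp]: "theta_coeff q r \<noteq> 0"
  using q_nz by (simp add: theta_coeff_def)

text \<open>In modulus, the half with negative indices is the positive half with
  \<open>q / w\<close> in place of \<open>w\<close>.\<close>

lemma theta_abs_summable:
  assumes "w \<noteq> 0"
  shows "(\<lambda>r. norm (theta_coeff q r * w powi r)) summable_on UNIV"
proof (rule summable_on_int_real)
  show "summable (\<lambda>n. norm (theta_coeff q (int n) * w powi int n))"
    using summable_square_powers[OF q_pos q_lt1, of "norm w"]
    by (simp add: norm_mult norm_theta_coeff norm_power)
  have "norm (theta_coeff q (- int n) * w powi (- int n))
      = norm q powi tri (int n) * norm (q / w) ^ n" for n
    using q_nz assms
    by (simp add: theta_coeff_neg norm_mult norm_theta_coeff norm_power power_int_minus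
        norm_inverse norm_divide field_simps)
  then show "summable (\<lambda>n. norm (theta_coeff q (- int n) * w powi (- int n)))"
    using summable_square_powers[OF q_pos q_lt1, of "norm (q / w)"] by simp
qed simp

lemma theta_bounded_summable:
  assumes "w \<noteq> 0" "\<And>r. norm (c r) \<le> K"
  shows "(\<lambda>r. norm (theta_coeff q r * w powi r * c r)) summable_on UNIV"
proof (rule summable_on_comparison_test)
  show "(\<lambda>r. norm (theta_coeff q r * w powi r) * K) summable_on UNIV"
    using theta_abs_summable[OF assms(1)] by (rule summable_on_cmult_left)
qed (use assms in \<open>auto simp: norm_mult intro!: mult_left_mono\<close>)

lemma qpoch_convergent: "convergent_prod (\<lambda>k. 1 - x * q ^ k)"
proof (rule abs_convergent_prod_imp_convergent_prod)
  have "summable (\<lambda>k. norm x * norm q ^ k)"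
    using q_lt1 by (intro summable_mult summable_geometric) auto
  then show "abs_convergent_prod (\<lambda>k. 1 - x * q ^ k)"
    by (simp add: abs_convergent_prod_conv_summable norm_mult norm_power)
qed

lemma qfac_tendsto: "(\<lambda>n. qfac x q n) \<longlonglongrightarrow> qpoch_inf x q"
  using convergent_prod_LIMSEQ[OF qpoch_convergent[of x]]
  unfolding qpoch_inf_def qfac_def
  by (subst filterlim_sequentially_Suc[symmetric]) (simp add: lessThan_Suc_atMost)

lemma qpoch_inf_rec: "qpoch_inf x q = (1 - x) * qpoch_inf (x * q) q"
proof (rule LIMSEQ_unique)
  show "(\<lambda>n. qfac x q (Suc n)) \<longlonglongrightarrow> qpoch_inf x q"
    using qfac_tendsto by (rule LIMSEQ_Suc)
  show "(\<lambda>n. qfac x q (Suc n)) \<longlonglongrightarrow> (1 - x) * qpoch_inf (x * q) q"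
    unfolding qfac_Suc' by (intro tendsto_intros qfac_tendsto)
qed

lemma qpoch_inf_eq_0_iff: "qpoch_inf x q = 0 \<longleftrightarrow> (\<exists>k. x * q ^ k = 1)"
proof
  assume "qpoch_inf x q = 0"
  then show "\<exists>k. x * q ^ k = 1"
    using prodinf_nonzero[OF qpoch_convergent[of x]] unfolding qpoch_inf_def by auto
next
  assume "\<exists>k. x * q ^ k = 1"
  then obtain k where k: "x * q ^ k = 1" by blast
  have "qfac x q n = 0" if "n > k" for n
    unfolding qfac_def using k that by (auto intro: bexI[of _ k])
  then have "eventually (\<lambda>n. qfac x q n = 0) sequentially"
    by (rule eventually_mono[OF eventually_gt_at_top[of k]])
  then have "(\<lambda>n. qfac x q n) \<longlonglongrightarrow> 0" by (rule tendsto_eventually)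
  with qfac_tendsto show "qpoch_inf x q = 0" by (rule LIMSEQ_unique)
qed

lemma q_power_neq_1: "q * q ^ k \<noteq> 1"
proof
  assume "q * q ^ k = 1"
  then have "norm q ^ Suc k = 1" by (metis norm_one norm_power power_Suc)
  then show False using q_lt1 power_Suc_less_one[of "norm q" k] q_pos by simp
qed

lemma qpoch_qq_nz: "qpoch_inf q q \<noteq> 0"
  using q_power_neq_1 by (simp add: qpoch_inf_eq_0_iff)

lemma qfac_bounded: obtains K where "K > 0" "\<And>n. norm (qfac x q n) \<le> K"
  using convergent_imp_Bseq[OF convergentI[OF qfac_tendsto[of x]]] by (auto elim: BseqE)

lemma inverse_qfac_bounded:
  assumes "\<And>k. x * q ^ k \<noteq> 1"
  obtains K where "K > 0" "\<And>n. norm (1 / qfac x q n) \<le> K"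
proof -
  have "qpoch_inf x q \<noteq> 0" using assms by (simp add: qpoch_inf_eq_0_iff)
  then have "(\<lambda>n. 1 / qfac x q n) \<longlonglongrightarrow> 1 / qpoch_inf x q"
    by (intro tendsto_intros qfac_tendsto)
  from convergent_imp_Bseq[OF convergentI[OF this]] show ?thesis
    using that by (auto elim: BseqE)
qed

text \<open>The first infinite factor vanishes at the powers with \<open>k \<le> 0\<close>, the
  second at those with \<open>k \<ge> 1\<close>, and the third factor is never zero.\<close>

lemma jtheta_eq_0_iff:
  assumes "z \<noteq> 0"
  shows "jtheta z q = 0 \<longleftrightarrow> (\<exists>k :: int. z = q powi k)"
proof
  assume "jtheta z q = 0"
  then have "(\<exists>k. z * q ^ k = 1) \<or> (\<exists>k. q / z * q ^ k = 1)"
    using qpoch_qq_nz by (auto simp: jtheta_def qpoch_inf_eq_0_iff)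
  then show "\<exists>k :: int. z = q powi k"
  proof
    assume "\<exists>k. z * q ^ k = 1"
    then obtain k where "z * q ^ k = 1" by blast
    then have "z = q powi (- int k)"
      using q_nz by (simp add: power_int_minus field_simps)
    then show ?thesis by blast
  next
    assume "\<exists>k. q / z * q ^ k = 1"
    then obtain k where "q / z * q ^ k = 1" by blast
    then have "z = q powi (int (Suc k))"
      using assms by (simp add: field_simps del: of_nat_Suc)
    then show ?thesis by blast
  qed
next
  assume "\<exists>k :: int. z = q powi k"
  then obtain k where k: "z = q powi k" by blast
  show "jtheta z q = 0"
  proof (cases "k \<le> 0")
    case True
    then have "z * q ^ nat (- k) = 1"
      using k q_nz by (simp add: power_int_def field_simps)
    then show ?thesis unfolding jtheta_def using qpoch_inf_eq_0_iff[of z] by auto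
  next
    case False
    then have "q / z * q ^ nat (k - 1) = 1"
      using k q_nz by (simp add: power_int_def nat_diff_distrib flip: power_Suc)
    then show ?thesis unfolding jtheta_def using qpoch_inf_eq_0_iff[of "q / z"] by auto
  qed
qed

lemma jtheta_1 [simp]: "jtheta 1 q = 0"
  using jtheta_eq_0_iff[of 1] by (metis power_int_0_right zero_neq_one)

lemma jtheta_reflect: "z \<noteq> 0 \<Longrightarrow> jtheta (q / z) q = jtheta z q"
  using q_nz by (simp add: jtheta_def)

lemma jtheta_qmult:
  assumes "z \<noteq> 0"
  shows "jtheta (q * z) q = - jtheta z q / z"
proof -
  have 1: "qpoch_inf z q = (1 - z) * qpoch_inf (q * z) q"
    using qpoch_inf_rec[of z] by (simp add: mult.commute)
  have 2: "qpoch_inf (1 / z) q = (1 - 1 / z) * qpoch_inf (q / z) q"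
    using qpoch_inf_rec[of "1 / z"] by (simp add: mult.commute)
  have "q / (q * z) = 1 / z" using q_nz by simp
  then have "jtheta (q * z) q = qpoch_inf (q * z) q * qpoch_inf (1 / z) q * qpoch_inf q q"
    by (simp add: jtheta_def)
  also have "\<dots> = - jtheta z q / z"
    unfolding jtheta_def 1 2 using assms by (simp add: field_simps)
  finally show ?thesis .
qed

lemma jtheta_inverse:
  assumes "z \<noteq> 0"
  shows "jtheta (1 / z) q = - jtheta z q / z"
  using jtheta_reflect[of "q * z"] jtheta_qmult[OF assms] assms q_nz by simp

text \<open>This iterates \<open>j(q z) = - j(z) / z\<close>. The accumulated factor is the
  reciprocal of the \<open>n\<close>-th term of the theta series, so such shifts can be absorbed
  into summation indices.\<close>

lemma jtheta_powi_mult: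
  assumes "z \<noteq> 0"
  shows "jtheta (q powi n * z) q * theta_coeff q n * z powi n = jtheta z q"
proof (induction n rule: int_induct[where k = 0])
  case base then show ?case by simp
next
  case (step1 i)
  have J: "jtheta (q powi (i + 1) * z) q = - jtheta (q powi i * z) q / (q powi i * z)"
    using jtheta_qmult[of "q powi i * z"] assms q_nz by (simp add: power_int_add mult_ac)
  have Z: "z powi (i + 1) = z powi i * z"
    using assms by (simp add: power_int_add)
  show ?case
    unfolding J Z theta_coeff_add1[OF q_nz] step1(2)[symmetric]
    using q_nz assms by simp
next
  case (step2 i)
  have J: "jtheta (q powi i * z) q = - jtheta (q powi (i - 1) * z) q / (q powi (i - 1) * z)"
    using jtheta_qmult[of "q powi (i - 1) * z"] assms q_nz
    by (simp add: power_int_diff field_simps)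
  have T: "theta_coeff q i = - (q powi (i - 1) * theta_coeff q (i - 1))"
    using theta_coeff_add1[OF q_nz, of "i - 1"] by simp
  have Z: "z powi i = z powi (i - 1) * z"
    using assms by (simp add: power_int_diff)
  show ?case
    using step2(2) assms q_nz unfolding J T Z by (simp add: mult.assoc)
qed

text \<open>The quotient tends to 1 for \<open>r\<close> going to infinity and, if \<open>y\<close>
  is nonzero, to 0 in the other direction. Series with such denominators are then dominated by the
  same series without them.\<close>

lemma inverse_one_minus_powi_bounded:
  assumes "\<And>k :: int. y \<noteq> q powi k"
  obtains K where "K > 0" "\<And>r :: int. norm (1 / (1 - q powi r * y)) \<le> K"
proof -
  have ne: "1 - q powi r * y \<noteq> 0" for r
  proof
    assume "1 - q powi r * y = 0"
    then have "y = q powi (- r)" by (metis eq_iff_diff_eq_0 power_int_minus inverse_unique mult.commute)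
    then show False using assms by blast
  qed
  have "(\<lambda>n. 1 / (1 - q ^ n * y)) \<longlonglongrightarrow> 1 / (1 - 0 * y)"
    using q_lt1 by (intro tendsto_intros LIMSEQ_power_zero) auto
  from convergent_imp_Bseq[OF convergentI[OF this]]
  obtain K1 where K1: "K1 > 0" "\<And>n. norm (1 / (1 - q ^ n * y)) \<le> K1" by (auto elim: BseqE)
  obtain K2 where K2: "K2 > 0" "\<And>n. norm (1 / (1 - q powi (- int n) * y)) \<le> K2"
  proof (cases "y = 0")
    case True then show ?thesis using that[of 1] by simp
  next
    case False
    have "(\<lambda>n. q ^ n / (q ^ n - y)) \<longlonglongrightarrow> 0 / (0 - y)"
      using q_lt1 False by (intro tendsto_intros LIMSEQ_power_zero) auto
    moreover have "q ^ n / (q ^ n - y) = 1 / (1 - q powi (- int n) * y)" for n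
      using q_nz ne[of "- int n"] by (simp add: power_int_minus field_simps)
    ultimately have "(\<lambda>n. 1 / (1 - q powi (- int n) * y)) \<longlonglongrightarrow> 0 / (0 - y)" by simp
    from convergent_imp_Bseq[OF convergentI[OF this]] that show ?thesis by (auto elim: BseqE)
  qed
  have "norm (1 / (1 - q powi r * y)) \<le> max K1 K2" for r
  proof (cases r rule: int_cases2)
    case (nonneg n) then show ?thesis using K1(2)[of n] by simp
  next
    case (nonpos n) then show ?thesis using K2(2)[of n] by (simp add: max.coboundedI2)
  qed
  then show ?thesis using that[of "max K1 K2"] K1(1) by auto
qed

end

section \<open>The triple product and the reciprocal of a theta function\<close>

lemma has_sum_cmult_cancel:
  fixes c :: complex
  assumes "((\<lambda>x. c * f x) has_sum c * S) A" "c \<noteq> 0"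
  shows "(f has_sum S) A"
  using has_sum_cmult_right[OF assms(1), of "1 / c"] assms(2) by simp

lemma has_sum_diff:
  fixes f g :: "'a \<Rightarrow> complex"
  assumes "(f has_sum S) A" "(g has_sum T) A"
  shows "((\<lambda>x. f x - g x) has_sum (S - T)) A"
  using has_sum_add[OF assms(1) has_sum_uminusI[OF assms(2)]] by simp

text \<open>The coefficient \<open>1 / ((q;q)\<^sub>n\<^sub>-\<^sub>r (q;q)\<^sub>n\<^sub>+\<^sub>r)\<close>, extended by \<open>0\<close> to all integers \<open>r\<close>: with this
  convention the recurrences below hold without boundary cases.\<close>

definition bfac :: "complex \<Rightarrow> nat \<Rightarrow> int \<Rightarrow> complex" where
  "bfac q n r = (if \<bar>r\<bar> \<le> int n
     then 1 / (qfac q q (nat (int n - r)) * qfac q q (nat (int n + r))) else 0)"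

lemma bfac_minus: "bfac q n (- r) = bfac q n r"
  by (simp add: bfac_def mult.commute)

context nome
begin

text \<open>For \<open>|r| \<le> n\<close> this is \<open>qfac_Suc\<close>, used twice. At
  \<open>|r| = n + 1\<close> the left side is 0 by convention, and on the right one factor is
  \<open>1 - q powi 0\<close>.\<close>

lemma bfac_Suc:
  "bfac q n r = (1 - q powi (int n + 1 - r)) * (1 - q powi (int n + 1 + r)) * bfac q (Suc n) r"
proof -
  consider "\<bar>r\<bar> \<le> int n" | "r = int n + 1" | "r = - int n - 1" | "\<bar>r\<bar> > int n + 1" by linarith
  then show ?thesis
  proof cases
    case 1
    define i j where "i = nat (int n - r)" and "j = nat (int n + r)"
    have ij: "nat (int (Suc n) - r) = Suc i" "nat (int (Suc n) + r) = Suc j"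
      using 1 by (auto simp: i_def j_def)
    have e: "int n + 1 - r = int (Suc i)" "int n + 1 + r = int (Suc j)"
      using 1 by (auto simp: i_def j_def)
    have p: "q powi (int n + 1 - r) = q * q ^ i" "q powi (int n + 1 + r) = q * q ^ j"
      unfolding e by (simp_all only: power_int_of_nat power_Suc)
    have "1 - q * q ^ i \<noteq> 0" "1 - q * q ^ j \<noteq> 0" using q_power_neq_1 by auto
    then show ?thesis
      unfolding bfac_def ij p using 1
      by (simp add: qfac_Suc i_def[symmetric] j_def[symmetric])
  qed (auto simp: bfac_def)
qed

lemma bfac_pred:
  "bfac q n (r - 1) = (1 - q powi (int n + r)) * (1 - q powi (int n + 1 + r)) * bfac q (Suc n) r"
proof -
  consider "\<bar>r - 1\<bar> \<le> int n" | "r = - int n" | "r = - int n - 1" | "\<bar>r\<bar> > int n + 1" by linarith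
  then show ?thesis
  proof cases
    case 1
    define i j where "i = nat (int n - (r - 1))" and "j = nat (int n + (r - 1))"
    have ij: "nat (int (Suc n) - r) = i" "nat (int (Suc n) + r) = Suc (Suc j)"
      using 1 by (auto simp: i_def j_def)
    have e: "int n + r = int (Suc j)" "int n + 1 + r = int (Suc (Suc j))"
      using 1 by (auto simp: j_def)
    have p: "q powi (int n + r) = q * q ^ j" "q powi (int n + 1 + r) = q * q ^ Suc j"
      unfolding e by (simp_all only: power_int_of_nat power_Suc)
    have "1 - q * q ^ j \<noteq> 0" "1 - q * q ^ Suc j \<noteq> 0"
      using q_power_neq_1[of j] q_power_neq_1[of "Suc j"] by auto
    moreover have "\<bar>r\<bar> \<le> int (Suc n)" using 1 by linarith
    ultimately show ?thesis
      unfolding bfac_def ij p using 1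
      by (simp add: qfac_Suc i_def[symmetric] j_def[symmetric])
  qed (auto simp: bfac_def)
qed

lemma bfac_succ:
  "bfac q n (r + 1) = (1 - q powi (int n - r)) * (1 - q powi (int n + 1 - r)) * bfac q (Suc n) r"
  using bfac_pred[of n "- r"] bfac_minus[of q n "r + 1"] by (simp add: bfac_minus)

lemma bfac_bounded: obtains K where "K > 0" "\<And>n r. norm (bfac q n r) \<le> K"
proof -
  obtain K where K: "K > 0" "\<And>n. norm (1 / qfac q q n) \<le> K"
    using inverse_qfac_bounded[of q] q_power_neq_1 by blast
  have "norm (bfac q n r) \<le> K * K" for n r
  proof (cases "\<bar>r\<bar> \<le> int n")
    case True
    then have "norm (bfac q n r) = norm (1 / qfac q q (nat (int n - r))) *
        norm (1 / qfac q q (nat (int n + r)))"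
      by (simp add: bfac_def norm_mult norm_divide)
    also have "\<dots> \<le> K * K" using K by (intro mult_mono) auto
    finally show ?thesis .
  qed (use K in \<open>auto simp: bfac_def\<close>)
  then show ?thesis using that[of "K * K"] K by auto
qed

lemma bfac_tendsto: "(\<lambda>n. bfac q n r) \<longlonglongrightarrow> 1 / qpoch_inf q q ^ 2"
proof -
  have "filterlim (\<lambda>n. nat (int n - r)) sequentially sequentially"
    unfolding filterlim_at_top
  proof
    fix Z show "eventually (\<lambda>n. Z \<le> nat (int n - r)) sequentially"
      using eventually_ge_at_top[of "Z + nat \<bar>r\<bar>"] by eventually_elim linarith
  qed
  moreover have "filterlim (\<lambda>n. nat (int n + r)) sequentially sequentially"
    unfolding filterlim_at_top
  proof
    fix Z show "eventually (\<lambda>n. Z \<le> nat (int n + r)) sequentially"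
      using eventually_ge_at_top[of "Z + nat \<bar>r\<bar>"] by eventually_elim linarith
  qed
  ultimately have "(\<lambda>n. 1 / (qfac q q (nat (int n - r)) * qfac q q (nat (int n + r))))
      \<longlonglongrightarrow> 1 / (qpoch_inf q q * qpoch_inf q q)"
    using qpoch_qq_nz by (intro tendsto_intros filterlim_compose[OF qfac_tendsto]) auto
  moreover have "eventually (\<lambda>n. bfac q n r =
      1 / (qfac q q (nat (int n - r)) * qfac q q (nat (int n + r)))) sequentially"
    using eventually_ge_at_top[of "nat \<bar>r\<bar>"]
    by eventually_elim (simp add: bfac_def nat_le_iff)
  ultimately show ?thesis by (simp add: tendsto_cong power2_eq_square)
qed

text \<open>A symmetric form of the q-binomial theorem. The new factor
  \<open>(1 - z q^n) (1 - q^(n+1) / z)\<close> expands to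
  \<open>1 + q^(2n+1) - z q^n - q^(n+1) / z\<close>, so the induction step combines the terms at
  \<open>r\<close>, \<open>r - 1\<close> and \<open>r + 1\<close>.\<close>

lemma finite_triple_product:
  assumes "z \<noteq> 0"
  shows "((\<lambda>r. theta_coeff q r * z powi r * bfac q n r) has_sum
     (qfac z q n * qfac (q / z) q n / qfac q q (2 * n))) UNIV"
proof (induction n)
  case 0
  have "((\<lambda>r. theta_coeff q r * z powi r * bfac q 0 r) has_sum
      (\<Sum>r\<in>{0}. theta_coeff q r * z powi r * bfac q 0 r)) UNIV"
    by (rule has_sum_finite_neutralI[where B = "{0}"]) (auto simp: bfac_def)
  then show ?case by (simp add: bfac_def)
next
  case (Suc n)
  let ?t = "\<lambda>n r. theta_coeff q r * z powi r * bfac q n r"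
  let ?g = "\<lambda>r. (1 + q ^ (2 * n + 1)) * ?t n r + (- (z * q ^ n) * ?t n (r - 1)
      + - (q ^ Suc n / z) * ?t n (r + 1))"
  let ?S = "qfac z q n * qfac (q / z) q n / qfac q q (2 * n)"
  have "((\<lambda>r. ?t n (r + 1)) has_sum ?S) UNIV"
    using Suc has_sum_int_shift[of "?t n" 1 ?S] by blast
  moreover have "((\<lambda>r. ?t n (r - 1)) has_sum ?S) UNIV"
    using Suc has_sum_int_shift[of "?t n" "-1" ?S] by simp
  ultimately have "(?g has_sum
      ((1 + q ^ (2 * n + 1)) * ?S + (- (z * q ^ n) * ?S + - (q ^ Suc n / z) * ?S))) UNIV"
    using Suc by (intro has_sum_add has_sum_cmult_right) auto
  also have "(1 + q ^ (2 * n + 1)) * ?S + (- (z * q ^ n) * ?S + - (q ^ Suc n / z) * ?S)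
      = (1 - z * q ^ n) * (1 - q / z * q ^ n) * ?S"
  proof -
    have "(1 + q ^ (2 * n + 1)) - z * q ^ n - q ^ Suc n / z = (1 - z * q ^ n) * (1 - q / z * q ^ n)"
      using assms by (simp add: field_simps) (simp add: mult_2_right power_add)
    moreover have "A * S + (- B * S + - C * S) = (A - B - C) * S" for A B C S :: complex
      by (simp add: algebra_simps)
    ultimately show ?thesis by (simp only:)
  qed
  also have "?g
      = (\<lambda>r. (1 - q ^ (2 * n + 1)) * (1 - q ^ (2 * n + 2)) * ?t (Suc n) r)"
  proof
    fix r :: int
    \<comment> \<open>Since \<open>a * b = q ^ (2 * n + 2)\<close>, the three neighbouring
      coefficients are \<open>\<beta>\<close> times polynomials in \<open>a\<close>,
      \<open>b\<close> and \<open>1 / q\<close>, and the induction step becomes a single identity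
      between such polynomials.\<close>
    define a b \<beta> where "a = q powi (int n + 1 - r)" and "b = q powi (int n + 1 + r)"
      and "\<beta> = bfac q (Suc n) r"
    have ab: "q ^ (2 * n + 2) = a * b" "q ^ (2 * n + 1) = a * b / q"
    proof -
      have "a * b = q powi int (2 * n + 2)"
        using q_nz power_int_add[of q "int n + 1 - r" "int n + 1 + r"]
        by (simp only: a_def b_def simp_thms) (simp add: algebra_simps)
      then show "q ^ (2 * n + 2) = a * b" by (simp only: power_int_of_nat)
      then show "q ^ (2 * n + 1) = a * b / q" using q_nz by (simp add: field_simps)
    qed
    have B: "bfac q n r = (1 - a) * (1 - b) * \<beta>" "bfac q n (r - 1) = (1 - b / q) * (1 - b) * \<beta>"
      "bfac q n (r + 1) = (1 - a / q) * (1 - a) * \<beta>"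
    proof -
      show "bfac q n r = (1 - a) * (1 - b) * \<beta>"
        unfolding a_def b_def \<beta>_def by (rule bfac_Suc)
      have "b / q = q powi (int n + r)" "a / q = q powi (int n - r)"
        unfolding a_def b_def using q_nz by (simp_all add: power_int_diff power_int_add)
      then show "bfac q n (r - 1) = (1 - b / q) * (1 - b) * \<beta>"
        "bfac q n (r + 1) = (1 - a / q) * (1 - a) * \<beta>"
        unfolding a_def b_def \<beta>_def by (simp_all only: bfac_pred bfac_succ)
    qed
    have T: "z * q ^ n * (theta_coeff q (r - 1) * z powi (r - 1)) = - (a * (theta_coeff q r * z powi r))"
    proof -
      have "theta_coeff q r = - (q powi (r - 1) * theta_coeff q (r - 1))"
        using theta_coeff_add1[OF q_nz, of "r - 1"] by simp
      moreover have "z powi r = z * z powi (r - 1)"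
        using assms by (simp add: power_int_diff)
      moreover have "a * q powi (r - 1) = q ^ n"
        unfolding a_def using q_nz by (simp flip: power_int_add)
      ultimately show ?thesis by (simp add: mult_ac)
    qed
    have T': "q ^ Suc n / z * (theta_coeff q (r + 1) * z powi (r + 1)) = - (b * (theta_coeff q r * z powi r))"
    proof -
      have "z powi (r + 1) = z * z powi r"
        using assms by (simp add: power_int_add)
      moreover have "b = q ^ Suc n * q powi r"
      proof -
        have "b = q powi (int (Suc n) + r)" by (simp add: b_def add_ac)
        then show ?thesis using q_nz by (simp only: power_int_add power_int_of_nat simp_thms)
      qed
      ultimately show ?thesis using assms by (simp add: theta_coeff_add1[OF q_nz] mult_ac)
    qed
    have "?g r
      = (1 + q ^ (2 * n + 1)) * ?t n r
        - (z * q ^ n * (theta_coeff q (r - 1) * z powi (r - 1))) * bfac q n (r - 1)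
        - (q ^ Suc n / z * (theta_coeff q (r + 1) * z powi (r + 1))) * bfac q n (r + 1)"
      by (simp add: mult_ac)
    also have "\<dots> = theta_coeff q r * z powi r * ((1 + a * b / q) * ((1 - a) * (1 - b) * \<beta>)
        + a * ((1 - b / q) * (1 - b) * \<beta>) + b * ((1 - a / q) * (1 - a) * \<beta>))"
    proof -
      have "A * (t * X) - - (a * t) * Y - - (b * t) * Z = t * (A * X + a * Y + b * Z)"
        for A t X Y Z :: complex
        by (simp add: algebra_simps)
      then show ?thesis unfolding T T' B ab by (simp only:)
    qed
    also have "(1 + a * b / q) * ((1 - a) * (1 - b) * \<beta>)
        + a * ((1 - b / q) * (1 - b) * \<beta>) + b * ((1 - a / q) * (1 - a) * \<beta>)
        = (1 - a * b / q) * (1 - a * b) * \<beta>"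
      using q_nz by (simp add: field_simps)
    finally show "?g r = (1 - q ^ (2 * n + 1)) * (1 - q ^ (2 * n + 2)) * ?t (Suc n) r"
      unfolding ab \<beta>_def by (simp add: mult_ac)
  qed
  finally have h: "((\<lambda>r. (1 - q ^ (2 * n + 1)) * (1 - q ^ (2 * n + 2)) * ?t (Suc n) r) has_sum
      (1 - z * q ^ n) * (1 - q / z * q ^ n) * ?S) UNIV" .
  have nz: "(1 - q ^ (2 * n + 1)) * (1 - q ^ (2 * n + 2)) \<noteq> 0"
    using q_power_neq_1[of "2 * n"] q_power_neq_1[of "2 * n + 1"] by auto
  have "(1 - z * q ^ n) * (1 - q / z * q ^ n) * ?S = (1 - q ^ (2 * n + 1)) * (1 - q ^ (2 * n + 2)) *
      (qfac z q (Suc n) * qfac (q / z) q (Suc n) / qfac q q (2 * Suc n))"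
    using nz by (simp add: qfac_Suc)
  with h have "((\<lambda>r. (1 - q ^ (2 * n + 1)) * (1 - q ^ (2 * n + 2)) * ?t (Suc n) r) has_sum
      (1 - q ^ (2 * n + 1)) * (1 - q ^ (2 * n + 2)) *
      (qfac z q (Suc n) * qfac (q / z) q (Suc n) / qfac q q (2 * Suc n))) UNIV" by simp
  then show ?case using nz by (rule has_sum_cmult_cancel)
qed

theorem jacobi_triple_product:
  assumes "z \<noteq> 0"
  shows "((\<lambda>r. theta_coeff q r * z powi r) has_sum jtheta z q) UNIV"
proof -
  obtain K where K: "K > 0" "\<And>n r. norm (bfac q n r) \<le> K" using bfac_bounded by blast
  have lim1: "(\<lambda>n. \<Sum>\<^sub>\<infinity>r. theta_coeff q r * z powi r * bfac q n r)
      \<longlonglongrightarrow> (\<Sum>\<^sub>\<infinity>r. theta_coeff q r * z powi r * (1 / qpoch_inf q q ^ 2))"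
  proof (rule infsum_dominated)
    show "(\<lambda>r. norm (theta_coeff q r * z powi r) * K) summable_on UNIV"
      using theta_abs_summable[OF assms] by (rule summable_on_cmult_left)
    show "norm (theta_coeff q r * z powi r * bfac q n r)
        \<le> norm (theta_coeff q r * z powi r) * K" for n r
      unfolding norm_mult[of "theta_coeff q r * z powi r"]
      using K by (intro mult_left_mono) auto
    show "(\<lambda>n. theta_coeff q r * z powi r * bfac q n r)
        \<longlonglongrightarrow> theta_coeff q r * z powi r * (1 / qpoch_inf q q ^ 2)" for r
      by (intro tendsto_intros bfac_tendsto)
  qed
  have "(\<lambda>n. qfac z q n * qfac (q / z) q n / qfac q q (2 * n))
      \<longlonglongrightarrow> qpoch_inf z q * qpoch_inf (q / z) q / qpoch_inf q q"
    using qpoch_qq_nz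
    by (intro tendsto_intros qfac_tendsto filterlim_compose[OF qfac_tendsto]
        filterlim_subseq) (auto simp: strict_mono_def)
  moreover have "(\<Sum>\<^sub>\<infinity>r. theta_coeff q r * z powi r * bfac q n r)
      = qfac z q n * qfac (q / z) q n / qfac q q (2 * n)" for n
    using finite_triple_product[OF assms] by (rule infsumI)
  ultimately have "(\<Sum>\<^sub>\<infinity>r. theta_coeff q r * z powi r * (1 / qpoch_inf q q ^ 2))
      = qpoch_inf z q * qpoch_inf (q / z) q / qpoch_inf q q"
    using lim1 LIMSEQ_unique by auto
  then have "(\<Sum>\<^sub>\<infinity>r. theta_coeff q r * z powi r) = jtheta z q"
    using qpoch_qq_nz
    by (simp only: infsum_cmult_left') (simp add: jtheta_def field_simps power2_eq_square)
  then show ?thesis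
    using abs_summable_summable[OF theta_abs_summable[OF assms]] has_sum_infsum by metis
qed

text \<open>Induction replaces the computation of residues. Multiplying the sum for
  \<open>n + 1\<close> by the two new factors gives the sum for \<open>n\<close> plus terms without
  the denominators \<open>1 - z q^r\<close>; these form the finite triple products at
  \<open>1\<close> and at \<open>q\<close>, and both are zero.\<close>

lemma finite_partial_fractions:
  assumes "z \<noteq> 0" "\<And>k :: int. z \<noteq> q powi k"
  shows "((\<lambda>r. theta_coeff q r * q powi r / (1 - z * q powi r) * bfac q n r) has_sum
     1 / ((1 - z) * qfac (z * q) q n * qfac (q / z) q n)) UNIV"
proof (induction n)
  case 0
  have "((\<lambda>r. theta_coeff q r * q powi r / (1 - z * q powi r) * bfac q 0 r) has_sum
      (\<Sum>r\<in>{0}. theta_coeff q r * q powi r / (1 - z * q powi r) * bfac q 0 r)) UNIV"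
    by (rule has_sum_finite_neutralI[where B = "{0}"]) (auto simp: bfac_def)
  then show ?case by (simp add: bfac_def)
next
  case (Suc n)
  let ?s = "\<lambda>n r. theta_coeff q r * q powi r / (1 - z * q powi r) * bfac q n r"
  define N where "N = Suc n"
  have ne: "1 - z * q powi r \<noteq> 0" for r
  proof
    assume "1 - z * q powi r = 0"
    then have "z = q powi (- r)" by (metis eq_iff_diff_eq_0 power_int_minus inverse_unique mult.commute)
    then show False using assms by blast
  qed
  \<comment> \<open>Here \<open>N > 0\<close> matters: the product at \<open>1\<close>, like the one
    at \<open>q\<close>, contains the factor \<open>1 - 1\<close>.\<close>
  have A: "((\<lambda>r. theta_coeff q r * bfac q N r) has_sum 0) UNIV"
    using finite_triple_product[of 1 N] by (simp add: N_def qfac_Suc')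
  have B: "((\<lambda>r. theta_coeff q r * q powi r * bfac q N r) has_sum 0) UNIV"
    using finite_triple_product[of q N] q_nz by (simp add: N_def qfac_Suc')
  have "((\<lambda>r. ?s n r + q ^ N * (theta_coeff q r * bfac q N r)
      + - (q ^ N / z) * (theta_coeff q r * q powi r * bfac q N r)) has_sum
      (1 / ((1 - z) * qfac (z * q) q n * qfac (q / z) q n) + q ^ N * 0 + - (q ^ N / z) * 0)) UNIV"
    by (intro has_sum_add has_sum_cmult_right A B Suc)
  also have "(\<lambda>r. ?s n r + q ^ N * (theta_coeff q r * bfac q N r)
      + - (q ^ N / z) * (theta_coeff q r * q powi r * bfac q N r))
      = (\<lambda>r. (1 - z * q ^ N) * (1 - q ^ N / z) * ?s N r)"
  proof
    fix r
    define y c where "y = q powi r" and "c = q ^ N"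
    have y: "y \<noteq> 0" unfolding y_def by (rule q_powi_nz)
    have "q powi (int n + 1 - r) = c / y" "q powi (int n + 1 + r) = c * y"
      unfolding c_def y_def N_def using q_nz
      by (simp_all add: power_int_add power_int_diff mult_ac)
    then have B: "bfac q n r = (1 - c / y) * (1 - c * y) * bfac q N r"
      using bfac_Suc[of n r] by (simp add: N_def)
    show "?s n r + q ^ N * (theta_coeff q r * bfac q N r)
      + - (q ^ N / z) * (theta_coeff q r * q powi r * bfac q N r)
      = (1 - z * q ^ N) * (1 - q ^ N / z) * ?s N r"
      using ne[of r] y assms(1) unfolding y_def[symmetric] c_def[symmetric] B
      by (simp add: field_simps)
  qed
  finally have h: "((\<lambda>r. (1 - z * q ^ N) * (1 - q ^ N / z) * ?s N r) has_sum
      1 / ((1 - z) * qfac (z * q) q n * qfac (q / z) q n)) UNIV" by simp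
  have nz: "(1 - z * q ^ N) * (1 - q ^ N / z) \<noteq> 0"
    using ne[of "int N"] assms(2)[of "int N"] assms(1) by auto
  have eq: "1 / ((1 - z) * qfac (z * q) q n * qfac (q / z) q n) = (1 - z * q ^ N) * (1 - q ^ N / z) *
      (1 / ((1 - z) * qfac (z * q) q N * qfac (q / z) q N))"
  proof -
    have f: "qfac (z * q) q N = qfac (z * q) q n * (1 - z * q ^ N)"
      "qfac (q / z) q N = qfac (q / z) q n * (1 - q ^ N / z)"
      unfolding N_def by (simp_all add: qfac_Suc mult.assoc)
    have *: "1 / (X * Y * W) = A * B * (1 / (X * (Y * A) * (W * B)))"
      if "A * B \<noteq> 0" for A B X Y W :: complex
    proof -
      have "X * (Y * A) * (W * B) = (A * B) * (X * Y * W)" by (simp add: mult_ac)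
      with that show ?thesis by simp
    qed
    show ?thesis unfolding f by (rule *[OF nz])
  qed
  show ?case
    using has_sum_cmult_cancel[OF h[unfolded eq] nz] unfolding N_def .
qed

theorem theta_reciprocal:
  assumes "z \<noteq> 0" "\<And>k :: int. z \<noteq> q powi k"
  shows "(\<Sum>\<^sub>\<infinity>r. theta_coeff q r * q powi r / (1 - z * q powi r)) = qpoch_inf q q ^ 3 / jtheta z q"
proof -
  obtain K where K: "K > 0" "\<And>n r. norm (bfac q n r) \<le> K" using bfac_bounded by blast
  obtain L where L: "L > 0" "\<And>r. norm (1 / (1 - q powi r * z)) \<le> L"
    using inverse_one_minus_powi_bounded[of z] assms(2) by blast
  let ?s = "\<lambda>r. theta_coeff q r * q powi r / (1 - z * q powi r)"
  have sm: "(\<lambda>r. norm (?s r)) summable_on UNIV"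
    using theta_bounded_summable[OF q_nz L(2)] by (simp add: mult.commute)
  have lim1: "(\<lambda>n. \<Sum>\<^sub>\<infinity>r. ?s r * bfac q n r) \<longlonglongrightarrow> (\<Sum>\<^sub>\<infinity>r. ?s r * (1 / qpoch_inf q q ^ 2))"
  proof (rule infsum_dominated)
    show "(\<lambda>r. norm (?s r) * K) summable_on UNIV"
      using sm by (rule summable_on_cmult_left)
    show "norm (?s r * bfac q n r) \<le> norm (?s r) * K" for n r
      unfolding norm_mult[of "?s r"] using K by (intro mult_left_mono) auto
    show "(\<lambda>n. ?s r * bfac q n r) \<longlonglongrightarrow> ?s r * (1 / qpoch_inf q q ^ 2)" for r
      by (intro tendsto_mult tendsto_const bfac_tendsto)
  qed
  have jz: "jtheta z q \<noteq> 0" using assms by (simp add: jtheta_eq_0_iff)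
  have j: "jtheta z q = (1 - z) * qpoch_inf (z * q) q * qpoch_inf (q / z) q * qpoch_inf q q"
    unfolding jtheta_def by (subst qpoch_inf_rec) simp
  have "(\<lambda>n. 1 / ((1 - z) * qfac (z * q) q n * qfac (q / z) q n))
      \<longlonglongrightarrow> 1 / ((1 - z) * qpoch_inf (z * q) q * qpoch_inf (q / z) q)"
    using jz j by (intro tendsto_intros qfac_tendsto) auto
  moreover have "(\<Sum>\<^sub>\<infinity>r. ?s r * bfac q n r)
      = 1 / ((1 - z) * qfac (z * q) q n * qfac (q / z) q n)" for n
    using finite_partial_fractions[OF assms] by (rule infsumI)
  ultimately have "(\<Sum>\<^sub>\<infinity>r. ?s r * (1 / qpoch_inf q q ^ 2))
      = 1 / ((1 - z) * qpoch_inf (z * q) q * qpoch_inf (q / z) q)"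
    using lim1 LIMSEQ_unique by auto
  then have "infsum ?s UNIV * (1 / qpoch_inf q q ^ 2)
      = 1 / ((1 - z) * qpoch_inf (z * q) q * qpoch_inf (q / z) q)"
    by (simp only: infsum_cmult_left')
  moreover have "infsum ?s UNIV = qpoch_inf q q ^ 2 * (infsum ?s UNIV * (1 / qpoch_inf q q ^ 2))"
    using qpoch_qq_nz by simp
  ultimately have "infsum ?s UNIV
      = qpoch_inf q q ^ 2 * (1 / ((1 - z) * qpoch_inf (z * q) q * qpoch_inf (q / z) q))"
    by simp
  also have "\<dots> = qpoch_inf q q ^ 3 / jtheta z q"
    unfolding j using qpoch_qq_nz by (simp add: power2_eq_square power3_eq_cube)
  finally show ?thesis .
qed

end

section \<open>Changing the last argument of an Appell--Lerch series\<close>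

definition appell_num :: "complex \<Rightarrow> complex \<Rightarrow> complex \<Rightarrow> complex" where
  "appell_num x q w = (\<Sum>\<^sub>\<infinity>r. theta_coeff q r * w powi r / (1 - q powi (r - 1) * x * w))"

lemma appell_lerch_eq: "appell_lerch x q z = appell_num x q z / jtheta z q"
  by (simp add: appell_lerch_def appell_num_def theta_coeff_def tri_def)

context nome
begin

text \<open>In this annulus both halves converge geometrically: terms of index \<open>n\<close>
  decay like \<open>|a|^n\<close>, those of index \<open>- n\<close> like
  \<open>|q / a|^n\<close>.\<close>

lemma kronecker_summable:
  assumes "norm q < norm a" "norm a < 1" "b \<noteq> 0" "\<And>k :: int. b \<noteq> q powi k"
  shows "(\<lambda>n. norm (a powi n / (1 - b * q powi n))) summable_on UNIV"
proof (rule summable_on_int_real)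
  have a: "a \<noteq> 0" using assms q_pos by auto
  obtain K where K: "\<And>r. norm (1 / (1 - q powi r * b)) \<le> K"
    using inverse_one_minus_powi_bounded[of b] assms(4) by blast
  have binv: "1 / b \<noteq> q powi k" for k
    using assms(4)[of "- k"] assms(3) by (auto simp: power_int_minus field_simps)
  obtain L where L: "\<And>r. norm (1 / (1 - q powi r * (1 / b))) \<le> L"
    using inverse_one_minus_powi_bounded[of "1 / b"] binv by blast
  show "summable (\<lambda>n. norm (a powi int n / (1 - b * q powi int n)))"
  proof (rule summable_comparison_test')
    show "summable (\<lambda>n. norm a ^ n * K)"
      using assms by (intro summable_mult2 summable_geometric) auto
    show "norm (norm (a powi int n / (1 - b * q powi int n))) \<le> norm a ^ n * K" for n
      using mult_left_mono[OF K[of "int n"], of "norm a ^ n"]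
      by (simp add: norm_divide norm_power mult.commute)
  qed
  show "summable (\<lambda>n. norm (a powi (- int n) / (1 - b * q powi (- int n))))"
  proof (rule summable_comparison_test')
    have "norm (q / a) < 1" using assms a by (simp add: norm_divide)
    then show "summable (\<lambda>n. norm (q / a) ^ n * (L / norm b))"
      by (intro summable_mult2 summable_geometric) auto
    fix n
    have ne: "1 - q ^ n / b \<noteq> 0" using assms(4)[of "int n"] assms(3) by auto
    have "a powi (- int n) / (1 - b * q powi (- int n))
      = - ((q / a) ^ n * (1 / (1 - q powi int n * (1 / b))) * (1 / b))"
      using a ne assms(3) q_nz binv[of "- int n"]
      by (simp add: power_int_minus field_simps)
    then have "norm (norm (a powi (- int n) / (1 - b * q powi (- int n))))
      = norm (q / a) ^ n * (norm (1 / (1 - q powi int n * (1 / b))) * (1 / norm b))"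
      by (simp add: norm_mult norm_power norm_divide)
    also have "\<dots> \<le> norm (q / a) ^ n * (L * (1 / norm b))"
      using L[of "int n"] by (intro mult_left_mono mult_right_mono) auto
    finally show "norm (norm (a powi (- int n) / (1 - b * q powi (- int n))))
      \<le> norm (q / a) ^ n * (L / norm b)" by simp
  qed
qed simp

text \<open>In the product of the theta series of \<open>j(a)\<close> with the Lambert series, the
  coefficient of \<open>a^N\<close> is the expansion of \<open>theta_reciprocal\<close> at
  \<open>b q^N\<close>. By quasi-periodicity it equals \<open>(q;q)^3 / j(b)\<close> times
  \<open>theta_coeff q N * b powi N\<close>, and the triple product sums these to
  \<open>j(a b)\<close>.\<close>

theorem kronecker:
  assumes "norm q < norm a" "norm a < 1" "b \<noteq> 0" "\<And>k :: int. b \<noteq> q powi k"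
  shows "jtheta a q * (\<Sum>\<^sub>\<infinity>n. a powi n / (1 - b * q powi n))
    = qpoch_inf q q ^ 3 * jtheta (a * b) q / jtheta b q"
proof -
  have a: "a \<noteq> 0" using assms q_pos by auto
  have jb: "jtheta b q \<noteq> 0" using assms by (simp add: jtheta_eq_0_iff)
  let ?f = "\<lambda>r. theta_coeff q r * a powi r" and ?g = "\<lambda>n. a powi n / (1 - b * q powi n)"
  have "((\<lambda>N. \<Sum>\<^sub>\<infinity>r. ?f r * ?g (N - r)) has_sum (infsum ?f UNIV * infsum ?g UNIV)) UNIV"
    by (intro infsum_cauchy_product_int theta_abs_summable kronecker_summable a assms)
  moreover have "(\<Sum>\<^sub>\<infinity>r. ?f r * ?g (N - r))
      = qpoch_inf q q ^ 3 / jtheta b q * (theta_coeff q N * (a * b) powi N)" for N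
  proof -
    have ne: "b * q powi N \<noteq> q powi k" for k
      using assms(4)[of "k - N"] q_nz by (auto simp: power_int_diff field_simps)
    have "(\<Sum>\<^sub>\<infinity>r. ?f r * ?g (N - r))
        = (\<Sum>\<^sub>\<infinity>r. a powi N * (theta_coeff q r / (1 - b * q powi (N - r))))"
      using a by (intro infsum_cong) (simp add: power_int_diff)
    also have "\<dots> = a powi N * (\<Sum>\<^sub>\<infinity>r. theta_coeff q r / (1 - b * q powi (N - r)))"
      by (rule infsum_cmult_right')
    also have "(\<Sum>\<^sub>\<infinity>r. theta_coeff q r / (1 - b * q powi (N - r)))
        = (\<Sum>\<^sub>\<infinity>r. theta_coeff q (- r) / (1 - b * q powi (N + r)))"
      by (subst infsum_int_neg[symmetric]) simp
    also have "\<dots> = (\<Sum>\<^sub>\<infinity>r. theta_coeff q r * q powi r / (1 - b * q powi N * q powi r))"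
      by (intro infsum_cong) (simp add: theta_coeff_neg[OF q_nz] power_int_add[of q] q_nz mult_ac)
    also have "\<dots> = qpoch_inf q q ^ 3 / jtheta (b * q powi N) q"
      using theta_reciprocal[of "b * q powi N"] assms ne by simp
    also have "\<dots> = qpoch_inf q q ^ 3 / jtheta b q * (theta_coeff q N * b powi N)"
    proof -
      have "jtheta (b * q powi N) q * (theta_coeff q N * b powi N) = jtheta b q"
        using jtheta_powi_mult[OF assms(3), of N] by (simp add: mult_ac)
      moreover have "theta_coeff q N * b powi N \<noteq> 0"
        using assms(3) by (simp add: power_int_eq_0_iff)
      ultimately show ?thesis using jb by (metis nonzero_mult_divide_mult_cancel_right
            times_divide_eq_left)
    qed
    finally show ?thesis by (simp add: power_int_mult_distrib mult_ac)
  qed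
  ultimately have "((\<lambda>N. qpoch_inf q q ^ 3 / jtheta b q * (theta_coeff q N * (a * b) powi N)) has_sum
      (infsum ?f UNIV * infsum ?g UNIV)) UNIV" by simp
  moreover have "((\<lambda>N. qpoch_inf q q ^ 3 / jtheta b q * (theta_coeff q N * (a * b) powi N)) has_sum
      (qpoch_inf q q ^ 3 / jtheta b q * jtheta (a * b) q)) UNIV"
    using a assms by (intro has_sum_cmult_right jacobi_triple_product) auto
  moreover have "infsum ?f UNIV = jtheta a q"
    using jacobi_triple_product[OF a] by (rule infsumI)
  ultimately show ?thesis using has_sum_unique by fastforce
qed

lemma appell_num_summable:
  assumes "w \<noteq> 0" "\<And>k :: int. x * w \<noteq> q powi k"
  shows "(\<lambda>r. norm (theta_coeff q r * w powi r / (1 - q powi (r - 1) * x * w))) summable_on UNIV"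
proof -
  have ne: "x * w / q \<noteq> q powi k" for k
    using assms(2)[of "k + 1"] q_nz by (auto simp: power_int_add field_simps)
  obtain K where K: "\<And>r. norm (1 / (1 - q powi r * (x * w / q))) \<le> K"
    using inverse_one_minus_powi_bounded[of "x * w / q"] ne by blast
  show ?thesis
    using theta_bounded_summable[OF assms(1) K] q_nz by (simp add: power_int_diff mult.assoc)
qed

lemma appell_num_has_sum:
  assumes "w \<noteq> 0" "\<And>k :: int. x * w \<noteq> q powi k"
  shows "((\<lambda>r. theta_coeff q r * w powi r / (1 - q powi (r - 1) * x * w)) has_sum
    appell_num x q w) UNIV"
  unfolding appell_num_def
  by (rule has_sum_infsum[OF abs_summable_summable[OF appell_num_summable[OF assms]]])

text \<open>The functional equation \<open>m(q x, q, z) = 1 - x m(x, q, z)\<close>, cleared of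
  denominators. After the shift \<open>r + 1\<close> in the second series both have the denominator
  \<open>1 - q^r x z\<close>, which cancels in the combined numerator.\<close>

lemma appell_num_shift_x:
  assumes "x \<noteq> 0" "z \<noteq> 0" "\<And>k :: int. x * z \<noteq> q powi k"
  shows "appell_num (q * x) q z = jtheta z q - x * appell_num x q z"
proof -
  have ne: "1 - q powi r * x * z \<noteq> 0" for r
  proof
    assume "1 - q powi r * x * z = 0"
    then have "x * z = q powi (- r)"
      by (metis eq_iff_diff_eq_0 power_int_minus inverse_unique mult.assoc)
    then show False using assms by blast
  qed
  have ne': "q * x * z \<noteq> q powi k" for k
    using assms(3)[of "k - 1"] q_nz by (auto simp: power_int_diff field_simps)
  have qq: "q powi (r - 1) * (q * x) * z = q powi r * x * z" for r
    using q_nz by (simp add: power_int_diff)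
  have s1: "((\<lambda>r. theta_coeff q r * z powi r / (1 - q powi r * x * z)) has_sum
      appell_num (q * x) q z) UNIV"
    using appell_num_has_sum[OF assms(2) ne'] unfolding qq .
  have "((\<lambda>r. theta_coeff q r * z powi r / (1 - q powi (r - 1) * x * z)) has_sum
      appell_num x q z) UNIV"
    by (rule appell_num_has_sum[OF assms(2,3)])
  then have "((\<lambda>r. theta_coeff q (r + 1) * z powi (r + 1) / (1 - q powi (r + 1 - 1) * x * z)) has_sum
      appell_num x q z) UNIV"
    by (subst has_sum_int_shift[of _ 1])
  then have s2: "((\<lambda>r. theta_coeff q r * z powi r / (1 - q powi r * x * z)
        + x * (theta_coeff q (r + 1) * z powi (r + 1) / (1 - q powi (r + 1 - 1) * x * z))) has_sum
      appell_num (q * x) q z + x * appell_num x q z) UNIV"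
    by (intro has_sum_add s1 has_sum_cmult_right)
  moreover have "theta_coeff q r * z powi r / (1 - q powi r * x * z)
        + x * (theta_coeff q (r + 1) * z powi (r + 1) / (1 - q powi (r + 1 - 1) * x * z))
      = theta_coeff q r * z powi r" for r
  proof -
    have "z powi (r + 1) = z powi r * z" using assms(2) by (simp add: power_int_add)
    then have "theta_coeff q r * z powi r / (1 - q powi r * x * z)
        + x * (theta_coeff q (r + 1) * z powi (r + 1) / (1 - q powi (r + 1 - 1) * x * z))
      = theta_coeff q r * z powi r * (1 - q powi r * x * z) / (1 - q powi r * x * z)"
      unfolding theta_coeff_add1[OF q_nz] add_diff_cancel_right'
      by (simp add: diff_divide_distrib algebra_simps)
    then show ?thesis using ne by simp
  qed
  ultimately have "((\<lambda>r. theta_coeff q r * z powi r) has_sum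
      appell_num (q * x) q z + x * appell_num x q z) UNIV" by simp
  then have "appell_num (q * x) q z + x * appell_num x q z = jtheta z q"
    using jacobi_triple_product[OF assms(2)] has_sum_unique by blast
  then show ?thesis by (simp add: algebra_simps)
qed

text \<open>Multiplying \<open>w\<close> by \<open>q^k\<close> only shifts the summation index. The
  resulting factor is the same as in \<open>jtheta_powi_mult\<close>, so \<open>m\<close> is
  unchanged by such a shift of its last argument.\<close>

lemma appell_num_shift_w:
  assumes "w \<noteq> 0"
  shows "appell_num x q (q powi k * w) * theta_coeff q k * w powi k = appell_num x q w"
proof -
  have "appell_num x q (q powi k * w) * (theta_coeff q k * w powi k)
      = (\<Sum>\<^sub>\<infinity>r. theta_coeff q (r + k) * w powi (r + k) / (1 - q powi (r + k - 1) * x * w))"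
    unfolding appell_num_def infsum_cmult_left'[symmetric]
  proof (rule infsum_cong)
    fix r :: int
    have qk: "q powi (r - 1) * q powi k = q powi (r + k - 1)"
      using q_nz by (simp add: algebra_simps flip: power_int_add)
    have "q powi (r - 1) * x * (q powi k * w) = (q powi (r - 1) * q powi k) * x * w"
      by (simp only: mult_ac)
    then have D: "q powi (r - 1) * x * (q powi k * w) = q powi (r + k - 1) * x * w"
      unfolding qk .
    show "theta_coeff q r * (q powi k * w) powi r / (1 - q powi (r - 1) * x * (q powi k * w))
        * (theta_coeff q k * w powi k)
      = theta_coeff q (r + k) * w powi (r + k) / (1 - q powi (r + k - 1) * x * w)"
      using assms unfolding D
      by (simp add: theta_coeff_add[OF q_nz] power_int_mult_distrib power_int_add
          mult.commute[of r k] flip: power_int_mult)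
  qed
  also have "\<dots> = appell_num x q w"
    unfolding appell_num_def by (rule infsum_int_shift)
  finally show ?thesis by (simp add: mult.assoc)
qed

text \<open>Laurent coefficients in \<open>w\<close> of the right-hand side of \<open>appell_num_change\<close>, in the annulus
  \<open>norm q < norm (x * w) < 1\<close>.\<close>

definition change_coeff :: "complex \<Rightarrow> complex \<Rightarrow> int \<Rightarrow> complex" where
  "change_coeff x z A = - (x powi (A - 1) * (jtheta z q - appell_num (x * q powi (1 - A)) q z))"

lemma change_coeff_0:
  assumes "x \<noteq> 0" "z \<noteq> 0" "\<And>k :: int. x * z \<noteq> q powi k"
  shows "change_coeff x z 0 = - appell_num x q z"
  using appell_num_shift_x[OF assms] assms(1)
  by (simp add: change_coeff_def mult.commute power_int_minus field_simps)

text \<open>The inhomogeneous term depends on \<open>z\<close> only through the factor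
  \<open>j(z)\<close>; it therefore cancels in \<open>j(w)\<close> times the coefficients for
  \<open>z\<close> minus \<open>j(z)\<close> times those for \<open>w\<close>.\<close>

lemma change_coeff_rec:
  assumes "x \<noteq> 0" "z \<noteq> 0" "\<And>k :: int. x * z \<noteq> q powi k"
  shows "change_coeff x z (A + 1) = - (x powi A * jtheta z q) - q powi A * change_coeff x z A"
proof -
  have "x * q powi (- A) * z \<noteq> q powi k" for k
    using assms(3)[of "k + A"] q_nz by (auto simp: power_int_add power_int_minus field_simps)
  then have "appell_num (q * (x * q powi (- A))) q z
      = jtheta z q - x * q powi (- A) * appell_num (x * q powi (- A)) q z"
    using assms q_nz by (intro appell_num_shift_x) auto
  moreover have "q * (x * q powi (- A)) = x * q powi (1 - A)"
    using q_nz by (simp add: power_int_diff power_int_minus field_simps)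
  ultimately have f: "jtheta z q - appell_num (x * q powi (1 - A)) q z
      = x * q powi (- A) * appell_num (x * q powi (- A)) q z"
    by simp
  have x: "x powi A = x * x powi (A - 1)"
    using assms(1) by (simp add: power_int_diff)
  have q: "q powi A * q powi (- A) = 1"
    using q_nz by (simp add: power_int_minus)
  have "q powi A * change_coeff x z A
      = - (q powi A * q powi (- A)) * (x powi A * appell_num (x * q powi (- A)) q z)"
    unfolding change_coeff_def f x by (simp only: mult_ac mult_minus_left mult_minus_right)
  then show ?thesis
    unfolding q by (simp add: change_coeff_def algebra_simps)
qed

lemma annulus_neq_powi:
  assumes "norm q < norm v" "norm v < 1"
  shows "v \<noteq> q powi k"
proof
  assume "v = q powi k"
  then have n: "norm v = norm q powi k" by (simp add: norm_power_int)
  show False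
  proof (cases "k \<le> 0")
    case True
    then have "1 \<le> norm q powi k"
      using power_int_decreasing[of k 0 "norm q"] q_lt1 q_pos by simp
    then show False using n assms by simp
  next
    case False
    then have "norm q powi k \<le> norm q powi 1"
      using q_lt1 q_pos by (intro power_int_decreasing) auto
    then show False using n assms by simp
  qed
qed

text \<open>\<open>kronecker\<close> is used with \<open>a = x w\<close> and
  \<open>b = 1 / (x z)\<close>, chosen so that \<open>a b = w / z\<close>. The remaining theta
  function \<open>j(x z w)\<close> is expanded as well, and the Cauchy product of the two series
  gives the coefficients of the powers of \<open>w\<close>.\<close>

lemma change_coeff_has_sum:
  assumes nz: "x \<noteq> 0" "w \<noteq> 0" "z \<noteq> 0" and xw: "norm q < norm (x * w)" "norm (x * w) < 1"
    and xz: "\<And>k :: int. x * z \<noteq> q powi k"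
  shows "((\<lambda>A. w powi A * change_coeff x z A) has_sum
    (z * qpoch_inf q q ^ 3 * jtheta (w / z) q * jtheta (x * z * w) q /
      (jtheta (x * z) q * jtheta (x * w) q))) UNIV"
proof -
  define b where "b = 1 / (x * z)"
  have b: "b \<noteq> 0" "\<And>k :: int. b \<noteq> q powi k"
  proof -
    show "b \<noteq> 0" using nz by (simp add: b_def)
    show "b \<noteq> q powi k" for k
    proof
      assume "b = q powi k"
      moreover have "x * z = inverse b" by (simp add: b_def)
      ultimately have "x * z = q powi (- k)" by (simp add: power_int_minus)
      then show False using xz by blast
    qed
  qed
  have jxw: "jtheta (x * w) q \<noteq> 0"
    using annulus_neq_powi[OF xw] nz by (simp add: jtheta_eq_0_iff)
  have jxz: "jtheta (x * z) q \<noteq> 0" using xz nz by (simp add: jtheta_eq_0_iff)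
  let ?f = "\<lambda>r. theta_coeff q r * (x * z * w) powi r"
    and ?g = "\<lambda>n. (x * w) powi n / (1 - b * q powi n)"
  have "((\<lambda>N. \<Sum>\<^sub>\<infinity>r. ?f r * ?g (N - r)) has_sum (infsum ?f UNIV * infsum ?g UNIV)) UNIV"
    using nz by (intro infsum_cauchy_product_int theta_abs_summable kronecker_summable b xw) auto
  then have "((\<lambda>N. - (1 / x) * (\<Sum>\<^sub>\<infinity>r. ?f r * ?g (N - r))) has_sum
      - (1 / x) * (infsum ?f UNIV * infsum ?g UNIV)) UNIV"
    by (rule has_sum_cmult_right)
  also have "(\<lambda>N. - (1 / x) * (\<Sum>\<^sub>\<infinity>r. ?f r * ?g (N - r))) = (\<lambda>A. w powi A * change_coeff x z A)"
  proof
    fix N :: int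
    have ne: "x * q powi (1 - N) * z \<noteq> q powi k" for k
      using xz[of "k + N - 1"] q_nz by (auto simp: power_int_add power_int_diff field_simps)
    have s1: "((\<lambda>r. theta_coeff q r * z powi r) has_sum jtheta z q) UNIV"
      by (rule jacobi_triple_product[OF nz(3)])
    have s2: "((\<lambda>r. theta_coeff q r * z powi r / (1 - q powi (r - 1) * (x * q powi (1 - N)) * z))
        has_sum appell_num (x * q powi (1 - N)) q z) UNIV"
      by (rule appell_num_has_sum[OF nz(3) ne])
    have eq: "?f r * ?g (N - r) = (x * w) powi N * (theta_coeff q r * z powi r
        - theta_coeff q r * z powi r / (1 - q powi (r - 1) * (x * q powi (1 - N)) * z))" for r
    proof -
      define c where "c = x * z * q powi (r - N)"
      have c: "q powi (r - 1) * (x * q powi (1 - N)) * z = c" "b * q powi (N - r) = 1 / c"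
        unfolding c_def b_def using q_nz nz
        by (simp_all add: power_int_diff field_simps)
      have "c \<noteq> 1"
        using xz[of "N - r"] q_nz by (auto simp: c_def power_int_diff field_simps)
      moreover have "c \<noteq> 0" using nz q_nz by (simp add: c_def)
      \<comment> \<open>This splits each term of the inner sum into a term of the theta series of
        \<open>z\<close> and a term of an Appell--Lerch numerator.\<close>
      ultimately have i: "1 / (1 - 1 / c) = 1 - 1 / (1 - c)" by (simp add: field_simps)
      have "?f r * ?g (N - r) = theta_coeff q r * ((x * z * w) powi r * (x * w) powi (N - r))
          * (1 / (1 - 1 / c))"
        unfolding c by simp
      also have "(x * z * w) powi r * (x * w) powi (N - r) = (x * w) powi N * z powi r"
        using nz by (simp add: power_int_diff power_int_mult_distrib)
      finally show ?thesis unfolding i c by (simp add: algebra_simps)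
    qed
    have "((\<lambda>r. ?f r * ?g (N - r)) has_sum (x * w) powi N * (jtheta z q
        - appell_num (x * q powi (1 - N)) q z)) UNIV"
      unfolding eq by (intro has_sum_cmult_right has_sum_diff s1 s2)
    then have S: "(\<Sum>\<^sub>\<infinity>r. ?f r * ?g (N - r)) = (x * w) powi N * (jtheta z q
        - appell_num (x * q powi (1 - N)) q z)"
      by (rule infsumI)
    have xN: "(1 / x) * (x * w) powi N = w powi N * x powi (N - 1)"
      using nz by (simp add: power_int_diff power_int_mult_distrib)
    have "- (1 / x) * (\<Sum>\<^sub>\<infinity>r. ?f r * ?g (N - r)) = - (((1 / x) * (x * w) powi N)
        * (jtheta z q - appell_num (x * q powi (1 - N)) q z))"
      unfolding S by (simp only: mult_ac mult_minus_left mult_minus_right)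
    also have "\<dots> = w powi N * change_coeff x z N"
      unfolding xN change_coeff_def by (simp only: mult_ac mult_minus_left mult_minus_right)
    finally show "- (1 / x) * (\<Sum>\<^sub>\<infinity>r. ?f r * ?g (N - r)) = w powi N * change_coeff x z N" .
  qed
  also have "infsum ?f UNIV = jtheta (x * z * w) q"
    using nz by (intro infsumI jacobi_triple_product) auto
  also have "- (1 / x) * (jtheta (x * z * w) q * infsum ?g UNIV) =
      z * qpoch_inf q q ^ 3 * jtheta (w / z) q * jtheta (x * z * w) q /
      (jtheta (x * z) q * jtheta (x * w) q)"
  proof -
    have "jtheta b q = - jtheta (x * z) q / (x * z)"
      unfolding b_def using nz by (intro jtheta_inverse) auto
    moreover have "x * w * b = w / z" using nz by (simp add: b_def)
    ultimately have "jtheta (x * w) q * infsum ?g UNIV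
        = qpoch_inf q q ^ 3 * jtheta (w / z) q / (- jtheta (x * z) q / (x * z))"
      using kronecker[OF xw b] by simp
    then have "infsum ?g UNIV = qpoch_inf q q ^ 3 * jtheta (w / z) q /
        (- jtheta (x * z) q / (x * z)) / jtheta (x * w) q"
      by (intro eq_divide_imp[OF jxw]) (simp only: mult.commute)
    then show ?thesis using nz jxw jxz by (simp add: field_simps)
  qed
  finally show ?thesis .
qed

text \<open>The sequence \<open>d\<close> is \<open>d 0\<close> times the theta coefficients, so its
  series at the point \<open>w\<close> is \<open>d 0 * j(w)\<close>. By
  \<open>change_coeff_has_sum\<close> the same series is \<open>j(w)\<close> times the theta
  quotient, since the family with parameter \<open>w\<close> contributes
  \<open>j(w / w) = 0\<close>. Cancelling \<open>j(w)\<close> leaves \<open>d 0\<close>, which is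
  the left-hand side.\<close>

lemma appell_num_change_annulus:
  assumes nz: "x \<noteq> 0" "w \<noteq> 0" "z \<noteq> 0" and xw: "norm q < norm (x * w)" "norm (x * w) < 1"
    and xz: "\<And>k :: int. x * z \<noteq> q powi k" and jw: "jtheta w q \<noteq> 0"
  shows "jtheta z q * appell_num x q w - jtheta w q * appell_num x q z
    = z * qpoch_inf q q ^ 3 * jtheta (w / z) q * jtheta (x * z * w) q /
      (jtheta (x * z) q * jtheta (x * w) q)" (is "_ = ?H")
proof -
  note xw' = annulus_neq_powi[OF xw]
  define d where "d A = jtheta w q * change_coeff x z A - jtheta z q * change_coeff x w A" for A
  have d_rec: "d (A + 1) = - (q powi A * d A)" for A
    unfolding d_def change_coeff_rec[OF nz(1,3) xz] change_coeff_rec[OF nz(1,2) xw']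
    by (simp add: algebra_simps)
  have d: "d A = d 0 * theta_coeff q A" for A
    using theta_coeff_unique[OF q_nz, of d] d_rec by blast
  have 0: "((\<lambda>A. w powi A * change_coeff x w A) has_sum 0) UNIV"
    using change_coeff_has_sum[OF nz(1,2,2) xw xw'] nz by simp
  from has_sum_diff[OF has_sum_cmult_right[OF change_coeff_has_sum[OF nz xw xz], of "jtheta w q"]
      has_sum_cmult_right[OF 0, of "jtheta z q"]]
  have 1: "((\<lambda>A. w powi A * d A) has_sum (jtheta w q * ?H - jtheta z q * 0)) UNIV"
    unfolding d_def right_diff_distrib by (simp only: mult.left_commute[of "w powi _"])
  have 2: "((\<lambda>A. d 0 * (theta_coeff q A * w powi A)) has_sum d 0 * jtheta w q) UNIV"
    by (intro has_sum_cmult_right jacobi_triple_product nz)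
  have 3: "(\<lambda>A. d 0 * (theta_coeff q A * w powi A)) = (\<lambda>A. w powi A * d A)"
    by (rule ext) (subst (2) d, simp only: mult_ac)
  have "d 0 * jtheta w q = jtheta w q * ?H - jtheta z q * 0"
    by (rule has_sum_unique[OF 2[unfolded 3] 1])
  then have "jtheta w q * d 0 = jtheta w q * ?H"
    by (simp only: mult.commute[of "d 0"] mult_zero_right diff_zero)
  then have "d 0 = ?H" by (rule iffD1[OF mult_left_cancel[OF jw]])
  then show ?thesis
    unfolding d_def change_coeff_0[OF nz(1,3) xz] change_coeff_0[OF nz(1,2) xw']
    by (simp add: algebra_simps)
qed

text \<open>\<open>L\<close> is the logarithm of \<open>c\<close> to the base \<open>|q|\<close>. It
  is not an integer, so its fractional part, which \<open>k\<close> isolates, lies strictly between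
  0 and 1.\<close>

lemma exists_shift_into_annulus:
  assumes "0 < c" "\<And>k :: int. c \<noteq> norm q powi k"
  obtains k :: int where "norm q < norm q powi k * c" "norm q powi k * c < 1"
proof -
  define L where "L = ln c / ln (norm q)"
  define k where "k = - \<lfloor>L\<rfloor>"
  have lq: "ln (norm q) < 0" using q_lt1 q_pos by simp
  have cL: "c = norm q powr L" using lq assms(1) q_pos by (simp add: L_def powr_def)
  have kc: "norm q powi k * c = norm q powr (of_int k + L)"
    using q_pos by (simp add: cL powr_add powr_real_of_int')
  have "L \<noteq> of_int \<lfloor>L\<rfloor>"
  proof
    define m where "m = \<lfloor>L\<rfloor>"
    assume "L = of_int \<lfloor>L\<rfloor>"
    then have "c = norm q powr of_int m" using cL by (simp only: m_def)
    then have "c = norm q powi m" using q_nz by (simp add: powr_real_of_int')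
    with assms(2) show False by blast
  qed
  then have "0 < of_int k + L" "of_int k + L < 1"
    unfolding k_def using floor_correct[of L] by linarith+
  then have "norm q powr 1 < norm q powr (of_int k + L)" "norm q powr (of_int k + L) < norm q powr 0"
    using q_lt1 q_pos by (intro powr_less_mono'; simp)+
  then show ?thesis using that[of k] kc q_pos by simp
qed

text \<open>Both sides acquire the same factor when \<open>w\<close> is replaced by
  \<open>q^k w\<close>, so \<open>w\<close> may be moved until \<open>x w\<close> lies in the
  annulus. The moduli that cannot be moved there are excluded by the hypothesis on
  \<open>x * w\<close>; for \<open>x * z\<close> only the poles themselves are excluded.\<close>

theorem appell_num_change:
  assumes nz: "x \<noteq> 0" "w \<noteq> 0" "z \<noteq> 0" and xw: "\<And>k :: int. norm (x * w) \<noteq> norm q powi k"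
    and xz: "\<And>k :: int. x * z \<noteq> q powi k" and jw: "jtheta w q \<noteq> 0"
  shows "jtheta z q * appell_num x q w - jtheta w q * appell_num x q z
    = z * qpoch_inf q q ^ 3 * jtheta (w / z) q * jtheta (x * z * w) q /
      (jtheta (x * z) q * jtheta (x * w) q)"
proof -
  have "0 < norm (x * w)" using nz by simp
  then obtain k where k: "norm q < norm q powi k * norm (x * w)" "norm q powi k * norm (x * w) < 1"
    using exists_shift_into_annulus xw by metis
  define v where "v = q powi k * w"
  define \<theta> where "\<theta> = theta_coeff q k"
  have v: "v \<noteq> 0" using nz q_nz by (simp add: v_def)
  have xv: "norm (x * v) = norm q powi k * norm (x * w)"
    by (simp add: v_def norm_mult norm_power_int)
  have \<theta>: "\<theta> \<noteq> 0" by (simp add: \<theta>_def)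
  have e1: "jtheta v q * \<theta> * w powi k = jtheta w q"
    unfolding v_def \<theta>_def by (rule jtheta_powi_mult[OF nz(2)])
  have e2: "appell_num x q v * \<theta> * w powi k = appell_num x q w"
    unfolding v_def \<theta>_def by (rule appell_num_shift_w[OF nz(2)])
  have e3: "jtheta (v / z) q * \<theta> * (w / z) powi k = jtheta (w / z) q"
    using jtheta_powi_mult[of "w / z" k] nz by (simp add: v_def \<theta>_def)
  have e4: "jtheta (x * z * v) q * \<theta> * (x * z * w) powi k = jtheta (x * z * w) q"
    using jtheta_powi_mult[of "x * z * w" k] nz by (simp add: v_def \<theta>_def mult_ac)
  have e5: "jtheta (x * v) q * \<theta> * (x * w) powi k = jtheta (x * w) q"
    using jtheta_powi_mult[of "x * w" k] nz by (simp add: v_def \<theta>_def mult_ac)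
  have jv: "jtheta v q \<noteq> 0" using jw e1 by auto
  have main: "jtheta z q * appell_num x q v - jtheta v q * appell_num x q z
    = z * qpoch_inf q q ^ 3 * jtheta (v / z) q * jtheta (x * z * v) q /
      (jtheta (x * z) q * jtheta (x * v) q)"
    using k xv by (intro appell_num_change_annulus nz v xz jv) auto
  have "jtheta z q * appell_num x q w - jtheta w q * appell_num x q z
      = (jtheta z q * appell_num x q v - jtheta v q * appell_num x q z) * (\<theta> * w powi k)"
    unfolding e1[symmetric] e2[symmetric] by (simp add: algebra_simps)
  also have "\<dots> = z * qpoch_inf q q ^ 3 * (jtheta (v / z) q * \<theta> * (w / z) powi k)
       * (jtheta (x * z * v) q * \<theta> * (x * z * w) powi k) /
      (jtheta (x * z) q * (jtheta (x * v) q * \<theta> * (x * w) powi k))"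
  proof -
    \<comment> \<open>This balance between numerator and denominator is why the factors from the
      three theta functions containing \<open>w\<close> leave exactly
      \<open>\<theta> * w powi k\<close>.\<close>
    have "(w / z) powi k * (x * z * w) powi k = (x * w) powi k * w powi k"
      using nz by (simp add: power_int_mult_distrib power_int_divide_distrib)
    moreover have "(x * w) powi k \<noteq> 0" using nz by (simp add: power_int_eq_0_iff)
    moreover have "C * a * b / (e * f) * (\<theta> * W)
        = C * (a * \<theta> * P) * (b * \<theta> * Q) / (e * (f * \<theta> * R))"
      if "P * Q = R * W" "R \<noteq> 0" for C a b e f P Q R W :: complex
    proof -
      have "C * (a * \<theta> * P) * (b * \<theta> * Q) / (e * (f * \<theta> * R))
          = (C * a * b * \<theta> * \<theta>) * (P * Q) / ((e * f) * (R * \<theta>))"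
        by (simp only: mult_ac)
      also have "\<dots> = (C * a * b * \<theta> * W) * (R * \<theta>) / ((e * f) * (R * \<theta>))"
        unfolding that(1) by (simp only: mult_ac)
      also have "\<dots> = C * a * b * \<theta> * W / (e * f)"
        using that(2) \<theta> by simp
      finally show ?thesis by simp
    qed
    ultimately show ?thesis unfolding main by blast
  qed
  finally show ?thesis unfolding e3 e4 e5 .
qed

end

section \<open>Dissection modulo n\<close>

lemma zeta_nz [simp]: "zeta n \<noteq> 0"
  by (simp add: zeta_def)

lemma norm_zeta: "norm (zeta n) = 1"
  by (simp add: zeta_def norm_exp_eq_Re Re_divide_of_nat)

lemma zeta_powi: "zeta n powi m = exp (of_int m * (2 * of_real pi * \<i> / of_nat n))"
  by (simp add: zeta_def exp_power_int)

lemma zeta_powi_eq_1_iff: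
  assumes "n > 0"
  shows "zeta n powi m = 1 \<longleftrightarrow> int n dvd m"
proof -
  have "zeta n powi m = 1 \<longleftrightarrow> (\<exists>k :: int. of_int m * (2 * pi / of_nat n) = of_int (2 * k) * pi)"
    by (simp add: zeta_powi exp_eq_1 Re_divide_of_nat Im_divide_of_nat)
  also have "\<dots> \<longleftrightarrow> (\<exists>k :: int. (of_int m :: real) = of_int (k * int n))"
    using assms by (simp add: field_simps)
  also have "\<dots> \<longleftrightarrow> int n dvd m"
    by (subst of_int_eq_iff) (auto simp: dvd_def mult.commute)
  finally show ?thesis .
qed

lemma sum_zeta_powi:
  assumes "n > 0"
  shows "(\<Sum>j<n. zeta n powi (m * int j)) = (if int n dvd m then of_nat n else 0)"
proof -
  define y where "y = zeta n powi m"
  have "(\<Sum>j<n. zeta n powi (m * int j)) = (\<Sum>j<n. y ^ j)"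
    by (simp add: y_def power_int_mult)
  also have "\<dots> = (if int n dvd m then of_nat n else 0)"
  proof (cases "int n dvd m")
    case True
    then have "y = 1" using zeta_powi_eq_1_iff[OF assms] by (simp add: y_def)
    then show ?thesis using True by simp
  next
    case False
    then have "y \<noteq> 1" using zeta_powi_eq_1_iff[OF assms] by (simp add: y_def)
    moreover have "y ^ n = 1"
      using zeta_powi_eq_1_iff[OF assms, of "m * int n"] by (simp add: y_def power_int_mult)
    ultimately show ?thesis using False by (simp add: geometric_sum)
  qed
  finally show ?thesis .
qed

text \<open>Over the common denominator \<open>1 - y^n\<close> each term is a finite geometric sum,
  and orthogonality of the roots of unity keeps only the exponent \<open>k\<close>. No bound on
  \<open>|y|\<close> enters, which matters as \<open>y\<close> will run through a bilateral
  sequence.\<close>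

lemma average_over_roots_of_unity:
  assumes "k < n" "y ^ n \<noteq> 1"
  shows "(\<Sum>t<n. zeta n powi (- (int k * int t)) / (1 - zeta n ^ t * y)) = of_nat n * (y ^ k / (1 - y ^ n))"
proof -
  have n: "n > 0" using assms by simp
  have root: "(zeta n ^ t * y) ^ n = y ^ n" for t
    using zeta_powi_eq_1_iff[OF n, of "int t * int n"]
    by (simp add: power_mult_distrib power_mult power_int_mult)
  have "zeta n powi (- (int k * int t)) / (1 - zeta n ^ t * y)
      = (\<Sum>i<n. y ^ i / (1 - y ^ n) * zeta n powi ((int i - int k) * int t))" for t
  proof -
    have ne: "1 - zeta n ^ t * y \<noteq> 0" using root[of t] assms(2) by auto
    have "1 - y ^ n = (1 - zeta n ^ t * y) * (\<Sum>i<n. (zeta n ^ t * y) ^ i)"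
      using one_diff_power_eq[of "zeta n ^ t * y" n] unfolding root .
    then have "1 / (1 - zeta n ^ t * y) = (\<Sum>i<n. (zeta n ^ t * y) ^ i) / (1 - y ^ n)"
      using ne assms(2) by (simp add: field_simps)
    then have "zeta n powi (- (int k * int t)) / (1 - zeta n ^ t * y)
        = zeta n powi (- (int k * int t)) * ((\<Sum>i<n. (zeta n ^ t * y) ^ i) / (1 - y ^ n))"
      by (metis mult.right_neutral times_divide_eq_right)
    also have "\<dots> = (\<Sum>i<n. zeta n powi (- (int k * int t)) * (zeta n ^ t * y) ^ i / (1 - y ^ n))"
      by (simp add: sum_divide_distrib sum_distrib_left)
    also have "\<dots> = (\<Sum>i<n. y ^ i / (1 - y ^ n) * zeta n powi ((int i - int k) * int t))"
    proof (rule sum.cong)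
      fix i
      have "zeta n powi ((int i - int k) * int t) = zeta n powi (- (int k * int t)) * zeta n powi int (t * i)"
        by (simp add: algebra_simps flip: power_int_add)
      also have "zeta n powi int (t * i) = (zeta n ^ t) ^ i"
        by (simp only: power_int_of_nat power_mult)
      finally show "zeta n powi (- (int k * int t)) * (zeta n ^ t * y) ^ i / (1 - y ^ n)
          = y ^ i / (1 - y ^ n) * zeta n powi ((int i - int k) * int t)"
        by (simp add: power_mult_distrib)
    qed simp
    finally show ?thesis .
  qed
  then have "(\<Sum>t<n. zeta n powi (- (int k * int t)) / (1 - zeta n ^ t * y))
      = (\<Sum>t<n. \<Sum>i<n. y ^ i / (1 - y ^ n) * zeta n powi ((int i - int k) * int t))" by simp
  also have "\<dots> = (\<Sum>i<n. \<Sum>t<n. y ^ i / (1 - y ^ n) * zeta n powi ((int i - int k) * int t))"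
    by (rule sum.swap)
  also have "\<dots> = (\<Sum>i<n. y ^ i / (1 - y ^ n) * (if int n dvd (int i - int k) then of_nat n else 0))"
    by (simp only: sum_zeta_powi[OF n] flip: sum_distrib_left)
  also have "\<dots> = (\<Sum>i<n. if i = k then y ^ i / (1 - y ^ n) * of_nat n else 0)"
  proof (rule sum.cong)
    fix i assume "i \<in> {..<n}"
    then have "int n dvd (int i - int k) \<longleftrightarrow> i = k"
      using assms(1) dvd_imp_le_int[of "int i - int k" "int n"] by (cases "i = k") auto
    then show "y ^ i / (1 - y ^ n) * (if int n dvd (int i - int k) then of_nat n else 0)
        = (if i = k then y ^ i / (1 - y ^ n) * of_nat n else 0)" by simp
  qed simp
  also have "\<dots> = of_nat n * (y ^ k / (1 - y ^ n))"
    using assms(1) by simp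
  finally show ?thesis .
qed

text \<open>The offset 1 is adapted to Appell--Lerch series, whose denominators contain
  \<open>q powi (r - 1)\<close>: it makes \<open>r - 1 = n s + t\<close>.\<close>

lemma infsum_int_dissect:
  fixes f :: "int \<Rightarrow> complex"
  assumes "f summable_on UNIV" "n > 0"
  shows "infsum f UNIV = (\<Sum>t<n. \<Sum>\<^sub>\<infinity>s :: int. f (int n * s + int t + 1))"
proof -
  have h: "((\<lambda>(t, s). f (int n * s + int t + 1)) has_sum infsum f UNIV) ({..<n} \<times> UNIV)"
  proof (rule iffD2[OF has_sum_reindex_bij_witness has_sum_infsum[OF assms(1)]])
    show "(\<lambda>r. (nat ((r - 1) mod int n), (r - 1) div int n)) r \<in> {..<n} \<times> UNIV" for r :: int
      using assms(2) by (simp add: nat_less_iff)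
    show "(\<lambda>(t, s). int n * s + int t + 1) ((\<lambda>r. (nat ((r - 1) mod int n), (r - 1) div int n)) r) = r"
      for r :: int
      using assms(2) mult_div_mod_eq[of "int n" "r - 1"] by simp
  next
    fix p :: "nat \<times> int" assume "p \<in> {..<n} \<times> UNIV"
    then obtain t s where p: "p = (t, s)" "t < n" by (cases p) auto
    show "(\<lambda>r. (nat ((r - 1) mod int n), (r - 1) div int n)) ((\<lambda>(t, s). int n * s + int t + 1) p) = p"
      using p by simp
  qed (auto simp: case_prod_unfold)
  have "(\<lambda>(t, s). f (int n * s + int t + 1)) summable_on ({..<n} \<times> UNIV)"
    using h by (rule has_sum_imp_summable)
  from infsum_Sigma'_banach[OF this] infsumI[OF h] show ?thesis
    by simp
qed

lemma has_sum_sum: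
  fixes f :: "'b \<Rightarrow> 'a \<Rightarrow> complex"
  assumes "\<And>t. t \<in> T \<Longrightarrow> (f t has_sum g t) A"
  shows "((\<lambda>r. \<Sum>t\<in>T. f t r) has_sum (\<Sum>t\<in>T. g t)) A"
  using assms by (induction T rule: infinite_finite_induct) (auto intro!: has_sum_add)

lemma choose_two_tri: "int (m choose 2) = tri (int m)"
  by (cases m) (simp_all add: choose_two tri_def zdiv_int algebra_simps)

context nome
begin

text \<open>With \<open>r = n s + t + 1\<close> the sum over \<open>s\<close> is an Appell--Lerch
  numerator in base \<open>q^(n^2)\<close>: \<open>dissect_w\<close> is its last argument,
  \<open>dissect_x\<close> its parameter and \<open>dissect_c\<close> a prefactor. The parameter
  does not depend on \<open>t\<close>, so moving every last argument to one \<open>z'\<close>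
  produces a single Appell--Lerch series.\<close>

definition dissect_w :: "nat \<Rightarrow> nat \<Rightarrow> complex \<Rightarrow> nat \<Rightarrow> complex" where
  "dissect_w n k z t = - (q powi (int (Suc n choose 2) + int n * int k + int n * int t)) * (- z) ^ n"

definition dissect_x :: "nat \<Rightarrow> nat \<Rightarrow> complex \<Rightarrow> complex" where
  "dissect_x n k x = - (q powi (int (n choose 2) - int n * int k)) * (- x) ^ n"

definition dissect_c :: "nat \<Rightarrow> complex \<Rightarrow> nat \<Rightarrow> complex" where
  "dissect_c k z t = - (z * (- z) ^ t * q powi (int (Suc t choose 2) + int k * int t))"

lemma dissect_term:
  assumes "z \<noteq> 0"
  shows "theta_coeff q (int n * s + int t + 1) * z powi (int n * s + int t + 1)
      * q powi (int k * (int n * s + int t))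
    = dissect_c k z t
      * (theta_coeff (q ^ n\<^sup>2) s * dissect_w n k z t powi s)"
proof -
  define e where "e = int (Suc n choose 2) + int n * int k + int n * int t"
  have ex: "tri (int n * s + int t + 1) + int k * (int n * s + int t)
      = int (Suc t choose 2) + int k * int t + (int (n\<^sup>2) * tri s + e * s)"
  proof -
    have "2 * (tri (int n * s + int t + 1) + int k * (int n * s + int t))
      = 2 * (int (Suc t choose 2) + int k * int t + (int (n\<^sup>2) * tri s + e * s))"
      using two_tri[of "int n * s + int t + 1"] two_tri[of "int (Suc t)"]
        two_tri[of "int (Suc n)"] arg_cong[OF two_tri[of s], of "\<lambda>x. int n * int n * x"]
      unfolding e_def choose_two_tri by (simp add: algebra_simps power2_eq_square)
    then show ?thesis by simp
  qed
  have w: "dissect_w n k z t powi s = (-1) powi s * q powi (e * s) * (- z) powi (int n * s)"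
  proof -
    have "dissect_w n k z t = (-1) * q powi e * (- z) ^ n"
      by (simp add: dissect_w_def e_def)
    then show ?thesis
      by (simp only: power_int_mult_distrib power_int_mult power_int_of_nat)
  qed
  have z1: "(- z) ^ t * (- z) powi (int n * s) = (-1) powi (int n * s + int t) * z powi (int n * s + int t)"
  proof -
    have "(- z) ^ t * (- z) powi (int n * s) = (- z) powi (int n * s + int t)"
      using assms by (simp add: power_int_add)
    also have "\<dots> = ((-1) * z) powi (int n * s + int t)" by simp
    finally show ?thesis by (simp only: power_int_mult_distrib)
  qed
  have th: "theta_coeff (q ^ n\<^sup>2) s = (-1) powi s * q powi (int (n\<^sup>2) * tri s)"
    by (simp only: theta_coeff_def power_int_mult power_int_of_nat)
  have "dissect_c k z t * (theta_coeff (q ^ n\<^sup>2) s * dissect_w n k z t powi s)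
    = - z * ((- z) ^ t * (- z) powi (int n * s)) * ((-1) powi s * (-1) powi s) *
      (q powi (int (Suc t choose 2) + int k * int t) * (q powi (int (n\<^sup>2) * tri s) * q powi (e * s)))"
    unfolding th w dissect_c_def by (simp only: mult_ac mult_minus_left mult_minus_right)
  also have "(-1 :: complex) powi s * (-1) powi s = 1"
    by (simp flip: power_int_mult_distrib)
  also have "q powi (int (Suc t choose 2) + int k * int t) * (q powi (int (n\<^sup>2) * tri s) * q powi (e * s))
    = q powi (tri (int n * s + int t + 1) + int k * (int n * s + int t))"
    unfolding ex using q_nz by (simp add: power_int_add)
  finally show ?thesis
    unfolding z1 using assms q_nz
    by (simp add: theta_coeff_def power_int_add)
qed

lemma dissect_denominator:
  assumes "z \<noteq> 0"
  shows "(q ^ n\<^sup>2) powi (s - 1) * dissect_x n k x * dissect_w n k z t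
    = q powi (int n * (int n * s + int t)) * (x * z) ^ n"
proof -
  have ex: "int (n\<^sup>2) * (s - 1) + (int (n choose 2) - int n * int k)
      + (int (Suc n choose 2) + int n * int k + int n * int t) = int n * (int n * s + int t)"
  proof -
    have "2 * (int (n\<^sup>2) * (s - 1) + (int (n choose 2) - int n * int k)
      + (int (Suc n choose 2) + int n * int k + int n * int t)) = 2 * (int n * (int n * s + int t))"
      using two_tri[of "int n"] two_tri[of "int (Suc n)"]
      unfolding choose_two_tri by (simp add: algebra_simps power2_eq_square)
    then show ?thesis by simp
  qed
  have "(q ^ n\<^sup>2) powi (s - 1) * dissect_x n k x * dissect_w n k z t
      = (q powi (int (n\<^sup>2) * (s - 1)) * q powi (int (n choose 2) - int n * int k)
         * q powi (int (Suc n choose 2) + int n * int k + int n * int t)) * ((- x) ^ n * (- z) ^ n)"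
    unfolding dissect_x_def dissect_w_def power_int_mult[of q "int (n\<^sup>2)"] power_int_of_nat
    by (simp only: mult_ac mult_minus_left mult_minus_right minus_minus)
  also have "(- x) ^ n * (- z) ^ n = (x * z) ^ n"
    by (simp flip: power_mult_distrib)
  also have "q powi (int (n\<^sup>2) * (s - 1)) * q powi (int (n choose 2) - int n * int k)
         * q powi (int (Suc n choose 2) + int n * int k + int n * int t)
       = q powi (int n * (int n * s + int t))"
    unfolding ex[symmetric] using q_nz by (simp only: power_int_add simp_thms)
  finally show ?thesis .
qed


lemma nome_power: "m > 0 \<Longrightarrow> nome (q ^ m)"
  using q_lt1 by unfold_locales (auto simp: norm_power intro: power_Suc_less_one power_less_one_iff[THEN iffD2])

text \<open>The left-hand sum is the theta series of \<open>z\<close> with weights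
  \<open>q^(k (r - 1))\<close>, split modulo \<open>n\<close>; it equals
  \<open>q^(-k) j(q^k z)\<close>, which quasi-periodicity reduces to \<open>j(z)\<close>. In
  \<open>appell_lerch_dissection\<close> this cancels the denominator \<open>j(z)\<close> in front
  of the common Appell--Lerch series.\<close>

lemma theta_dissection:
  assumes "z \<noteq> 0" "n > 0"
  shows "(\<Sum>t<n. dissect_c k z t
      * jtheta (dissect_w n k z t) (q ^ n\<^sup>2)) * ((x * z) ^ k)
    = q powi (- int (Suc k choose 2)) * (- x) ^ k * jtheta z q"
proof -
  interpret Q: nome "q ^ n\<^sup>2" using assms(2) by (intro nome_power) simp
  have w: "dissect_w n k z t \<noteq> 0" for t
    using assms(1) by (simp add: dissect_w_def)
  have eq: "theta_coeff q r * z powi r * q powi (int k * (r - 1))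
      = q powi (- int k) * (theta_coeff q r * (q ^ k * z) powi r)" for r
  proof -
    have "(q ^ k * z) powi r = q powi (int k * r) * z powi r"
      by (simp add: power_int_mult_distrib power_int_mult)
    moreover have "q powi (int k * (r - 1)) = q powi (int k * r) * q powi (- int k)"
      by (simp add: algebra_simps flip: power_int_add)
    ultimately show ?thesis by (simp add: mult_ac)
  qed
  have hs: "((\<lambda>r. theta_coeff q r * z powi r * q powi (int k * (r - 1))) has_sum
      q powi (- int k) * jtheta (q ^ k * z) q) UNIV"
    unfolding eq using assms by (intro has_sum_cmult_right jacobi_triple_product) auto
  have "q powi (- int k) * jtheta (q ^ k * z) q
      = (\<Sum>t<n. \<Sum>\<^sub>\<infinity>s. theta_coeff q (int n * s + int t + 1) * z powi (int n * s + int t + 1)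
          * q powi (int k * (int n * s + int t + 1 - 1)))"
    using infsum_int_dissect[OF has_sum_imp_summable[OF hs] assms(2)] infsumI[OF hs] by simp
  also have "\<dots> = (\<Sum>t<n. \<Sum>\<^sub>\<infinity>s. dissect_c k z t
      * (theta_coeff (q ^ n\<^sup>2) s * dissect_w n k z t powi s))"
    by (simp only: add_diff_cancel_right' dissect_term[OF assms(1)])
  also have "\<dots> = (\<Sum>t<n. dissect_c k z t
      * jtheta (dissect_w n k z t) (q ^ n\<^sup>2))"
    by (simp only: infsum_cmult_right' infsumI[OF Q.jacobi_triple_product[OF w]])
  finally have 1: "(\<Sum>t<n. dissect_c k z t
      * jtheta (dissect_w n k z t) (q ^ n\<^sup>2)) = q powi (- int k) * jtheta (q ^ k * z) q"
    by (rule sym)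
  have 2: "jtheta (q ^ k * z) q * theta_coeff q k * z ^ k = jtheta z q"
    using jtheta_powi_mult[OF assms(1), of "int k"] by simp
  \<comment> \<open>The exponents match because \<open>Suc k choose 2\<close> is
    \<open>tri k + k\<close>.\<close>
  have 3: "q powi (- int (Suc k choose 2)) * (- 1) ^ k * theta_coeff q (int k) = q powi (- int k)"
  proof -
    have "(-1 :: complex) ^ k * (-1) ^ k = 1" by (simp flip: power_mult_distrib)
    moreover have "int (Suc k choose 2) = tri (int k) + int k"
      unfolding choose_two_tri using tri_add1[of "int k"] by (simp add: add.commute)
    then have "q powi (- int (Suc k choose 2)) * q powi tri (int k) = q powi (- int k)"
      by (simp flip: power_int_add)
    ultimately show ?thesis
      by (simp add: theta_coeff_def mult_ac)
  qed
  have "q powi (- int (Suc k choose 2)) * (- x) ^ k * jtheta z q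
      = (q powi (- int (Suc k choose 2)) * (- 1) ^ k * theta_coeff q (int k))
        * jtheta (q ^ k * z) q * (x ^ k * z ^ k)"
    unfolding 2[symmetric] by (subst power_minus[of x]) (simp only: mult_ac)
  then show ?thesis
    unfolding 1 3 by (simp only: power_mult_distrib)
qed

text \<open>Averaging over the roots of unity replaces \<open>1 / (1 - y)\<close> by
  \<open>y^k / (1 - y^n)\<close>, where \<open>y = q^(r-1) x z\<close>; the index is then split
  modulo \<open>n\<close>. The condition on \<open>|x z|\<close> excludes a pole for all
  \<open>n\<close> averaged series at once, since they differ by factors of modulus 1.\<close>

lemma appell_num_dissection:
  assumes nz: "x \<noteq> 0" "z \<noteq> 0" and k: "k < n"
    and xz: "\<And>l :: int. norm (x * z) \<noteq> norm q powi l"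
  shows "(\<Sum>t<n. zeta n powi (- (int k * int t)) * appell_num (zeta n ^ t * x) q z)
    = of_nat n * ((x * z) ^ k * (\<Sum>t<n. dissect_c k z t
      * appell_num (dissect_x n k x) (q ^ n\<^sup>2) (dissect_w n k z t)))"
proof -
  have n: "n > 0" using k by simp
  interpret Q: nome "q ^ n\<^sup>2" using n by (intro nome_power) simp
  have ne: "zeta n ^ t * x * z \<noteq> q powi l" for t l
  proof
    assume "zeta n ^ t * x * z = q powi l"
    then have "norm (zeta n ^ t * x * z) = norm q powi l" by (simp add: norm_power_int)
    then show False using xz[of l] by (simp add: norm_mult norm_power norm_zeta)
  qed
  define y where "y r = q powi (r - 1) * (x * z)" for r
  have yn: "y r ^ n \<noteq> 1" for r
  proof
    assume "y r ^ n = 1"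
    then have "norm (y r) ^ n = 1" by (metis norm_one norm_power)
    then have "norm (y r) ^ n = 1 ^ n" by simp
    then have "norm (y r) = 1" by (rule power_eq_imp_eq_base) (use n in auto)
    then have "norm q powi (r - 1) * norm (x * z) = 1"
      by (simp only: y_def norm_mult norm_power_int)
    moreover have "norm q powi (1 - r) * norm q powi (r - 1) = 1"
      using q_pos by (simp flip: power_int_add)
    ultimately have "norm (x * z) = norm q powi (1 - r)"
      by (metis mult.assoc mult.right_neutral mult_1)
    then show False using xz by blast
  qed
  let ?g = "\<lambda>r. theta_coeff q r * z powi r * q powi (int k * (r - 1)) / (1 - y r ^ n)"
  have "((\<lambda>r. \<Sum>t<n. zeta n powi (- (int k * int t)) *
      (theta_coeff q r * z powi r / (1 - q powi (r - 1) * (zeta n ^ t * x) * z))) has_sum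
      (\<Sum>t<n. zeta n powi (- (int k * int t)) * appell_num (zeta n ^ t * x) q z)) UNIV"
    by (intro has_sum_sum has_sum_cmult_right appell_num_has_sum nz ne)
  also have "(\<lambda>r. \<Sum>t<n. zeta n powi (- (int k * int t)) *
      (theta_coeff q r * z powi r / (1 - q powi (r - 1) * (zeta n ^ t * x) * z)))
      = (\<lambda>r. of_nat n * (x * z) ^ k * ?g r)"
  proof
    fix r :: int
    have "(\<Sum>t<n. zeta n powi (- (int k * int t)) *
      (theta_coeff q r * z powi r / (1 - q powi (r - 1) * (zeta n ^ t * x) * z)))
      = theta_coeff q r * z powi r * (\<Sum>t<n. zeta n powi (- (int k * int t)) / (1 - zeta n ^ t * y r))"
      unfolding sum_distrib_left y_def by (intro sum.cong) (simp_all add: mult_ac)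
    also have "\<dots> = theta_coeff q r * z powi r * (of_nat n * (y r ^ k / (1 - y r ^ n)))"
      by (simp only: average_over_roots_of_unity[OF k yn])
    also have "y r ^ k = q powi (int k * (r - 1)) * (x * z) ^ k"
      by (simp add: y_def power_mult_distrib power_int_mult mult.commute[of "int k"])
    finally show "(\<Sum>t<n. zeta n powi (- (int k * int t)) *
      (theta_coeff q r * z powi r / (1 - q powi (r - 1) * (zeta n ^ t * x) * z)))
      = of_nat n * (x * z) ^ k * ?g r" by (simp add: mult_ac)
  qed
  finally have h: "((\<lambda>r. of_nat n * (x * z) ^ k * ?g r) has_sum
      (\<Sum>t<n. zeta n powi (- (int k * int t)) * appell_num (zeta n ^ t * x) q z)) UNIV" .
  have c: "of_nat n * (x * z) ^ k \<noteq> 0" using n nz by simp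
  have sm: "?g summable_on UNIV"
    by (rule iffD1[OF summable_on_cmult_right'[OF c] has_sum_imp_summable[OF h]])
  have "(\<Sum>t<n. zeta n powi (- (int k * int t)) * appell_num (zeta n ^ t * x) q z)
      = of_nat n * (x * z) ^ k * infsum ?g UNIV"
    using infsumI[OF h] by (simp only: infsum_cmult_right')
  also have "infsum ?g UNIV = (\<Sum>t<n. \<Sum>\<^sub>\<infinity>s. ?g (int n * s + int t + 1))"
    by (rule infsum_int_dissect[OF sm n])
  also have "\<dots> = (\<Sum>t<n. \<Sum>\<^sub>\<infinity>s. dissect_c k z t
      * (theta_coeff (q ^ n\<^sup>2) s * dissect_w n k z t powi s /
        (1 - (q ^ n\<^sup>2) powi (s - 1) * dissect_x n k x * dissect_w n k z t)))"
  proof (intro sum.cong infsum_cong refl)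
    fix t s
    have "y (int n * s + int t + 1) ^ n = (q ^ n\<^sup>2) powi (s - 1) * dissect_x n k x * dissect_w n k z t"
      unfolding dissect_denominator[OF nz(2)] y_def
      unfolding mult.commute[of "int n" "int n * s + int t"] power_int_mult[of q "int n * s + int t"]
      by (simp add: power_mult_distrib)
    then show "?g (int n * s + int t + 1) = dissect_c k z t
      * (theta_coeff (q ^ n\<^sup>2) s * dissect_w n k z t powi s /
        (1 - (q ^ n\<^sup>2) powi (s - 1) * dissect_x n k x * dissect_w n k z t))"
      unfolding add_diff_cancel_right' dissect_term[OF nz(2)] by simp
  qed
  also have "\<dots> = (\<Sum>t<n. dissect_c k z t
      * appell_num (dissect_x n k x) (q ^ n\<^sup>2) (dissect_w n k z t))"
    by (simp only: infsum_cmult_right' appell_num_def)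
  finally show ?thesis by (simp only: mult.assoc)
qed

text \<open>The splitting yields \<open>n\<close> numerators with different last arguments
  \<open>w t\<close>, and \<open>appell_num_change\<close> moves each to \<open>z'\<close>. The
  multiples of \<open>m(X, Q, z')\<close> are collected by \<open>theta_dissection\<close>; the
  theta quotients add up to \<open>Psi_quot\<close>. The condition on \<open>- ((- z) ^ n)\<close>
  keeps every \<open>w t\<close> away from the zeros of \<open>j\<close>.\<close>

theorem appell_lerch_dissection:
  assumes nz: "x \<noteq> 0" "z \<noteq> 0" "z' \<noteq> 0" and k: "k < n"
    and jz: "jtheta z q \<noteq> 0"
    and xz: "\<And>l :: int. norm (x * z) \<noteq> norm q powi l"
    and zn: "\<And>l :: int. - ((- z) ^ n) \<noteq> q powi l"
    and gen: "\<And>l :: int. z' \<noteq> (q ^ n\<^sup>2) powi l" "\<And>l :: int. dissect_x n k x * z' \<noteq> (q ^ n\<^sup>2) powi l"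
  shows "(\<Sum>t<n. zeta n powi (- (int k * int t)) * appell_lerch (zeta n ^ t * x) q z)
    = of_nat n * (q powi (- int (Suc k choose 2)) * (- x) ^ k
        * appell_lerch (dissect_x n k x) (q ^ n\<^sup>2) z' + Psi_quot n (int k) x z z' q)"
proof -
  have n: "n > 0" using k by simp
  interpret Q: nome "q ^ n\<^sup>2" using n by (intro nome_power) simp
  define Q X where "Q = q ^ n\<^sup>2" and "X = dissect_x n k x"
  define w where "w t = dissect_w n k z t" for t
  define c where "c t = dissect_c k z t" for t
  define Y where "Y t = q ^ (n * t) * (x * z) ^ n" for t
  define H where "H t = jtheta (w t / z') Q * jtheta (Y t * z') Q
      / (jtheta (X * z') Q * jtheta (Y t) Q)" for t
  have X: "X \<noteq> 0" using nz by (simp add: X_def dissect_x_def)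
  have w: "w t \<noteq> 0" for t using nz by (simp add: w_def dissect_w_def)
  have Y: "Y t \<noteq> 0" for t using nz by (simp add: Y_def)
  have Qnz: "Q \<noteq> 0" by (simp add: Q_def)
  have jw: "jtheta (w t) Q \<noteq> 0" for t
  proof
    assume "jtheta (w t) Q = 0"
    then obtain l :: int where "w t = Q powi l"
      using Q.jtheta_eq_0_iff[of "w t"] w by (auto simp: Q_def)
    then have "q powi (int (Suc n choose 2) + int n * int k + int n * int t) * - ((- z) ^ n)
        = q powi (int (n\<^sup>2) * l)"
      unfolding w_def dissect_w_def Q_def power_int_mult power_int_of_nat by simp
    then have "- ((- z) ^ n) = q powi (int (n\<^sup>2) * l
        - (int (Suc n choose 2) + int n * int k + int n * int t))"
      by (subst power_int_diff) (simp_all add: field_simps)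
    then show False using zn by blast
  qed
  \<comment> \<open>The theta functions produced by the change of argument are thus one quasi-period
    away from those in \<open>Psi_quot\<close>.\<close>
  have XwY: "X * w t = Q * Y t" for t
    using dissect_denominator[OF nz(2), of n 0 k x t] Qnz
    unfolding X_def[symmetric] w_def[symmetric] Q_def[symmetric] Y_def
    by (simp add: power_int_minus field_simps flip: power_int_of_nat)
  have nXw: "norm (X * w t) \<noteq> norm Q powi l" for t l
  proof
    assume "norm (X * w t) = norm Q powi l"
    then have "norm q powi (int n * int t) * norm (x * z) ^ n = norm q powi (int (n\<^sup>2) * (l - 1))"
      unfolding XwY Y_def power_int_mult power_int_of_nat
      using Qnz by (simp add: norm_mult norm_power Q_def power_int_diff field_simps flip: power_mult)
    then have "norm (x * z) ^ n = norm q powi (int (n\<^sup>2) * (l - 1) - int n * int t)"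
      by (subst power_int_diff) (simp_all add: field_simps)
    also have "int (n\<^sup>2) * (l - 1) - int n * int t = (int n * (l - 1) - int t) * int n"
      by (simp add: power2_eq_square algebra_simps)
    also have "norm q powi \<dots> = (norm q powi (int n * (l - 1) - int t)) ^ n"
      unfolding power_int_mult power_int_of_nat ..
    finally have "norm (x * z) = norm q powi (int n * (l - 1) - int t)"
      by (rule power_eq_imp_eq_base) (use n in auto)
    then show False using xz by blast
  qed
  have jz': "jtheta z' Q \<noteq> 0"
    using Q.jtheta_eq_0_iff[of z'] nz gen by (auto simp: Q_def)
  have change: "appell_num X Q (w t) = jtheta (w t) Q * appell_lerch X Q z'
      + qpoch_inf Q Q ^ 3 / jtheta z' Q * H t" for t
  proof -
    have "jtheta z' Q * appell_num X Q (w t) - jtheta (w t) Q * appell_num X Q z'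
      = z' * qpoch_inf Q Q ^ 3 * jtheta (w t / z') Q * jtheta (X * z' * w t) Q /
      (jtheta (X * z') Q * jtheta (X * w t) Q)"
      using Q.appell_num_change[of X "w t" z'] X w nz nXw gen jw by (simp add: Q_def X_def)
    also have "X * z' * w t = Q * (Y t * z')" using XwY[of t] by (simp add: mult_ac)
    also have "jtheta (Q * (Y t * z')) Q = - jtheta (Y t * z') Q / (Y t * z')"
      using Q.jtheta_qmult[of "Y t * z'"] Y nz by (simp add: Q_def)
    also have "jtheta (X * w t) Q = - jtheta (Y t) Q / Y t"
      using Q.jtheta_qmult[of "Y t"] Y by (simp add: Q_def XwY)
    \<comment> \<open>The two quasi-period factors leave \<open>1 / z'\<close>, which cancels the
      leading \<open>z'\<close>.\<close>
    also have "z' * qpoch_inf Q Q ^ 3 * jtheta (w t / z') Q * (- jtheta (Y t * z') Q / (Y t * z')) /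
      (jtheta (X * z') Q * (- jtheta (Y t) Q / Y t))
      = qpoch_inf Q Q ^ 3 * H t"
      using Y[of t] nz by (simp add: H_def)
    finally have "jtheta z' Q * appell_num X Q (w t) = jtheta (w t) Q * appell_num X Q z'
      + qpoch_inf Q Q ^ 3 * H t"
      by (simp only: algebra_simps)
    then have "appell_num X Q (w t) = (jtheta (w t) Q * appell_num X Q z'
      + qpoch_inf Q Q ^ 3 * H t) / jtheta z' Q"
      by (intro eq_divide_imp[OF jz']) (simp only: mult.commute)
    then show ?thesis
      unfolding appell_lerch_eq by (simp add: add_divide_distrib)
  qed
  have theta: "(x * z) ^ k * (\<Sum>t<n. c t * jtheta (w t) Q)
      = q powi (- int (Suc k choose 2)) * (- x) ^ k * jtheta z q"
    using theta_dissection[OF nz(2) n, of k x] unfolding c_def w_def Q_def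
    by (simp only: mult.commute)
  have psi: "Psi_quot n (int k) x z z' q = (x * z) ^ k / jtheta z q * (\<Sum>t<n. c t *
      (qpoch_inf Q Q ^ 3 / jtheta z' Q * H t))"
  proof -
    have "z powi (int k + 1) = z ^ k * z"
      using nz by (simp add: power_int_add)
    then show ?thesis
      unfolding Psi_quot_def sum_distrib_left
      by (intro sum.cong refl) (simp add: H_def c_def dissect_c_def w_def Y_def X_def Q_def dissect_w_def dissect_x_def
          power_mult_distrib mult_ac)
  qed
  have "(\<Sum>t<n. zeta n powi (- (int k * int t)) * appell_lerch (zeta n ^ t * x) q z)
      = (\<Sum>t<n. zeta n powi (- (int k * int t)) * appell_num (zeta n ^ t * x) q z) / jtheta z q"
    by (simp add: appell_lerch_eq sum_divide_distrib)
  also have "(\<Sum>t<n. zeta n powi (- (int k * int t)) * appell_num (zeta n ^ t * x) q z)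
      = of_nat n * ((x * z) ^ k * (\<Sum>t<n. c t * appell_num X Q (w t)))"
    unfolding c_def w_def X_def Q_def by (rule appell_num_dissection[OF nz(1,2) k xz])
  also have "(\<Sum>t<n. c t * appell_num X Q (w t))
      = (\<Sum>t<n. c t * jtheta (w t) Q) * appell_lerch X Q z'
        + (\<Sum>t<n. c t * (qpoch_inf Q Q ^ 3 / jtheta z' Q *
        H t))"
    unfolding change by (simp only: distrib_left sum.distrib sum_distrib_right mult.assoc)
  also have "(x * z) ^ k * \<dots> = ((x * z) ^ k * (\<Sum>t<n. c t * jtheta (w t) Q)) * appell_lerch X Q z'
        + (x * z) ^ k * (\<Sum>t<n. c t * (qpoch_inf Q Q ^ 3 / jtheta z' Q *
        H t))"
    by (simp only: distrib_left mult.assoc)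
  also have "of_nat n * \<dots> / jtheta z q = of_nat n * (q powi (- int (Suc k choose 2)) * (- x) ^ k
        * appell_lerch X Q z' + Psi_quot n (int k) x z z' q)"
    unfolding theta psi using jz by (simp add: field_simps)
  finally show ?thesis unfolding X_def Q_def .
qed

end

section \<open>The rank generating function as a basic hypergeometric series\<close>

lemma infsum_eq_suminf:
  fixes f :: "nat \<Rightarrow> complex"
  assumes "summable (\<lambda>n. norm (f n))"
  shows "infsum f UNIV = suminf f"
  by (rule infsumI[OF norm_summable_imp_has_sum[OF assms summable_sums[OF summable_norm_cancel[OF assms]]]])

lemma suminf_telescope:
  fixes f g G :: "nat \<Rightarrow> complex"
  assumes "\<And>m. f m - g m = G m - G (Suc m)" "G \<longlonglongrightarrow> 0" "summable g"
  shows "f sums (G 0 + suminf g)"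
proof -
  have "(\<lambda>m. G m - G (Suc m)) sums (G 0 - 0)"
    using assms(2) by (rule telescope_sums')
  then have "(\<lambda>m. (f m - g m) + g m) sums (G 0 - 0 + suminf g)"
    unfolding assms(1) by (intro sums_add summable_sums assms(3))
  then show ?thesis by simp
qed

lemma qfac_split: "qfac a q (m + n) = qfac a q m * qfac (a * q ^ m) q n"
  by (induction n) (simp_all add: qfac_Suc power_add mult_ac)

lemma qfac_shift: "(1 - a) * qfac (a * q) q n = qfac a q n * (1 - a * q ^ n)"
  using qfac_Suc[of a q n] qfac_Suc'[of a q n] by simp

lemma qfac_nz: "(\<And>k. a * q ^ k \<noteq> 1) \<Longrightarrow> qfac a q n \<noteq> 0"
  by (auto simp: qfac_def)

context nome
begin

lemma qfac_even_tendsto: "(\<lambda>n. qfac x q (2 * n)) \<longlonglongrightarrow> qpoch_inf x q"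
  by (rule filterlim_compose[OF qfac_tendsto filterlim_subseq]) (simp add: strict_mono_def)

text \<open>The bound is uniform in shift and length because a shifted product is the quotient of
  two products starting at \<open>x\<close>.\<close>

lemma inverse_qfac_shifted_bounded:
  assumes x: "\<And>k. x * q ^ k \<noteq> 1"
  obtains K where "K > 0" "\<And>N m. norm (1 / qfac (x * q ^ N) q m) \<le> K"
proof -
  obtain C where C: "C > 0" "\<And>n. norm (qfac x q n) \<le> C"
    by (rule qfac_bounded[of x], rule that)
  obtain D where D: "D > 0" "\<And>n. norm (1 / qfac x q n) \<le> D"
    by (rule inverse_qfac_bounded[OF x], rule that)
  have "norm (1 / qfac (x * q ^ N) q m) \<le> C * D" for N m
  proof -
    have "qfac x q N \<noteq> 0" using x by (rule qfac_nz)
    then have "1 / qfac (x * q ^ N) q m = qfac x q N * (1 / qfac x q (N + m))"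
      by (simp add: qfac_split)
    then show ?thesis
      unfolding norm_mult[symmetric] using C D by (simp only: norm_mult) (intro mult_mono; simp)
  qed
  then show ?thesis using that[of "C * D"] C(1) D(1) by simp
qed

end

section \<open>The chain of contiguous series\<close>

locale nome_square = nome +
  fixes p :: complex
  assumes p_def: "p = q\<^sup>2"
begin

sublocale p: nome p
  unfolding p_def by (rule nome_power) simp

text \<open>The generating function of the overpartitions with \<open>rank_index\<close> at most
  \<open>m\<close>, with \<open>u\<close> marking the parts counted by \<open>marked_parts\<close>;
  see \<open>op_weight_rank_index_le\<close>.\<close>

definition rank_prod :: "complex \<Rightarrow> nat \<Rightarrow> complex" where
  "rank_prod u m = qfac (- (u * q)) q (2 * m) / (qfac (u * p) p m * qfac q p (Suc m))"

text \<open>Level \<open>k = 0\<close> is \<open>rank_prod u m / u ^ m\<close>. Each further level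
  multiplies by \<open>p\<close> both the parameter \<open>u p\<close> of the denominator and the
  argument \<open>1 / u\<close>, so from level 1 on the series converges geometrically.\<close>

definition chain_term :: "complex \<Rightarrow> nat \<Rightarrow> nat \<Rightarrow> complex" where
  "chain_term u k m = qfac (- (u * q)) q (2 * m) /
     (qfac (u * p ^ Suc k) p m * qfac q p (Suc m)) * (p ^ k / u) ^ m"

lemma unit_times_power_neq_1:
  assumes "norm u = 1"
  shows "u * p ^ Suc k \<noteq> 1"
proof
  assume "u * p ^ Suc k = 1"
  then have "norm (u * p ^ Suc k) = 1" by simp
  then have "norm p ^ Suc k = 1" using assms by (simp add: norm_mult norm_power)
  then show False using power_Suc_less_one[OF p.q_pos p.q_lt1, of k] by simp
qed

lemma q_even_power: "q ^ (2 * m) = p ^ m"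
  by (simp add: p_def power_mult)

lemma q_times_power_neq_1: "q * p ^ k \<noteq> 1"
  using q_power_neq_1[of "2 * k"] by (simp add: q_even_power)

lemma chain_term_bound:
  assumes "norm u = 1"
  obtains K where "K > 0" "\<And>k m. norm (chain_term u k m) \<le> K * (norm p ^ k) ^ m"
proof -
  obtain A where A: "A > 0" "\<And>n. norm (qfac (- (u * q)) q n) \<le> A"
    using qfac_bounded[of "- (u * q)"] by blast
  obtain E where E: "E > 0" "\<And>n. norm (1 / qfac q p n) \<le> E"
    using p.inverse_qfac_bounded[of q] q_times_power_neq_1 by blast
  have "u * p * p ^ k \<noteq> 1" for k
    using unit_times_power_neq_1[OF assms, of k] by (simp add: mult.assoc)
  from p.inverse_qfac_shifted_bounded[OF this]
  obtain D where D: "D > 0" "\<And>k m. norm (1 / qfac (u * p * p ^ k) p m) \<le> D"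
    by metis
  have D': "norm (1 / qfac (u * p ^ Suc k) p m) \<le> D" for k m
    using D(2)[of k m] by (simp only: power_Suc mult.assoc)
  have "norm (chain_term u k m) \<le> A * D * E * (norm p ^ k) ^ m" for k m
  proof -
    have "chain_term u k m = qfac (- (u * q)) q (2 * m) * (1 / qfac (u * p ^ Suc k) p m)
        * (1 / qfac q p (Suc m)) * (p ^ k / u) ^ m"
      by (simp add: chain_term_def)
    then have "norm (chain_term u k m) = norm (qfac (- (u * q)) q (2 * m))
        * norm (1 / qfac (u * p ^ Suc k) p m)
        * norm (1 / qfac q p (Suc m)) * (norm p ^ k) ^ m"
      using assms by (simp only: norm_mult norm_power norm_divide div_by_1)
    also have "\<dots> \<le> A * D * E * (norm p ^ k) ^ m"
      by (intro mult_mono A D' E mult_nonneg_nonneg) (use A D E in auto)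
    finally show ?thesis .
  qed
  then show ?thesis using that[of "A * D * E"] A(1) D(1) E(1) by simp
qed

text \<open>The multiplier between the sums at levels \<open>k\<close> and \<open>k + 1\<close>.
  Together with the factors \<open>1 - p^k / u\<close>, its successive products build up
  \<open>rank_coeff\<close>.\<close>

definition chain_factor :: "complex \<Rightarrow> nat \<Rightarrow> complex" where
  "chain_factor u k = q * (1 + p ^ k) * (1 + q * p ^ k) / (1 - u * p ^ Suc k)"

text \<open>The telescoping certificate is \<open>(1 - q p^m) * chain_term u k m\<close>. The terms
  at \<open>(k + 1, m)\<close> and \<open>(k, m + 1)\<close> are rational multiples of the one at
  \<open>(k, m)\<close>; once the factor \<open>1 - D * y\<close> is cleared, a polynomial identity
  in \<open>q\<close>, \<open>u\<close>, \<open>x\<close> and \<open>y\<close> remains.\<close>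

lemma chain_telescope:
  assumes u: "norm u = 1"
  shows "(1 - p ^ k / u) * chain_term u k m - chain_factor u k * chain_term u (Suc k) m
    = (1 - q * p ^ m) * chain_term u k m - (1 - q * p ^ Suc m) * chain_term u k (Suc m)"
proof -
  define y P z where "y = p ^ m" and "P = p ^ k" and "z = 1 / u"
  define D x where "D = u * p * P" and "x = z * P"
  define a where "a = chain_term u k m"
  have uz: "u * z = 1" using u by (auto simp: z_def)
  have D: "D = u * p ^ Suc k" by (simp add: D_def P_def)
  have xk: "x = p ^ k / u" by (simp add: x_def z_def P_def)
  have Dk: "D * p ^ i \<noteq> 1" for i
    using unit_times_power_neq_1[OF u, of "k + i"] by (simp add: D power_add mult_ac)
  have D1: "1 - D \<noteq> 0" "1 - D * y \<noteq> 0" using Dk[of 0] Dk[of m] by (auto simp: y_def)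
  have qy: "1 - q * (p * y) \<noteq> 0" using q_times_power_neq_1[of "Suc m"] by (simp add: y_def)
  have step_k: "(1 - D * y) * chain_term u (Suc k) m = a * y * (1 - D)"
  proof -
    have "qfac (D * p) p m \<noteq> 0" "qfac D p m \<noteq> 0"
      using Dk Dk[of "Suc _"] by (auto intro!: qfac_nz simp: mult_ac)
    moreover have "(1 - D) * qfac (D * p) p m = qfac D p m * (1 - D * y)"
      unfolding y_def by (rule qfac_shift)
    ultimately have f: "(1 - D * y) / qfac (D * p) p m = (1 - D) / qfac D p m"
      by (simp add: frac_eq_eq mult.commute)
    have e1: "(p ^ Suc k / u) ^ m = x ^ m * y"
      by (simp add: xk y_def power_mult_distrib power_divide)
    have e2: "u * p ^ Suc (Suc k) = D * p" by (simp add: D mult_ac)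
    have "(1 - D * y) * chain_term u (Suc k) m = qfac (- (u * q)) q (2 * m)
        / qfac q p (Suc m) * (x ^ m * y) * ((1 - D * y) / qfac (D * p) p m)"
      unfolding chain_term_def e1 e2 by (simp add: mult_ac)
    then show ?thesis
      unfolding f a_def chain_term_def D[symmetric] xk[symmetric]
      by (simp add: mult_ac)
  qed
  have step_m: "(1 - q * (p * y)) * (1 - D * y) * chain_term u k (Suc m)
      = a * (x * (1 + u * q * y) * (1 + u * p * y))"
  proof -
    have q2: "q ^ (2 * m) = y" by (simp add: y_def q_even_power)
    have 1: "qfac (- (u * q)) q (2 * Suc m)
        = qfac (- (u * q)) q (2 * m) * ((1 + u * q * y) * (1 + u * p * y))"
    proof -
      have "2 * Suc m = Suc (Suc (2 * m))" by simp
      then show ?thesis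
        by (simp only: qfac_Suc power_Suc q2) (simp add: p_def power2_eq_square mult_ac)
    qed
    have 2: "qfac D p (Suc m) = qfac D p m * (1 - D * y)"
      "qfac q p (Suc (Suc m)) = qfac q p (Suc m) * (1 - q * (p * y))"
      by (simp_all add: qfac_Suc y_def)
    show ?thesis
      unfolding a_def chain_term_def D[symmetric] xk[symmetric] 1 2
      using qy D1(2) by simp
  qed
  have "chain_factor u k = q * (1 + P) * (1 + q * P) / (1 - D)"
    by (simp add: chain_factor_def P_def D)
  then have lam: "chain_factor u k * (1 - D) = q * (1 + P) * (1 + q * P)"
    using D1(1) by simp
  have "(1 - D * y) * ((1 - x) * a - chain_factor u k * chain_term u (Suc k) m)
      = (1 - D * y) * (1 - x) * a - chain_factor u k * ((1 - D * y) * chain_term u (Suc k) m)"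
  proof -
    have "E * (X * Z - L * C) = E * X * Z - L * (E * C)" for E X Z L C :: complex
      by (simp add: algebra_simps)
    then show ?thesis by (simp only:)
  qed
  also have "\<dots> = a * ((1 - D * y) * (1 - x) - q * (1 + P) * (1 + q * P) * y)"
  proof -
    have "E * X * a - L * (a * y * F) = a * (E * X - L * F * y)" for E X L F :: complex
      by (simp add: algebra_simps)
    then show ?thesis unfolding step_k lam[symmetric] by (simp only:)
  qed
  also have "(1 - D * y) * (1 - x) - q * (1 + P) * (1 + q * P) * y
      = (1 - q * y) * (1 - D * y) - x * (1 + u * q * y) * (1 + u * p * y)"
  proof -
    have P: "P = u * x" using uz by (simp add: x_def flip: mult.assoc)
    have D': "D = u * p * (u * x)" by (simp add: D_def P)
    show ?thesis unfolding D' P by (simp add: p_def algebra_simps power2_eq_square)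
  qed
  also have "a * \<dots> = (1 - D * y) * ((1 - q * y) * a - (1 - q * (p * y)) * chain_term u k (Suc m))"
    using step_m by (simp add: algebra_simps)
  finally have "(1 - x) * a - chain_factor u k * chain_term u (Suc k) m
      = (1 - q * y) * a - (1 - q * (p * y)) * chain_term u k (Suc m)"
    by (rule iffD1[OF mult_left_cancel[OF D1(2)]])
  then show ?thesis
    unfolding xk a_def y_def p_def by simp
qed

lemma chain_term_summable:
  assumes u: "norm u = 1"
  shows "summable (chain_term u (Suc k))"
proof -
  obtain K where K: "K > 0" "\<And>k m. norm (chain_term u k m) \<le> K * (norm p ^ k) ^ m"
    by (rule chain_term_bound[OF u], rule that)
  show ?thesis
  proof (rule summable_comparison_test')
    have "norm p ^ Suc k < 1" using p.q_lt1 p.q_pos by (intro power_Suc_less_one) auto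
    then show "summable (\<lambda>m. K * (norm p ^ Suc k) ^ m)"
      by (intro summable_mult summable_geometric) auto
  qed (rule K(2))
qed

lemma chain_step:
  assumes u: "norm u = 1"
  shows "(1 - p ^ Suc k / u) * (\<Sum>m. chain_term u (Suc k) m)
    = 1 + chain_factor u (Suc k) * (\<Sum>m. chain_term u (Suc (Suc k)) m)"
proof -
  define G where "G m = (1 - q * p ^ m) * chain_term u (Suc k) m" for m
  have "(\<lambda>m. (1 - q * p ^ m) * chain_term u (Suc k) m) \<longlonglongrightarrow> (1 - q * 0) * 0"
    using summable_LIMSEQ_zero[OF chain_term_summable[OF u]] p.q_lt1
    by (intro tendsto_intros LIMSEQ_power_zero) auto
  then have G: "G \<longlonglongrightarrow> 0" unfolding G_def by simp
  have "(\<lambda>m. (1 - p ^ Suc k / u) * chain_term u (Suc k) m) sums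
      (G 0 + (\<Sum>m. chain_factor u (Suc k) * chain_term u (Suc (Suc k)) m))"
  proof (rule suminf_telescope[OF _ G])
    show "summable (\<lambda>m. chain_factor u (Suc k) * chain_term u (Suc (Suc k)) m)"
      by (rule summable_mult[OF chain_term_summable[OF u]])
  qed (simp only: G_def chain_telescope[OF u])
  \<comment> \<open>The term at \<open>m = 0\<close> is \<open>1 / (1 - q)\<close>, because
    \<open>rank_prod\<close> and \<open>chain_term\<close> carry one extra factor of
    \<open>qfac q p\<close>.\<close>
  moreover have "G 0 = 1"
    using q_times_power_neq_1[of 0] by (simp add: G_def chain_term_def qfac_Suc)
  ultimately show ?thesis
    using sums_unique suminf_mult[OF chain_term_summable[OF u]] by metis
qed

lemma rank_prod_convergent:
  assumes "norm u = 1"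
  shows "convergent (rank_prod u)"
proof -
  have "rank_prod u \<longlonglongrightarrow> qpoch_inf (- (u * q)) q / (qpoch_inf (u * p) p * qpoch_inf q p)"
    unfolding rank_prod_def
  proof (intro tendsto_intros LIMSEQ_Suc qfac_even_tendsto p.qfac_tendsto)
    show "qpoch_inf (u * p) p * qpoch_inf q p \<noteq> 0"
      using unit_times_power_neq_1[OF assms] q_times_power_neq_1
      by (auto simp: p.qpoch_inf_eq_0_iff mult_ac)
  qed
  then show ?thesis by (rule convergentI)
qed

text \<open>The terms \<open>rank_prod u m / u ^ m\<close> themselves are not summable for \<open>norm u = 1\<close>, hence the
  differences.\<close>

lemma chain_start:
  assumes u: "norm u = 1"
  shows "(\<lambda>m. (rank_prod u m - (if m = 0 then 0 else rank_prod u (m - 1))) / u ^ m) sums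
    (1 + chain_factor u 0 * (\<Sum>m. chain_term u 1 m))"
proof -
  \<comment> \<open>In the factor \<open>1 - 1 / u\<close> of the level 0 relation, the part with
    \<open>1 / u\<close> is moved up by one index and supplies the subtracted
    \<open>rank_prod u (m - 1)\<close>. Only the combination tends to 0: up to a factor of modulus 1
    its limit is the limit of \<open>rank_prod u\<close> minus itself.\<close>
  define H where "H m = (1 - q * p ^ m) * chain_term u 0 m
      - (if m = 0 then 0 else rank_prod u (m - 1)) / u ^ m" for m
  have c0: "chain_term u 0 m = rank_prod u m / u ^ m" for m
    by (simp add: chain_term_def rank_prod_def power_divide)
  obtain L where L: "rank_prod u \<longlonglongrightarrow> L"
    using rank_prod_convergent[OF u] by (auto simp: convergent_def)
  have "(\<lambda>m. (1 - q * p ^ Suc m) * rank_prod u (Suc m) - rank_prod u m) \<longlonglongrightarrow> (1 - q * 0) * L - L"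
    using p.q_lt1
    by (intro tendsto_intros LIMSEQ_Suc[OF LIMSEQ_power_zero] LIMSEQ_Suc[OF L] L) auto
  then have "(\<lambda>m. norm ((1 - q * p ^ Suc m) * rank_prod u (Suc m) - rank_prod u m)) \<longlonglongrightarrow> 0"
    by (intro tendsto_norm_zero) simp
  moreover have "norm (H (Suc m)) = norm ((1 - q * p ^ Suc m) * rank_prod u (Suc m) - rank_prod u m)" for m
  proof -
    have "H (Suc m) = ((1 - q * p ^ Suc m) * rank_prod u (Suc m) - rank_prod u m) / u ^ Suc m"
      by (simp add: H_def c0 diff_divide_distrib)
    then show ?thesis using u by (simp only: norm_divide norm_power power_one div_by_1)
  qed
  ultimately have "(\<lambda>m. norm (H (Suc m))) \<longlonglongrightarrow> 0" by simp
  then have "(\<lambda>m. H (Suc m)) \<longlonglongrightarrow> 0" by (rule tendsto_norm_zero_cancel)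
  then have H: "H \<longlonglongrightarrow> 0" by (rule LIMSEQ_imp_Suc)
  have "(\<lambda>m. (rank_prod u m - (if m = 0 then 0 else rank_prod u (m - 1))) / u ^ m) sums
      (H 0 + (\<Sum>m. chain_factor u 0 * chain_term u 1 m))"
  proof (rule suminf_telescope[OF _ H])
    show "summable (\<lambda>m. chain_factor u 0 * chain_term u 1 m)"
      using summable_mult[OF chain_term_summable[OF u, of 0]] by simp
    fix m
    have "(1 - 1 / u) * chain_term u 0 m - chain_factor u 0 * chain_term u 1 m
        = (1 - q * p ^ m) * chain_term u 0 m - (1 - q * p ^ Suc m) * chain_term u 0 (Suc m)"
      using chain_telescope[OF u, of 0 m] by simp
    moreover have "(1 / u) * chain_term u 0 m = rank_prod u m / u ^ Suc m"
      by (simp add: c0)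
    ultimately have "chain_term u 0 m - chain_factor u 0 * chain_term u 1 m
        = (1 - q * p ^ m) * chain_term u 0 m + rank_prod u m / u ^ Suc m
          - (1 - q * p ^ Suc m) * chain_term u 0 (Suc m)"
      by (simp only: left_diff_distrib) (simp add: algebra_simps)
    then show "(rank_prod u m - (if m = 0 then 0 else rank_prod u (m - 1))) / u ^ m
        - chain_factor u 0 * chain_term u 1 m = H m - H (Suc m)"
      unfolding H_def by (simp only: c0 diff_divide_distrib nat.distinct if_False diff_Suc_1) simp
  qed
  moreover have "H 0 = 1"
    using q_times_power_neq_1[of 0] by (simp add: H_def chain_term_def qfac_Suc)
  ultimately show ?thesis
    using suminf_mult[OF chain_term_summable[OF u, of 0]] by simp
qed

end

section \<open>From the chain to a basic hypergeometric series and to an Appell--Lerch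
  series\<close>

context nome_square
begin

definition rank_coeff :: "complex \<Rightarrow> nat \<Rightarrow> complex" where
  "rank_coeff u n = q ^ n * qfac (- 1) q (2 * n) /
     (qfac (u * p) p n * qfac (p / u) p n)"

lemma rank_coeff_bound:
  assumes u: "norm u = 1"
  obtains K where "K > 0" "\<And>n. norm (rank_coeff u n) \<le> K * norm q ^ n"
proof -
  let ?b = "\<lambda>n. qfac (- 1) q (2 * n) / (qfac (u * p) p n * qfac (p / u) p n)"
  have "norm (1 / u) = 1" using u by (simp add: norm_divide)
  note ne = unit_times_power_neq_1[OF u] unit_times_power_neq_1[OF this]
  have "?b \<longlonglongrightarrow> qpoch_inf (- 1) q / (qpoch_inf (u * p) p * qpoch_inf (p / u) p)"
  proof (intro tendsto_intros qfac_even_tendsto p.qfac_tendsto)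
    show "qpoch_inf (u * p) p * qpoch_inf (p / u) p \<noteq> 0"
      using ne by (auto simp: p.qpoch_inf_eq_0_iff mult_ac)
  qed
  from convergent_imp_Bseq[OF convergentI[OF this]]
  obtain K where K: "K > 0" "\<And>n. norm (?b n) \<le> K"
    unfolding Bseq_def by blast
  have "norm (rank_coeff u n) \<le> K * norm q ^ n" for n
  proof -
    have "rank_coeff u n = ?b n * q ^ n" by (simp add: rank_coeff_def)
    then show ?thesis using K(2)[of n] by (simp only: norm_mult norm_power mult_right_mono zero_le_power norm_ge_zero)
  qed
  then show ?thesis using that K(1) by blast
qed

text \<open>Each application of \<open>chain_step\<close> splits off one more term of the series.
  The remainder tends to 0, as \<open>rank_coeff\<close> decays like \<open>q^N\<close> while
  \<open>Y\<close> is bounded uniformly: at every level from 1 on the terms are dominated by one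
  geometric series.\<close>

lemma rank_coeff_sums:
  assumes u: "norm u = 1"
  shows "rank_coeff u sums (1 + chain_factor u 0 * (\<Sum>m. chain_term u 1 m))"
proof -
  have u': "norm (1 / u) = 1" using u by (simp add: norm_divide)
  define Y where "Y k = (1 - p ^ k / u) * (\<Sum>m. chain_term u k m)" for k
  have fac: "rank_coeff u n * chain_factor u n = rank_coeff u (Suc n) * (1 - p ^ Suc n / u)" for n
  proof -
    have ne: "1 - p ^ Suc n / u \<noteq> 0"
      using unit_times_power_neq_1[OF u', of n] by simp
    have q2: "q ^ (2 * n) = p ^ n" by (rule q_even_power)
    have 1: "qfac (- 1) q (2 * Suc n) = qfac (- 1) q (2 * n) * ((1 + p ^ n) * (1 + q * p ^ n))"
    proof -
      have "2 * Suc n = Suc (Suc (2 * n))" by simp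
      then show ?thesis by (simp only: qfac_Suc power_Suc q2) (simp add: mult_ac)
    qed
    have 2: "qfac (u * p) p (Suc n) = qfac (u * p) p n * (1 - u * p ^ Suc n)"
      "qfac (p / u) p (Suc n) = qfac (p / u) p n * (1 - p ^ Suc n / u)"
      by (simp_all add: qfac_Suc mult_ac)
    have "q ^ Suc n * (N * (a * b)) / (D1 * d1 * (D2 * d2)) * d2
        = q ^ n * N / (D1 * D2) * (q * a * b / d1)" if "d2 \<noteq> 0" for N a b D1 D2 d1 d2
      using that by (simp add: mult_ac)
    from this[OF ne] show ?thesis
      unfolding rank_coeff_def chain_factor_def 1 2 by (simp only:)
  qed
  have part: "1 + chain_factor u 0 * (\<Sum>m. chain_term u 1 m)
      = (\<Sum>n<Suc N. rank_coeff u n) + rank_coeff u (Suc N) * Y (Suc N)" for N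
  proof (induction N)
    case 0
    have "rank_coeff u 0 = 1" by (simp add: rank_coeff_def)
    then have "chain_factor u 0 = rank_coeff u 1 * (1 - p ^ 1 / u)"
      using fac[of 0] by simp
    then show ?case using \<open>rank_coeff u 0 = 1\<close> by (simp add: Y_def)
  next
    case (Suc N)
    have "Y (Suc N) = 1 + chain_factor u (Suc N) * (\<Sum>m. chain_term u (Suc (Suc N)) m)"
      unfolding Y_def by (rule chain_step[OF u])
    then have "rank_coeff u (Suc N) * Y (Suc N) = rank_coeff u (Suc N)
        + (rank_coeff u (Suc N) * chain_factor u (Suc N)) * (\<Sum>m. chain_term u (Suc (Suc N)) m)"
      by (simp add: distrib_left mult.assoc)
    also have "\<dots> = rank_coeff u (Suc N) + rank_coeff u (Suc (Suc N)) * Y (Suc (Suc N))"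
      unfolding fac Y_def by (simp only: mult.assoc)
    finally show ?case using Suc by (simp only: sum.lessThan_Suc add.assoc)
  qed
  obtain K where K: "K > 0" "\<And>n. norm (rank_coeff u n) \<le> K * norm q ^ n"
    by (rule rank_coeff_bound[OF u], rule that)
  obtain L where L: "L > 0" "\<And>k m. norm (chain_term u k m) \<le> L * (norm p ^ k) ^ m"
    by (rule chain_term_bound[OF u], rule that)
  define c where "c = norm p"
  have c: "0 < c" "c < 1" using p.q_lt1 p.q_pos by (simp_all add: c_def)
  have Yb: "norm (Y (Suc N)) \<le> 2 * (L / (1 - c))" for N
  proof -
    have cN: "c ^ Suc N \<le> c" using c by (simp add: mult_left_le power_le_one)
    have tb: "norm (chain_term u (Suc N) m) \<le> L * c ^ m" for m
    proof -
      have "norm (chain_term u (Suc N) m) \<le> L * (c ^ Suc N) ^ m"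
        using L(2)[of "Suc N" m] unfolding c_def .
      also have "\<dots> \<le> L * c ^ m"
        using L(1) cN c by (intro mult_left_mono power_mono) auto
      finally show "norm (chain_term u (Suc N) m) \<le> L * c ^ m" .
    qed
    have sg: "summable (\<lambda>m. L * c ^ m)"
      using c by (intro summable_mult summable_geometric) auto
    then have sn: "summable (\<lambda>m. norm (chain_term u (Suc N) m))"
      by (rule summable_comparison_test') (simp add: tb)
    have "norm (\<Sum>m. chain_term u (Suc N) m) \<le> (\<Sum>m. norm (chain_term u (Suc N) m))"
      by (rule summable_norm[OF sn])
    also have "\<dots> \<le> (\<Sum>m. L * c ^ m)"
      by (rule suminf_le[OF tb sn sg])
    also have "\<dots> = L / (1 - c)"
      using c by (simp add: suminf_mult suminf_geometric)
    finally have 1: "norm (\<Sum>m. chain_term u (Suc N) m) \<le> L / (1 - c)" .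
    have "norm (1 - p ^ Suc N / u) \<le> norm (1 :: complex) + norm (p ^ Suc N / u)"
      by (rule norm_triangle_ineq4)
    also have "norm (p ^ Suc N / u) = c ^ Suc N"
      using u by (simp only: norm_divide norm_power c_def div_by_1)
    also have "norm (1 :: complex) + c ^ Suc N \<le> 2"
      using cN c by (simp del: power_Suc)
    finally show ?thesis
      unfolding Y_def norm_mult using 1 by (intro mult_mono) auto
  qed
  have "(\<lambda>N. rank_coeff u (Suc N) * Y (Suc N)) \<longlonglongrightarrow> 0"
  proof (rule Lim_null_comparison)
    have "norm (rank_coeff u (Suc N) * Y (Suc N)) \<le> K * norm q ^ Suc N * (2 * (L / (1 - c)))" for N
      unfolding norm_mult using K(1) by (intro mult_mono K(2) Yb) simp_all
    then show "\<forall>\<^sub>F N in sequentially. norm (rank_coeff u (Suc N) * Y (Suc N))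
        \<le> K * norm q ^ Suc N * (2 * (L / (1 - c)))"
      by (intro always_eventually allI)
    have "(\<lambda>N. K * norm q ^ Suc N * (2 * (L / (1 - c)))) \<longlonglongrightarrow> K * 0 * (2 * (L / (1 - c)))"
      using q_lt1 by (intro tendsto_intros LIMSEQ_Suc[OF LIMSEQ_power_zero]) auto
    then show "(\<lambda>N. K * norm q ^ Suc N * (2 * (L / (1 - c)))) \<longlonglongrightarrow> 0" by simp
  qed
  then have "(\<lambda>N. (1 + chain_factor u 0 * (\<Sum>m. chain_term u 1 m))
      - rank_coeff u (Suc N) * Y (Suc N)) \<longlonglongrightarrow> (1 + chain_factor u 0 * (\<Sum>m. chain_term u 1 m)) - 0"
    by (intro tendsto_intros)
  note lim = this
  have "(\<lambda>N. \<Sum>n<Suc N. rank_coeff u n) \<longlonglongrightarrow> (1 + chain_factor u 0 * (\<Sum>m. chain_term u 1 m))"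
  proof -
    have "(\<Sum>n<Suc N. rank_coeff u n) = (1 + chain_factor u 0 * (\<Sum>m. chain_term u 1 m))
        - rank_coeff u (Suc N) * Y (Suc N)" for N
      unfolding part[of N] by (rule add_diff_cancel_right'[symmetric])
    with lim show ?thesis by (simp only: diff_zero)
  qed
  then show ?thesis
    unfolding sums_def by (rule LIMSEQ_imp_Suc)
qed

text \<open>\<open>|q|\<close> is \<open>|p|\<close> to the power one half, hence strictly between
  two consecutive integral powers. This gap supplies the modulus condition whenever
  \<open>-1\<close> is used as a last argument.\<close>

lemma norm_neq_norm_square_powi: "norm q \<noteq> norm p powi k"
proof
  assume h: "norm q = norm p powi k"
  show False
  proof (cases "k \<le> 0")
    case True
    then have "norm p powi 0 \<le> norm p powi k"
      using p.q_lt1 p.q_pos by (intro power_int_decreasing) auto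
    then show False unfolding power_int_0_right h[symmetric] using q_lt1 by linarith
  next
    case False
    then have "norm p powi k \<le> norm p powi 1"
      using p.q_lt1 p.q_pos by (intro power_int_decreasing) auto
    then have "norm q \<le> norm q * norm q"
      unfolding h[symmetric] power_int_1_right by (simp add: p_def norm_mult power2_eq_square)
    then show False using q_lt1 q_pos by simp
  qed
qed

lemma jtheta_q_nz: "jtheta q p \<noteq> 0"
proof
  assume "jtheta q p = 0"
  then obtain k :: int where "q = p powi k" by (auto simp: p.jtheta_eq_0_iff)
  then have "norm q = norm p powi k" by (metis norm_power_int)
  then show False using norm_neq_norm_square_powi by blast
qed

lemma unit_neq_powi:
  assumes "norm w = 1" "w \<noteq> 1"
  shows "w \<noteq> p powi k"
proof
  assume h: "w = p powi k"
  then have "k \<noteq> 0" using assms(2) by auto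
  then consider n where "k = int (Suc n)" | n where "k = - int (Suc n)"
    by (metis int_cases4 not0_implies_Suc of_nat_0 minus_zero)
  then show False
  proof cases
    case (1 n)
    then show False
      using unit_times_power_neq_1[of "1 / w" n] assms h by (simp add: norm_divide del: of_nat_Suc)
  next
    case (2 n)
    have "w * p ^ Suc n = 1"
      unfolding h 2 power_int_minus power_int_of_nat by (rule left_inverse) simp
    then show False using unit_times_power_neq_1[OF assms(1)] by blast
  qed
qed

lemma one_plus_powi_nz: "1 + p powi r \<noteq> 0"
  using unit_neq_powi[of "- 1" r] add_eq_0_iff[of 1 "p powi r"] by auto

text \<open>The weight \<open>theta_coeff p r * q powi r\<close> is \<open>(-1)^r q^(r^2)\<close>,
  hence even in \<open>r\<close>, and \<open>1 / (1 + p^r) + 1 / (1 + p^(-r)) = 1\<close>. So the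
  sum is half the theta series.\<close>

lemma theta_half_has_sum:
  "((\<lambda>r. theta_coeff p r * q powi r / (1 + p powi r)) has_sum (jtheta q p / 2)) UNIV"
proof -
  define \<theta> where "\<theta> = jtheta q p"
  define t where "t r = theta_coeff p r * q powi r" for r
  have mp: "- 1 \<noteq> p powi k" for k by (rule unit_neq_powi) auto
  obtain L where L: "L > 0" "\<And>r. norm (1 / (1 - p powi r * (- 1))) \<le> L"
    by (rule p.inverse_one_minus_powi_bounded[OF mp], rule that)
  have s1: "((\<lambda>r. t r) has_sum \<theta>) UNIV"
    unfolding t_def \<theta>_def by (rule p.jacobi_triple_product) simp
  have sm2: "(\<lambda>r. t r / (1 + p powi r)) summable_on UNIV"
  proof (rule abs_summable_summable)
    show "(\<lambda>r. norm (t r / (1 + p powi r))) summable_on UNIV"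
      using p.theta_bounded_summable[OF q_nz L(2)] by (simp add: t_def)
  qed
  then obtain S where S: "((\<lambda>r. t r / (1 + p powi r)) has_sum S) UNIV"
    by (auto simp: summable_on_def)
  have S': "((\<lambda>r. t r * p powi r / (1 + p powi r)) has_sum S) UNIV"
  proof -
    have "((\<lambda>r. t (- r) / (1 + p powi (- r))) has_sum S) UNIV"
      using S by (subst has_sum_int_neg)
    moreover have "t (- r) / (1 + p powi (- r)) = t r * p powi r / (1 + p powi r)" for r
    proof -
      have pr: "p powi r = q powi r * q powi r"
        by (simp add: p_def power2_eq_square power_int_mult_distrib)
      have "t (- r) = t r"
        using p.q_nz by (simp add: t_def theta_coeff_neg pr power_int_minus)
      moreover have "1 / (1 + p powi (- r)) = p powi r / (1 + p powi r)"
      proof -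
        have "p powi r \<noteq> 0" by (simp add: pr)
        then have "1 + p powi (- r) = (1 + p powi r) / p powi r"
          by (simp add: power_int_minus field_simps)
        then show ?thesis by simp
      qed
      ultimately show ?thesis by (metis mult.right_neutral times_divide_eq_right)
    qed
    ultimately show ?thesis by simp
  qed
  have "((\<lambda>r. t r / (1 + p powi r) + t r * p powi r / (1 + p powi r)) has_sum (S + S)) UNIV"
    by (rule has_sum_add[OF S S'])
  also have "(\<lambda>r. t r / (1 + p powi r) + t r * p powi r / (1 + p powi r)) = t"
  proof
    fix r
    have "t r / (1 + p powi r) + t r * p powi r / (1 + p powi r) = t r * (1 + p powi r) / (1 + p powi r)"
      by (simp add: add_divide_distrib distrib_left)
    then show "t r / (1 + p powi r) + t r * p powi r / (1 + p powi r) = t r" using one_plus_powi_nz by simp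
  qed
  finally have SS: "S + S = \<theta>" using s1 has_sum_unique by blast
  then have e: "S = jtheta q p / 2" by (simp add: \<theta>_def field_simps)
  show ?thesis using S[unfolded e t_def] .
qed

text \<open>Summed over \<open>n\<close>, this is the second member of a conjugate Bailey pair in
  base \<open>p\<close> relative to 1, whose first member is \<open>q^n (-1;q)_2n\<close>.\<close>

definition conj_term :: "int \<Rightarrow> nat \<Rightarrow> complex" where
  "conj_term r n = q ^ n * qfac (- 1) q (2 * n) * bfac p n r"

text \<open>The interchange in the second part is Bailey's transform. It is legitimate because
  \<open>bfac\<close> is bounded uniformly in both indices, while \<open>\<beta>\<close> and
  \<open>q^n (-1;q)_2n\<close> are absolutely summable.\<close>

lemma conj_term_swap:
  fixes \<beta> :: "int \<Rightarrow> complex"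
  assumes "(\<lambda>r. norm (\<beta> r)) summable_on UNIV"
  shows "(\<lambda>n. norm (conj_term r n)) summable_on UNIV"
    and "(\<Sum>\<^sub>\<infinity>n. q ^ n * qfac (- 1) q (2 * n) * (\<Sum>\<^sub>\<infinity>r. \<beta> r * bfac p n r))
      = (\<Sum>\<^sub>\<infinity>r. \<beta> r * (\<Sum>\<^sub>\<infinity>n. conj_term r n))"
proof -
  define g where "g n = q ^ n * qfac (- 1) q (2 * n)" for n
  obtain A where A: "A > 0" "\<And>n. norm (qfac (- 1) q n) \<le> A"
    by (rule qfac_bounded[of "- 1"], rule that)
  have g: "(\<lambda>n. norm (g n)) summable_on UNIV"
  proof (rule summable_on_comparison_test)
    show "(\<lambda>n. norm q ^ n * A) summable_on UNIV"
      using q_lt1 A(1) by (subst summable_on_UNIV_nonneg_real_iff)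
        (auto intro!: summable_mult2 summable_geometric)
    show "norm (g n) \<le> norm q ^ n * A" for n
      unfolding g_def norm_mult norm_power using A by (intro mult_left_mono) auto
  qed simp
  obtain K where K: "K > 0" "\<And>n r. norm (bfac p n r) \<le> K"
    by (rule p.bfac_bounded, rule that)
  show "(\<lambda>n. norm (conj_term r n)) summable_on UNIV"
  proof (rule summable_on_comparison_test)
    show "(\<lambda>n. norm (g n) * K) summable_on UNIV" using g by (rule summable_on_cmult_left)
    show "norm (conj_term r n) \<le> norm (g n) * K" for n
      unfolding conj_term_def g_def[symmetric] norm_mult using K by (intro mult_left_mono) auto
  qed simp
  have "(\<lambda>x. norm (g (fst x) * \<beta> (snd x) * bfac p (fst x) (snd x))) summable_on (UNIV \<times> UNIV)"
  proof (rule summable_on_comparison_test)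
    show "(\<lambda>x. norm (g (fst x) * \<beta> (snd x)) * K) summable_on (UNIV \<times> UNIV)"
      by (intro summable_on_cmult_left abs_summable_on_times g assms)
    show "norm (g (fst x) * \<beta> (snd x) * bfac p (fst x) (snd x)) \<le> norm (g (fst x) * \<beta> (snd x)) * K" for x
      unfolding norm_mult[of "g (fst x) * \<beta> (snd x)"] using K by (intro mult_left_mono) auto
  qed simp
  then have sm: "(\<lambda>(n, r). g n * \<beta> r * bfac p n r) summable_on (UNIV \<times> UNIV)"
    using abs_summable_summable by (simp add: case_prod_unfold)
  show "(\<Sum>\<^sub>\<infinity>n. q ^ n * qfac (- 1) q (2 * n) * (\<Sum>\<^sub>\<infinity>r. \<beta> r * bfac p n r))
      = (\<Sum>\<^sub>\<infinity>r. \<beta> r * (\<Sum>\<^sub>\<infinity>n. conj_term r n))"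
    using infsum_swap_banach[OF sm] unfolding conj_term_def g_def[symmetric]
    by (simp only: infsum_cmult_right'[symmetric] mult.assoc mult.left_commute[of "g _"])
qed

text \<open>All terms are expressed through \<open>bfac p (Suc n) r\<close>, which remains nonzero
  at the boundary \<open>|r| = n + 1\<close> where \<open>bfac p n r\<close> is 0. What is left is
  an identity in \<open>q\<close>, \<open>y = p^n\<close> and \<open>P = p^r\<close>.\<close>

lemma conj_term_telescope:
  fixes r :: int
  defines "G \<equiv> \<lambda>n. (q * p powi r - 1) * ((1 - p ^ n / p powi r) * conj_term r n)"
  shows "q * (1 + p powi r) * conj_term r n - (1 + p powi (r + 1)) * conj_term (r + 1) n
    = G n - G (Suc n)"
proof -
  define y P where "y = p ^ n" and "P = p powi r"
  define C where "C = q ^ n * qfac (- 1) q (2 * n) * (1 - p * y / P) * bfac p (Suc n) r"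
  have P: "P \<noteq> 0" by (simp add: P_def)
  have a: "p powi (int n + 1 - r) = p * y / P" "p powi (int n - r) = y / P"
    "p powi (int n + 1 + r) = p * y * P" "p powi (r + 1) = p * P"
    by (simp_all add: y_def P_def power_int_add power_int_diff)
  have t: "conj_term r n = C * (1 - p * y * P)" "conj_term (r + 1) n = C * (1 - y / P)"
    unfolding conj_term_def p.bfac_Suc[of n r] p.bfac_succ a C_def by (simp_all only: mult_ac)
  have "2 * Suc n = Suc (Suc (2 * n))" by simp
  then have "qfac (- 1) q (2 * Suc n) = qfac (- 1) q (2 * n) * ((1 + y) * (1 + q * y))"
    by (simp only: qfac_Suc power_Suc q_even_power y_def) (simp add: mult_ac)
  then have t': "(1 - p * y / P) * conj_term r (Suc n) = C * (q * (1 + y) * (1 + q * y))"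
    by (simp add: conj_term_def C_def mult_ac)
  have "q * (1 + P) * (1 - p * y * P) - (1 + p * P) * (1 - y / P)
      = (q * P - 1) * ((1 - y / P) * (1 - p * y * P) - q * (1 + y) * (1 + q * y))"
    using P by (simp add: p_def power2_eq_square field_simps)
  moreover have "c * (C * v) - d * (C * w) = s * (w * (C * v)) - s * (C * x)"
    if "c * v - d * w = s * (w * v - x)" for c d s v w x
  proof -
    have "c * (C * v) - d * (C * w) = C * (c * v - d * w)" by (simp add: algebra_simps)
    then show ?thesis unfolding that by (simp add: algebra_simps)
  qed
  ultimately have "q * (1 + P) * conj_term r n - (1 + p * P) * conj_term (r + 1) n
      = (q * P - 1) * ((1 - y / P) * conj_term r n) - (q * P - 1) * ((1 - p * y / P) * conj_term r (Suc n))"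
    unfolding t t' by blast
  then show ?thesis unfolding G_def a by (simp add: y_def P_def)
qed

text \<open>The recurrence in \<open>r\<close> determines the sums up to a constant factor, which is fixed by the
  finite triple product at \<open>z = 1\<close>: its right-hand side vanishes for \<open>n > 0\<close>.\<close>

lemma conjugate_bailey:
  "(\<Sum>\<^sub>\<infinity>n. conj_term r n) = 2 * q powi r / (1 + p powi r) / jtheta q p"
proof -
  define W where "W r = (\<Sum>\<^sub>\<infinity>n. conj_term r n)" for r
  have th: "(\<lambda>r. norm (theta_coeff p r)) summable_on UNIV"
    using p.theta_abs_summable[of 1] by simp
  have sm: "summable (\<lambda>n. norm (conj_term r n))" for r
    by (rule summable_on_imp_summable[OF conj_term_swap(1)[OF th]])
  have W: "W r = (\<Sum>n. conj_term r n)" for r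
    unfolding W_def by (rule infsum_eq_suminf[OF sm])
  have rec: "q * (1 + p powi r) * W r = (1 + p powi (r + 1)) * W (r + 1)" for r
  proof -
    define G where "G n = (q * p powi r - 1) * ((1 - p ^ n / p powi r) * conj_term r n)" for n
    have "(\<lambda>n. (q * p powi r - 1) * ((1 - p ^ n / p powi r) * conj_term r n)) \<longlonglongrightarrow>
        (q * p powi r - 1) * ((1 - 0 / p powi r) * 0)"
      using summable_LIMSEQ_zero[OF summable_norm_cancel[OF sm[of r]]] p.q_lt1
      by (intro tendsto_intros LIMSEQ_power_zero) auto
    then have G: "G \<longlonglongrightarrow> 0" unfolding G_def by simp
    have "(\<lambda>n. q * (1 + p powi r) * conj_term r n) sums
        (G 0 + (\<Sum>n. (1 + p powi (r + 1)) * conj_term (r + 1) n))"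
      unfolding G_def
      by (rule suminf_telescope[OF conj_term_telescope G[unfolded G_def]])
        (rule summable_mult[OF summable_norm_cancel[OF sm]])
    \<comment> \<open>For \<open>r = 0\<close> the factor \<open>1 - p^0 / p^0\<close> vanishes, and
      for all other \<open>r\<close> the coefficient \<open>bfac p 0 r\<close> does. So the
      recurrence for the sums is homogeneous.\<close>
    moreover have "G 0 = 0" by (cases "r = 0") (auto simp: G_def conj_term_def bfac_def)
    ultimately show ?thesis
      unfolding W using sums_unique suminf_mult[OF summable_norm_cancel[OF sm]] by (metis add_0)
  qed
  have Wr: "W r * (1 + p powi r) = W 0 * (2 * q powi r)" for r
  proof (induction r rule: int_induct[where k = 0])
    case (step1 i)
    have "W (i + 1) * (1 + p powi (i + 1)) = q * (W i * (1 + p powi i))"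
      using rec[of i] by (simp add: mult_ac)
    then show ?case unfolding step1(2) by (simp add: power_int_add mult_ac)
  next
    case (step2 i)
    have "q * (W (i - 1) * (1 + p powi (i - 1))) = W i * (1 + p powi i)"
      using rec[of "i - 1"] by (simp add: mult_ac)
    also have "\<dots> = q * (W 0 * (2 * q powi (i - 1)))"
      unfolding step2(2) by (simp add: power_int_diff)
    finally show ?case by simp
  qed simp
  have "(\<Sum>\<^sub>\<infinity>r. theta_coeff p r * bfac p n r) = (if n = 0 then 1 else 0)" for n
    using infsumI[OF p.finite_triple_product[of 1 n]] by (cases n) (simp_all add: qfac_Suc')
  then have "(\<Sum>\<^sub>\<infinity>n. q ^ n * qfac (- 1) q (2 * n) * (if n = 0 then 1 else 0))
      = (\<Sum>\<^sub>\<infinity>r. theta_coeff p r * W r)"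
    using conj_term_swap(2)[OF th] by (simp only: W_def)
  also have "(\<Sum>\<^sub>\<infinity>n. q ^ n * qfac (- 1) q (2 * n) * (if n = 0 then 1 else 0)) = 1"
    by (rule infsumI, rule has_sum_finite_neutralI[where B = "{0}"]) auto
  also have "(\<Sum>\<^sub>\<infinity>r. theta_coeff p r * W r)
      = (\<Sum>\<^sub>\<infinity>r. 2 * W 0 * (theta_coeff p r * q powi r / (1 + p powi r)))"
  proof (rule infsum_cong)
    fix r
    have "W r = W 0 * (2 * q powi r) / (1 + p powi r)"
      using Wr[of r] by (rule eq_divide_imp[OF one_plus_powi_nz])
    then show "theta_coeff p r * W r = 2 * W 0 * (theta_coeff p r * q powi r / (1 + p powi r))"
      by simp
  qed
  also have "\<dots> = 2 * W 0 * (jtheta q p / 2)"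
    by (simp only: infsum_cmult_right' infsumI[OF theta_half_has_sum])
  finally have "W 0 * jtheta q p = 1" by simp
  then have "W 0 = 1 / jtheta q p" using jtheta_q_nz by (simp add: eq_divide_eq)
  moreover have "W r = W 0 * (2 * q powi r) / (1 + p powi r)"
    using Wr[of r] by (rule eq_divide_imp[OF one_plus_powi_nz])
  ultimately show ?thesis by (simp add: W_def mult_ac)
qed

lemma rank_coeff_lambert:
  assumes u: "norm u = 1" "u \<noteq> 1"
  defines "z \<equiv> 1 / u"
  shows "(\<Sum>n. rank_coeff u n) * jtheta q p = (1 - z) *
    (\<Sum>\<^sub>\<infinity>r. 2 * (theta_coeff p r * q powi r * p powi r
       / ((1 - z * p powi r) * (1 + p powi r))))"
proof -
  have z: "norm z = 1" "z \<noteq> 1" "z \<noteq> 0" using u by (auto simp: z_def norm_divide)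
  have zp: "z \<noteq> p powi k" for k by (rule unit_neq_powi[OF z(1,2)])
  define \<beta> where "\<beta> r = theta_coeff p r * p powi r / (1 - z * p powi r)" for r
  obtain L where L: "L > 0" "\<And>r. norm (1 / (1 - p powi r * z)) \<le> L"
    by (rule p.inverse_one_minus_powi_bounded[OF zp], rule that)
  have \<beta>: "(\<lambda>r. norm (\<beta> r)) summable_on UNIV"
    using p.theta_bounded_summable[OF p.q_nz L(2)] by (simp add: \<beta>_def mult.commute[of z])
  obtain C where C: "C > 0" "\<And>n. norm (rank_coeff u n) \<le> C * norm q ^ n"
    by (rule rank_coeff_bound[OF u(1)], rule that)
  have "summable (\<lambda>n. norm (rank_coeff u n))"
    by (rule summable_comparison_test'[of "\<lambda>n. C * norm q ^ n"])
      (use C q_lt1 in \<open>auto intro!: summable_mult summable_geometric\<close>)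
  then have "(\<Sum>n. rank_coeff u n) = (\<Sum>\<^sub>\<infinity>n. rank_coeff u n)"
    by (simp only: infsum_eq_suminf)
  also have "\<dots> = (\<Sum>\<^sub>\<infinity>n. (1 - z) * (q ^ n * qfac (- 1) q (2 * n) * (\<Sum>\<^sub>\<infinity>r. \<beta> r * bfac p n r)))"
  proof (rule infsum_cong)
    fix n
    have "(\<Sum>\<^sub>\<infinity>r. \<beta> r * bfac p n r) = 1 / ((1 - z) * qfac (z * p) p n * qfac (p / z) p n)"
      using p.finite_partial_fractions[OF z(3) zp, of n] unfolding \<beta>_def by (rule infsumI)
    moreover have "1 - z \<noteq> 0" using z by simp
    moreover have "rank_coeff u n = q ^ n * qfac (- 1) q (2 * n) / (qfac (z * p) p n * qfac (p / z) p n)"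
      by (simp add: rank_coeff_def z_def mult_ac)
    ultimately show "rank_coeff u n
        = (1 - z) * (q ^ n * qfac (- 1) q (2 * n) * (\<Sum>\<^sub>\<infinity>r. \<beta> r * bfac p n r))"
      by simp
  qed
  also have "\<dots> = (1 - z) * (\<Sum>\<^sub>\<infinity>r. \<beta> r * (2 * q powi r / (1 + p powi r) / jtheta q p))"
    by (simp only: infsum_cmult_right' conj_term_swap(2)[OF \<beta>] conjugate_bailey)
  also have "(\<Sum>\<^sub>\<infinity>r. \<beta> r * (2 * q powi r / (1 + p powi r) / jtheta q p))
      = (\<Sum>\<^sub>\<infinity>r. 2 * (theta_coeff p r * q powi r * p powi r
         / ((1 - z * p powi r) * (1 + p powi r))) * (1 / jtheta q p))"
    by (intro infsum_cong) (simp add: \<beta>_def mult_ac)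
  also have "\<dots> = (\<Sum>\<^sub>\<infinity>r. 2 * (theta_coeff p r * q powi r * p powi r
       / ((1 - z * p powi r) * (1 + p powi r)))) * (1 / jtheta q p)"
    by (rule infsum_cmult_left')
  finally show ?thesis using jtheta_q_nz by simp
qed

text \<open>With \<open>X = p^r\<close> one has \<open>(1 + z) X / ((1 - z X) (1 + X)) = 1 / (1 - z
  X) - 1 / (1 + X)\<close>. The first part gives the numerator of \<open>m(z q, p, q)\<close>,
  because \<open>p^(r-1) (z q) q = z p^r\<close>; the second is half a theta series and gives the
  \<open>- 1\<close>.\<close>

theorem rank_coeff_appell:
  assumes u: "norm u = 1" "u \<noteq> 1"
  shows "(1 + 1 / u) * (\<Sum>n. rank_coeff u n) = (1 - 1 / u) * (2 * appell_lerch (q / u) p q - 1)"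
proof -
  define z where "z = 1 / u"
  have z: "norm z = 1" "z \<noteq> 1" "z \<noteq> 0" using u by (auto simp: z_def norm_divide)
  have zp: "z \<noteq> p powi k" for k by (rule unit_neq_powi[OF z(1,2)])
  define \<theta> where "\<theta> = jtheta q p"
  have \<theta>: "\<theta> \<noteq> 0" unfolding \<theta>_def by (rule jtheta_q_nz)
  define t where "t r = theta_coeff p r * q powi r" for r
  have zne: "1 - z * p powi r \<noteq> 0" for r
    using zp[of "- r"] by (auto simp: power_int_minus field_simps)
  have S: "((\<lambda>r. t r / (1 + p powi r)) has_sum (\<theta> / 2)) UNIV"
    unfolding t_def \<theta>_def by (rule theta_half_has_sum)
  have num: "((\<lambda>r. t r / (1 - z * p powi r)) has_sum appell_num (z * q) p q) UNIV"
  proof -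
    have "z * q * q \<noteq> p powi k" for k
      using zp[of "k - 1"] by (auto simp: power_int_diff field_simps p_def power2_eq_square)
    from p.appell_num_has_sum[OF q_nz this]
    have "((\<lambda>r. theta_coeff p r * q powi r / (1 - p powi (r - 1) * (z * q) * q)) has_sum
        appell_num (z * q) p q) UNIV" by simp
    moreover have "p powi (r - 1) * (z * q) * q = z * p powi r" for r
    proof -
      have "p powi r = p powi (r - 1) * p" by (simp add: power_int_diff)
      then show ?thesis by (simp add: p_def power2_eq_square mult_ac)
    qed
    ultimately show ?thesis by (simp add: t_def)
  qed
  have "((\<lambda>r. 2 * (t r / (1 - z * p powi r)) - 2 * (t r / (1 + p powi r))) has_sum
      (2 * appell_num (z * q) p q - 2 * (\<theta> / 2))) UNIV"
    by (intro has_sum_diff has_sum_cmult_right num S)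
  also have "(\<lambda>r. 2 * (t r / (1 - z * p powi r)) - 2 * (t r / (1 + p powi r)))
      = (\<lambda>r. (1 + z) * (2 * (t r * p powi r / ((1 - z * p powi r) * (1 + p powi r)))))"
  proof
    fix r
    have "2 * (T / a) - 2 * (T / b) = (1 + z) * (2 * (T * X / (a * b)))"
      if "a \<noteq> 0" "b \<noteq> 0" "a = 1 - z * X" "b = 1 + X" for T X a b
    proof -
      have "2 * (T / a) - 2 * (T / b) = 2 * T * (b - a) / (a * b)"
        using that(1,2) by (simp add: field_simps)
      also have "b - a = (1 + z) * X" using that(3,4) by (simp add: algebra_simps)
      finally show ?thesis by (simp add: mult_ac)
    qed
    from this[OF zne one_plus_powi_nz refl refl]
    show "2 * (t r / (1 - z * p powi r)) - 2 * (t r / (1 + p powi r))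
      = (1 + z) * (2 * (t r * p powi r / ((1 - z * p powi r) * (1 + p powi r))))" .
  qed
  finally have I1: "(1 + z) * (\<Sum>\<^sub>\<infinity>r. 2 * (t r * p powi r / ((1 - z * p powi r) * (1 + p powi r))))
      = 2 * appell_num (z * q) p q - 2 * (\<theta> / 2)"
    unfolding infsum_cmult_right'[symmetric] by (rule infsumI)
  have I2: "(\<Sum>n. rank_coeff u n) * \<theta> = (1 - z) *
      (\<Sum>\<^sub>\<infinity>r. 2 * (t r * p powi r / ((1 - z * p powi r) * (1 + p powi r))))"
    using rank_coeff_lambert[OF u] unfolding t_def z_def \<theta>_def .
  have "(1 + z) * (\<Sum>n. rank_coeff u n) * \<theta> = (1 - z) * ((1 + z) *
      (\<Sum>\<^sub>\<infinity>r. 2 * (t r * p powi r / ((1 - z * p powi r) * (1 + p powi r)))))"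
    unfolding mult.assoc[of "1 + z"] I2 by (rule mult.left_commute)
  also have "\<dots> = (1 - z) * (2 * appell_num (z * q) p q - \<theta>)"
    unfolding I1 by simp
  also have "appell_num (z * q) p q = appell_lerch (z * q) p q * \<theta>"
    using \<theta> by (simp add: appell_lerch_eq \<theta>_def)
  finally have "((1 + z) * (\<Sum>n. rank_coeff u n)) * \<theta>
      = ((1 - z) * (2 * appell_lerch (z * q) p q - 1)) * \<theta>"
    by (simp add: algebra_simps)
  then have "(1 + z) * (\<Sum>n. rank_coeff u n) = (1 - z) * (2 * appell_lerch (z * q) p q - 1)"
    by (rule iffD1[OF mult_right_cancel[OF \<theta>]])
  then show ?thesis by (simp add: z_def)
qed

end

section \<open>Overpartitions and the M2-rank\<close>

definition all_overpartitions :: "overpartition set" where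
  "all_overpartitions = {(P, S). 0 \<notin># P \<and> S \<subseteq> set_mset P}"

definition overpartitions_on :: "nat set \<Rightarrow> nat set \<Rightarrow> overpartition set" where
  "overpartitions_on A B = {(P, S). set_mset P \<subseteq> A \<and> S \<subseteq> set_mset P \<inter> B}"

text \<open>This is the total number of parts minus the number of odd non-overlined ones, written so
  that it is visibly additive over part sizes; see \<open>num_parts_eq\<close>.\<close>

definition marked_parts :: "overpartition \<Rightarrow> nat" where
  "marked_parts \<pi> = size (filter_mset even (fst \<pi>)) + card {s \<in> snd \<pi>. odd s}"

text \<open>The share of the rank that depends on the largest part alone. The subtraction of
  naturals never truncates: \<open>chi_largest\<close> is 1 only for an odd largest part.\<close>

definition rank_index :: "overpartition \<Rightarrow> nat" where
  "rank_index \<pi> = (largest_part \<pi> + 1) div 2 - chi_largest \<pi>"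

lemma num_parts_eq:
  assumes "S \<subseteq> set_mset P"
  shows "num_parts (P, S) = marked_parts (P, S) + size (odd_nonoverlined (P, S))"
proof -
  have fin: "finite S" using assms by (rule finite_subset) simp
  have sub: "mset_set S \<subseteq># P"
  proof (rule mset_subset_eqI)
    show "count (mset_set S) x \<le> count P x" for x
      using assms fin by (cases "x \<in> S") (auto simp: Suc_le_eq)
  qed
  have "size P = size (filter_mset even P) + size (filter_mset odd P)"
    by (metis multiset_partition size_union)
  moreover have "size (filter_mset odd P)
      = size (filter_mset odd (P - mset_set S)) + size (filter_mset odd (mset_set S))"
    using arg_cong[OF subset_mset.diff_add[OF sub], of "\<lambda>X. size (filter_mset odd X)"]
    by (simp only: filter_union_mset size_union)
  moreover have "size (filter_mset odd (mset_set S)) = card {s \<in> S. odd s}"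
    using fin by (simp add: filter_mset_mset_set size_mset_set)
  ultimately show ?thesis
    unfolding num_parts_def marked_parts_def odd_nonoverlined_def fst_conv snd_conv by linarith
qed

lemma M2_rank_eq:
  assumes "\<pi> \<in> all_overpartitions"
  shows "M2_rank \<pi> = int (rank_index \<pi>) - int (marked_parts \<pi>)"
proof -
  obtain P S where \<pi>: "\<pi> = (P, S)" by (cases \<pi>)
  have S: "S \<subseteq> set_mset P" using assms by (simp add: \<pi> all_overpartitions_def)
  have c: "\<lceil>real l / 2\<rceil> = int ((l + 1) div 2)" for l :: nat
  proof (cases "even l")
    case True
    then obtain k where "l = 2 * k" by (rule evenE)
    then show ?thesis by simp
  next
    case False
    then obtain k where k: "l = 2 * k + 1" by (rule oddE)
    have "\<lceil>real l / 2\<rceil> = int (k + 1)" by (rule ceiling_unique) (simp_all add: k)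
    then show ?thesis by (simp add: k)
  qed
  have "chi_largest \<pi> \<le> (largest_part \<pi> + 1) div 2"
    by (auto simp: chi_largest_def of_bool_def elim: oddE)
  then have "int (rank_index \<pi>) = int ((largest_part \<pi> + 1) div 2) - int (chi_largest \<pi>)"
    by (simp add: rank_index_def of_nat_diff)
  then show ?thesis
    unfolding M2_rank_def c using num_parts_eq[OF S] by (simp add: \<pi>)
qed

text \<open>A largest part \<open>2 k\<close> has index \<open>k\<close>, and a largest part
  \<open>2 k + 1\<close> has index \<open>k\<close> or \<open>k + 1\<close> according to whether it
  is non-overlined or overlined. So the bound \<open>m\<close> admits the size
  \<open>2 m + 1\<close>, but not its overlined form.\<close>

lemma rank_index_le_iff:
  "\<pi> \<in> all_overpartitions \<and> rank_index \<pi> \<le> m \<longleftrightarrow> \<pi> \<in> overpartitions_on {1..2 * m + 1} {1..2 * m}"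
proof -
  obtain P S where \<pi>: "\<pi> = (P, S)" by (cases \<pi>)
  define l where "l = largest_part \<pi>"
  have le: "x \<le> l" if "x \<in># P" for x
    using that by (simp add: l_def largest_part_def \<pi>)
  have lin: "l = 0 \<or> l \<in># P"
    using Max_in[of "insert 0 (set_mset P)"] by (simp add: l_def largest_part_def \<pi>)
  show ?thesis
  proof
    assume h: "\<pi> \<in> all_overpartitions \<and> rank_index \<pi> \<le> m"
    then have P: "0 \<notin># P" "S \<subseteq> set_mset P" by (simp_all add: \<pi> all_overpartitions_def)
    have r: "(l + 1) div 2 - of_bool (odd l \<and> l \<notin> S) \<le> m"
      using h by (simp add: rank_index_def chi_largest_def l_def \<pi>)
    have l1: "l \<le> 2 * m + 1" using r by (cases "odd l \<and> l \<notin> S") auto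
    have l2: "l \<noteq> 2 * m + 1" if "l \<in> S" using r that by auto
    have "x \<le> 2 * m" if "x \<in> S" for x
    proof -
      have "x \<le> l" using that P le by auto
      then show ?thesis using l1 l2 that by (cases "x = l") auto
    qed
    moreover have "1 \<le> x" if "x \<in># P" for x
      using that P(1) by (cases x) auto
    ultimately show "\<pi> \<in> overpartitions_on {1..2 * m + 1} {1..2 * m}"
      using P le l1 by (fastforce simp: \<pi> overpartitions_on_def)
  next
    assume h: "\<pi> \<in> overpartitions_on {1..2 * m + 1} {1..2 * m}"
    then have P: "set_mset P \<subseteq> {1..2 * m + 1}" "S \<subseteq> set_mset P" "S \<subseteq> {1..2 * m}"
      by (auto simp: \<pi> overpartitions_on_def)
    have "l \<le> 2 * m + 1" using lin P by auto
    moreover have "l \<noteq> 2 * m + 1" if "l \<in> S" using that P by auto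
    ultimately have "(l + 1) div 2 - of_bool (odd l \<and> l \<notin> S) \<le> m"
      by (cases "l \<in> S"; cases "odd l") (auto elim!: oddE evenE)
    then have "rank_index \<pi> \<le> m" by (simp add: rank_index_def chi_largest_def l_def \<pi>)
    moreover have "0 \<notin># P" using P by auto
    ultimately show "\<pi> \<in> all_overpartitions \<and> rank_index \<pi> \<le> m"
      using P by (simp add: \<pi> all_overpartitions_def)
  qed
qed

section \<open>Product formulas for overpartitions with restricted part sizes\<close>

definition part_choices :: "nat set \<Rightarrow> nat \<Rightarrow> (nat \<times> bool) set" where
  "part_choices B s = {(c, b). b \<longrightarrow> c > 0 \<and> s \<in> B}"

definition add_part :: "nat \<Rightarrow> overpartition \<times> (nat \<times> bool) \<Rightarrow> overpartition" where
  "add_part s = (\<lambda>((P, S), (c, b)). (P + replicate_mset c s, if b then insert s S else S))"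

lemma add_part_bij:
  assumes "s \<notin> A"
  shows "bij_betw (add_part s) (overpartitions_on A B \<times> part_choices B s) (overpartitions_on (insert s A) B)"
proof (rule bij_betwI[where g = "\<lambda>(P, S). ((filter_mset (\<lambda>x. x \<noteq> s) P, S - {s}), (count P s, s \<in> S))"])
  show "add_part s \<in> overpartitions_on A B \<times> part_choices B s \<rightarrow> overpartitions_on (insert s A) B"
    by (auto simp: add_part_def overpartitions_on_def part_choices_def split: if_splits)
  show "(\<lambda>(P, S). ((filter_mset (\<lambda>x. x \<noteq> s) P, S - {s}), (count P s, s \<in> S)))
      \<in> overpartitions_on (insert s A) B \<rightarrow> overpartitions_on A B \<times> part_choices B s"
    by (auto simp: overpartitions_on_def part_choices_def)
next
  fix x assume "x \<in> overpartitions_on A B \<times> part_choices B s"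
  then obtain P S c b where x: "x = ((P, S), (c, b))" and P: "set_mset P \<subseteq> A" "S \<subseteq> set_mset P \<inter> B"
    and b: "b \<longrightarrow> c > 0 \<and> s \<in> B"
    by (auto simp: overpartitions_on_def part_choices_def)
  have s: "s \<notin># P" "s \<notin> S" using P assms by auto
  have "filter_mset (\<lambda>x. x \<noteq> s) P = P"
    using s by (intro filter_mset_eq_conv[THEN iffD2]) auto
  moreover have "filter_mset (\<lambda>x. x \<noteq> s) (replicate_mset c s) = {#}"
    by (simp add: filter_mset_eq_conv)
  moreover have "count P s = 0" using s by (simp add: not_in_iff)
  ultimately show "(\<lambda>(P, S). ((filter_mset (\<lambda>x. x \<noteq> s) P, S - {s}), (count P s, s \<in> S))) (add_part s x) = x"
    using s by (auto simp: x add_part_def)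
next
  fix y assume "y \<in> overpartitions_on (insert s A) B"
  obtain P S where y: "y = (P, S)" by (cases y)
  have "filter_mset (\<lambda>x. x \<noteq> s) P + replicate_mset (count P s) s = P"
    by (rule multiset_eqI) auto
  then show "add_part s ((\<lambda>(P, S). ((filter_mset (\<lambda>x. x \<noteq> s) P, S - {s}), (count P s, s \<in> S))) y) = y"
    by (auto simp: y add_part_def)
qed

context nome_square
begin

definition op_weight :: "complex \<Rightarrow> overpartition \<Rightarrow> complex" where
  "op_weight u \<pi> = u ^ marked_parts \<pi> * q ^ sum_mset (fst \<pi>)"

definition choice_weight :: "complex \<Rightarrow> nat \<Rightarrow> nat \<times> bool \<Rightarrow> complex" where
  "choice_weight u s = (\<lambda>(c, b). u ^ (if even s then c else of_bool b) * q ^ (s * c))"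

definition part_factor :: "complex \<Rightarrow> nat set \<Rightarrow> nat \<Rightarrow> complex" where
  "part_factor u B s = (if s \<in> B then 1 + u * q ^ s else 1) / (1 - (if even s then u else 1) * q ^ s)"

lemma op_weight_add_part:
  assumes "s \<notin> A" "\<pi> \<in> overpartitions_on A B"
  shows "op_weight u (add_part s (\<pi>, x)) = op_weight u \<pi> * choice_weight u s x"
proof -
  obtain P S c b where e: "\<pi> = (P, S)" "x = (c, b)" by (cases \<pi>; cases x) auto
  have P: "set_mset P \<subseteq> A" "S \<subseteq> set_mset P" using assms by (auto simp: e overpartitions_on_def)
  then have s: "s \<notin> S" and fin: "finite S" using assms(1) by (auto intro: finite_subset)
  have "filter_mset even (replicate_mset c s) = (if even s then replicate_mset c s else {#})"
    by (auto simp: filter_mset_eq_conv)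
  moreover have "{t \<in> if b then insert s S else S. odd t}
      = (if b \<and> odd s then insert s {t \<in> S. odd t} else {t \<in> S. odd t})"
    by auto
  ultimately have "marked_parts (add_part s (\<pi>, x)) = marked_parts \<pi> + (if even s then c else of_bool b)"
    using s fin by (simp add: e add_part_def marked_parts_def)
  moreover have "sum_mset (fst (add_part s (\<pi>, x))) = sum_mset P + s * c"
    by (simp add: e add_part_def mult.commute)
  ultimately show ?thesis
    by (simp add: op_weight_def choice_weight_def e power_add)
qed

text \<open>Without an overline the multiplicities give \<open>1 / (1 - v)\<close>; with an
  overline, if allowed, they give \<open>e v / (1 - v)\<close>. Here \<open>e v = u q^s\<close> for
  either parity of \<open>s\<close>, which makes the numerator of \<open>part_factor\<close>
  independent of parity.\<close>

lemma choice_weight_sum: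
  assumes u: "norm u = 1" and s: "s > 0"
  shows "(\<lambda>x. norm (choice_weight u s x)) summable_on part_choices B s"
    and "(choice_weight u s has_sum part_factor u B s) (part_choices B s)"
proof -
  define v where "v = (if even s then u else 1) * q ^ s"
  define e where "e = (if even s then 1 else u)"
  have v: "norm v < 1"
    using u q_lt1 s by (auto simp: v_def norm_mult norm_power power_less_one_iff)
  have ev: "e * v = u * q ^ s" by (simp add: e_def v_def)
  have w: "choice_weight u s (c, b) = (if b then e else 1) * v ^ c" for c b
    by (simp add: choice_weight_def v_def e_def power_mult_distrib power_mult)
  have g: "summable (\<lambda>c. norm (v ^ c))"
    using v by (simp add: norm_power summable_geometric)
  have g1: "summable (\<lambda>c. norm (e * v * v ^ c))"
    using v by (simp add: norm_mult norm_power summable_geometric)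
  have hF: "(choice_weight u s has_sum (1 / (1 - v))) (range (\<lambda>c. (c, False)))"
    using norm_summable_imp_has_sum[OF g geometric_sums[OF v]]
    by (subst has_sum_reindex) (auto simp: inj_on_def o_def w)
  have hT: "(choice_weight u s has_sum (e * v / (1 - v))) (range (\<lambda>c. (Suc c, True)))"
    using norm_summable_imp_has_sum[OF g1 sums_mult[OF geometric_sums[OF v]]]
    by (subst has_sum_reindex) (auto simp: inj_on_def o_def w mult_ac)
  have aF: "(\<lambda>x. norm (choice_weight u s x)) summable_on (range (\<lambda>c. (c, False)))"
    using g by (subst summable_on_reindex) (auto simp: inj_on_def o_def w summable_on_UNIV_nonneg_real_iff)
  have aT: "(\<lambda>x. norm (choice_weight u s x)) summable_on (range (\<lambda>c. (Suc c, True)))"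
    using g1 by (subst summable_on_reindex)
      (auto simp: inj_on_def o_def w summable_on_UNIV_nonneg_real_iff mult_ac)
  have disj: "range (\<lambda>c :: nat. (c, False)) \<inter> range (\<lambda>c. (Suc c, True)) = {}" by auto
  have "part_choices B s = (if s \<in> B then range (\<lambda>c. (c, False)) \<union> range (\<lambda>c. (Suc c, True))
      else range (\<lambda>c. (c, False)))"
    by (auto simp: part_choices_def image_iff gr0_conv_Suc)
  moreover have "part_factor u B s = (if s \<in> B then 1 / (1 - v) + e * v / (1 - v) else 1 / (1 - v))"
    unfolding part_factor_def v_def[symmetric] ev[symmetric] by (simp add: add_divide_distrib)
  ultimately show "(\<lambda>x. norm (choice_weight u s x)) summable_on part_choices B s"
    "(choice_weight u s has_sum part_factor u B s) (part_choices B s)"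
    using summable_on_Un_disjoint[OF aF aT disj] has_sum_Un_disjoint[OF hF hT disj] aF hF by auto
qed

lemma op_weight_sum:
  assumes u: "norm u = 1" and A: "finite A" "0 \<notin> A"
  shows "(\<lambda>\<pi>. norm (op_weight u \<pi>)) summable_on overpartitions_on A B \<and>
    (op_weight u has_sum (\<Prod>s\<in>A. part_factor u B s)) (overpartitions_on A B)"
  using A
proof (induction A rule: finite_induct)
  case empty
  have "overpartitions_on {} B = {({#}, {})}" by (auto simp: overpartitions_on_def)
  then show ?case by (simp add: op_weight_def marked_parts_def has_sum_finiteI)
next
  case (insert s A)
  let ?X = "overpartitions_on A B" and ?Y = "part_choices B s"
  have s: "s > 0" using insert.prems by (cases s) auto
  have IH: "(\<lambda>\<pi>. norm (op_weight u \<pi>)) summable_on ?X"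
    "(op_weight u has_sum (\<Prod>s\<in>A. part_factor u B s)) ?X"
    using insert by auto
  note c = choice_weight_sum[OF u s, of B]
  have eq: "op_weight u (add_part s x) = op_weight u (fst x) * choice_weight u s (snd x)"
    if "x \<in> ?X \<times> ?Y" for x
    using op_weight_add_part[of s A "fst x" B u "snd x"] insert.hyps that by auto
  have ab: "(\<lambda>x. norm (op_weight u (fst x) * choice_weight u s (snd x))) summable_on ?X \<times> ?Y"
    by (rule abs_summable_on_times[OF IH(1) c(1)])
  have hs: "((\<lambda>x. op_weight u (fst x) * choice_weight u s (snd x)) has_sum
      ((\<Prod>s\<in>A. part_factor u B s) * part_factor u B s)) (?X \<times> ?Y)"
  proof (rule has_sum_SigmaI)
    show "((\<lambda>y. op_weight u (fst (x, y)) * choice_weight u s (snd (x, y))) has_sum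
        (op_weight u x * part_factor u B s)) ?Y" for x
      using has_sum_cmult_right[OF c(2)] by simp
    show "((\<lambda>x. op_weight u x * part_factor u B s) has_sum
        ((\<Prod>s\<in>A. part_factor u B s) * part_factor u B s)) ?X"
      by (rule has_sum_cmult_left[OF IH(2)])
    show "(\<lambda>x. op_weight u (fst x) * choice_weight u s (snd x)) summable_on ?X \<times> ?Y"
      by (rule abs_summable_summable[OF ab])
  qed
  note bij = add_part_bij[OF insert.hyps(2), of B]
  have "(\<lambda>\<pi>. norm (op_weight u \<pi>)) summable_on overpartitions_on (insert s A) B"
    using ab unfolding summable_on_reindex_bij_betw[OF bij, symmetric]
    by (rule iffD1[OF summable_on_cong, rotated]) (simp add: eq)
  moreover have "(op_weight u has_sum ((\<Prod>s\<in>A. part_factor u B s) * part_factor u B s))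
      (overpartitions_on (insert s A) B)"
    using hs unfolding has_sum_reindex_bij_betw[OF bij, symmetric]
    by (rule iffD1[OF has_sum_cong, rotated]) (simp add: eq)
  ultimately show ?case using insert.hyps by (simp add: mult.commute)
qed

lemma rank_prod_eq:
  "(\<Prod>s\<in>{1..2 * m + 1}. part_factor u {1..2 * m} s) = rank_prod u m"
proof -
  define g where "g s = (1 + u * q ^ s) / (1 - (if even s then u else 1) * q ^ s)" for s :: nat
  have "(\<Prod>s\<in>{1..2 * m + 1}. part_factor u {1..2 * m} s)
      = (\<Prod>s\<in>{1..2 * m}. part_factor u {1..2 * m} s) * part_factor u {1..2 * m} (2 * m + 1)"
    by simp
  also have "(\<Prod>s\<in>{1..2 * m}. part_factor u {1..2 * m} s) = (\<Prod>s\<in>{1..2 * m}. g s)"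
    by (rule prod.cong) (simp_all add: part_factor_def g_def)
  \<comment> \<open>The size \<open>2 m + 1\<close> may not be overlined and contributes only a
    denominator; this is the extra factor of \<open>qfac q p (Suc m)\<close>.\<close>
  also have "part_factor u {1..2 * m} (2 * m + 1) = 1 / (1 - q ^ (2 * m + 1))"
    by (simp add: part_factor_def)
  also have "(\<Prod>s\<in>{1..2 * m}. g s) = qfac (- (u * q)) q (2 * m) / (qfac (u * p) p m * qfac q p m)"
  proof (induction m)
    case (Suc m)
    have e: "{1..2 * Suc m} = insert (2 * m + 2) (insert (2 * m + 1) {1..2 * m})" by auto
    have "(\<Prod>s\<in>{1..2 * Suc m}. g s) = g (2 * m + 2) * (g (2 * m + 1) * (\<Prod>s\<in>{1..2 * m}. g s))"
      unfolding e by simp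
    also have "g (2 * m + 2) = (1 + u * q * q ^ Suc (2 * m)) / (1 - u * p * p ^ m)"
    proof -
      have 1: "u * q ^ (2 * m + 2) = u * q * q ^ Suc (2 * m)" by (simp add: mult_ac)
      have 2: "u * q ^ (2 * m + 2) = u * p * p ^ m"
        unfolding power_add q_even_power by (simp add: p_def mult_ac)
      have "g (2 * m + 2) = (1 + u * q ^ (2 * m + 2)) / (1 - u * q ^ (2 * m + 2))"
        by (simp add: g_def)
      also have "\<dots> = (1 + u * q * q ^ Suc (2 * m)) / (1 - u * p * p ^ m)"
        using 1 2 by (simp only:)
      finally show ?thesis .
    qed
    also have "g (2 * m + 1) = (1 + u * q * q ^ (2 * m)) / (1 - q * p ^ m)"
      unfolding g_def by (simp add: mult_ac flip: q_even_power)
    finally show ?case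
      unfolding Suc.IH using qfac_Suc[of "- (u * q)" q "2 * m"] qfac_Suc[of "- (u * q)" q "Suc (2 * m)"]
      by (simp add: qfac_Suc[of _ p] mult_ac)
  qed simp
  finally show ?thesis
    by (simp add: rank_prod_def qfac_Suc q_even_power)
qed

lemma op_weight_rank_index_le:
  assumes "norm u = 1"
  shows "(\<lambda>\<pi>. norm (op_weight u \<pi>)) summable_on {\<pi> \<in> all_overpartitions. rank_index \<pi> \<le> m}"
    and "(op_weight u has_sum rank_prod u m) {\<pi> \<in> all_overpartitions. rank_index \<pi> \<le> m}"
proof -
  have e: "{\<pi> \<in> all_overpartitions. rank_index \<pi> \<le> m} = overpartitions_on {1..2 * m + 1} {1..2 * m}"
    using rank_index_le_iff by blast
  show "(\<lambda>\<pi>. norm (op_weight u \<pi>)) summable_on {\<pi> \<in> all_overpartitions. rank_index \<pi> \<le> m}"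
    "(op_weight u has_sum rank_prod u m) {\<pi> \<in> all_overpartitions. rank_index \<pi> \<le> m}"
    unfolding e using op_weight_sum[OF assms, of "{1..2 * m + 1}" "{1..2 * m}"]
    by (simp_all only: rank_prod_eq) simp_all
qed

lemma op_weight_rank_index_eq:
  assumes u: "norm u = 1"
  shows "(op_weight u has_sum (rank_prod u m - (if m = 0 then 0 else rank_prod u (m - 1))))
    {\<pi> \<in> all_overpartitions. rank_index \<pi> = m}"
proof (cases m)
  case 0
  then show ?thesis using op_weight_rank_index_le(2)[OF u, of 0] by simp
next
  case (Suc k)
  have "(op_weight u has_sum (rank_prod u m - rank_prod u k))
      ({\<pi> \<in> all_overpartitions. rank_index \<pi> \<le> m} - {\<pi> \<in> all_overpartitions. rank_index \<pi> \<le> k})"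
    using Suc by (intro has_sum_Diff op_weight_rank_index_le(2) u) auto
  also have "{\<pi> \<in> all_overpartitions. rank_index \<pi> \<le> m} - {\<pi> \<in> all_overpartitions. rank_index \<pi> \<le> k}
      = {\<pi> \<in> all_overpartitions. rank_index \<pi> = m}"
    using Suc by auto
  finally show ?thesis using Suc by simp
qed

end

section \<open>The two-variable generating function of the M2-rank\<close>

context nome_square
begin

text \<open>At the real base \<open>|q|\<close> and \<open>u = 1\<close> the weights are the moduli
  themselves. A finite set of overpartitions has bounded \<open>rank_index\<close>, so its sum is at
  most some \<open>R.rank_prod 1 m\<close>, and this sequence is bounded because it
  converges.\<close>

lemma q_power_summable_overpartitions:
  "(\<lambda>\<pi>. norm q ^ sum_mset (fst \<pi>)) summable_on all_overpartitions"
proof -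
  interpret R: nome_square "of_real (norm q)" "(of_real (norm q))\<^sup>2"
    using q_pos q_lt1 by unfold_locales auto
  have n1: "norm (1 :: complex) = 1" by simp
  obtain K where K: "\<And>m. norm (R.rank_prod 1 m) \<le> K"
    using convergent_imp_Bseq[OF R.rank_prod_convergent[OF n1]] unfolding Bseq_def by blast
  let ?f = "\<lambda>\<pi> :: overpartition. norm q ^ sum_mset (fst \<pi>)"
  have w: "R.op_weight 1 = (\<lambda>\<pi>. of_real (?f \<pi>))"
    by (rule ext) (simp add: R.op_weight_def)
  show ?thesis
  proof (rule nonneg_bdd_above_summable_on)
    show "bdd_above (sum ?f ` {F. F \<subseteq> all_overpartitions \<and> finite F})"
    proof (rule bdd_aboveI2)
      fix F assume "F \<in> {F. F \<subseteq> all_overpartitions \<and> finite F}"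
      then have F: "F \<subseteq> all_overpartitions" "finite F" by auto
      define m where "m = Max (insert 0 (rank_index ` F))"
      have sub: "F \<subseteq> {\<pi> \<in> all_overpartitions. rank_index \<pi> \<le> m}"
        using F by (auto simp: m_def)
      have s: "?f summable_on {\<pi> \<in> all_overpartitions. rank_index \<pi> \<le> m}"
        using R.op_weight_rank_index_le(1)[OF n1, of m] by (simp add: w norm_power)
      have eq: "complex_of_real (infsum ?f {\<pi> \<in> all_overpartitions. rank_index \<pi> \<le> m}) = R.rank_prod 1 m"
      proof (rule has_sum_unique)
        show "(R.op_weight 1 has_sum complex_of_real (infsum ?f {\<pi> \<in> all_overpartitions. rank_index \<pi> \<le> m}))
            {\<pi> \<in> all_overpartitions. rank_index \<pi> \<le> m}"
          unfolding w by (rule has_sum_of_real[OF has_sum_infsum[OF s]])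
        show "(R.op_weight 1 has_sum R.rank_prod 1 m) {\<pi> \<in> all_overpartitions. rank_index \<pi> \<le> m}"
          by (rule R.op_weight_rank_index_le(2)[OF n1])
      qed
      have "sum ?f F \<le> infsum ?f {\<pi> \<in> all_overpartitions. rank_index \<pi> \<le> m}"
        by (rule finite_sum_le_infsum[OF s F(2) sub]) simp
      also have "\<dots> \<le> norm (R.rank_prod 1 m)"
        unfolding eq[symmetric] norm_of_real by (rule abs_ge_self)
      also have "\<dots> \<le> K" by (rule K)
      finally show "sum ?f F \<le> K" .
    qed
  qed simp
qed

text \<open>The rank variable is \<open>1 / u\<close>, of modulus 1, so the previous bound gives
  absolute summability and the terms may be grouped by \<open>rank_index\<close>. On the class of
  index \<open>m\<close> the rank weight is \<open>u ^ marked_parts / u ^ m\<close>, which leads to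
  the series of \<open>chain_start\<close>.\<close>

lemma M2_rank_generating_function:
  assumes u: "norm u = 1"
  shows "((\<lambda>\<pi>. (1 / u) powi M2_rank \<pi> * q ^ sum_mset (fst \<pi>)) has_sum (\<Sum>n. rank_coeff u n))
    all_overpartitions"
proof -
  let ?f = "\<lambda>\<pi> :: overpartition. (1 / u) powi M2_rank \<pi> * q ^ sum_mset (fst \<pi>)"
  let ?C = "\<lambda>m. {\<pi> \<in> all_overpartitions. rank_index \<pi> = m}"
  let ?D = "\<lambda>m. rank_prod u m - (if m = 0 then 0 else rank_prod u (m - 1))"
  have u0: "u \<noteq> 0" using u by auto
  have "norm (?f \<pi>) = norm q ^ sum_mset (fst \<pi>)" for \<pi>
    using u by (simp add: norm_mult norm_power norm_power_int norm_divide)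
  then have "(\<lambda>\<pi>. norm (?f \<pi>)) summable_on all_overpartitions"
    using q_power_summable_overpartitions by (simp only:)
  then have sm: "?f summable_on all_overpartitions"
    by (rule abs_summable_summable)
  then obtain S where S: "(?f has_sum S) all_overpartitions" by (auto simp: summable_on_def)
  have "((\<lambda>(m, \<pi>). ?f \<pi>) has_sum S) (SIGMA m:UNIV. ?C m)"
    by (rule iffD2[OF has_sum_reindex_bij_witness[of _ "\<lambda>\<pi>. (rank_index \<pi>, \<pi>)" snd] S]) auto
  moreover have "((\<lambda>\<pi>. (\<lambda>(m, \<pi>). ?f \<pi>) (m, \<pi>)) has_sum (?D m / u ^ m)) (?C m)" for m
  proof -
    have "((\<lambda>\<pi>. op_weight u \<pi> * (1 / u ^ m)) has_sum (?D m * (1 / u ^ m))) (?C m)"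
      by (rule has_sum_cmult_left[OF op_weight_rank_index_eq[OF u]])
    moreover have "op_weight u \<pi> * (1 / u ^ m) = ?f \<pi>" if "\<pi> \<in> ?C m" for \<pi>
    proof -
      have "M2_rank \<pi> = int m - int (marked_parts \<pi>)"
        using M2_rank_eq[of \<pi>] that by simp
      then have "(1 / u) powi M2_rank \<pi> = u ^ marked_parts \<pi> / u ^ m"
        using u0 by (simp add: power_int_diff power_divide)
      then show ?thesis by (simp add: op_weight_def)
    qed
    ultimately have "(?f has_sum (?D m * (1 / u ^ m))) (?C m)"
      by (rule iffD1[OF has_sum_cong, rotated])
    then show ?thesis by simp
  qed
  ultimately have "((\<lambda>m. ?D m / u ^ m) has_sum S) UNIV"
    by (rule has_sum_SigmaD)
  then have "(\<lambda>m. ?D m / u ^ m) sums S" by (rule has_sum_imp_sums)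
  then have "S = 1 + chain_factor u 0 * (\<Sum>m. chain_term u 1 m)"
    using chain_start[OF u] sums_unique2 by blast
  also have "\<dots> = (\<Sum>n. rank_coeff u n)"
    using rank_coeff_sums[OF u] by (rule sums_unique)
  finally show ?thesis using S by simp
qed

end

text \<open>At base \<open>1 / 2\<close> every overpartition of \<open>n\<close> has the same
  positive weight, and a positive constant is summable only over a finite set.\<close>

lemma finite_overpartitions: "finite (overpartitions n)"
proof -
  interpret nome_square "1 / 2" "(1 / 2)\<^sup>2" by unfold_locales (auto simp: norm_divide)
  have sub: "overpartitions n \<subseteq> all_overpartitions"
    by (auto simp: overpartitions_def all_overpartitions_def)
  have "(\<lambda>\<pi>. norm (1 / 2 :: complex) ^ sum_mset (fst \<pi>)) summable_on overpartitions n"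
    using q_power_summable_overpartitions sub by (rule summable_on_subset_banach)
  moreover have "norm (1 / 2 :: complex) ^ sum_mset (fst \<pi>) = (1 / 2) ^ n" if "\<pi> \<in> overpartitions n" for \<pi>
    using that by (auto simp: overpartitions_def norm_divide)
  ultimately have "(\<lambda>_. (1 / 2 :: real) ^ n) summable_on overpartitions n"
    by (rule iffD1[OF summable_on_cong, rotated])
  then show ?thesis
    using infsum_diverge_constant[of "overpartitions n" "(1 / 2 :: real) ^ n"] by auto
qed

context nome_square
begin

lemma M2_rank_series:
  assumes u: "norm u = 1"
  shows "(\<lambda>n. (\<Sum>\<pi>\<in>overpartitions n. (1 / u) powi M2_rank \<pi>) * q ^ n) sums (\<Sum>n. rank_coeff u n)"
proof -
  let ?f = "\<lambda>\<pi> :: overpartition. (1 / u) powi M2_rank \<pi> * q ^ sum_mset (fst \<pi>)"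
  have "((\<lambda>(n, \<pi>). ?f \<pi>) has_sum (\<Sum>n. rank_coeff u n)) (SIGMA n:UNIV. overpartitions n)"
    by (rule iffD2[OF has_sum_reindex_bij_witness[of _ "\<lambda>\<pi>. (sum_mset (fst \<pi>), \<pi>)" snd]
          M2_rank_generating_function[OF u]])
      (auto simp: overpartitions_def all_overpartitions_def)
  moreover have "((\<lambda>\<pi>. (\<lambda>(n, \<pi>). ?f \<pi>) (n, \<pi>)) has_sum
      ((\<Sum>\<pi>\<in>overpartitions n. (1 / u) powi M2_rank \<pi>) * q ^ n)) (overpartitions n)" for n
    by (rule has_sum_finiteI[OF finite_overpartitions])
      (auto simp: sum_distrib_right overpartitions_def intro!: sum.cong)
  ultimately have "((\<lambda>n. (\<Sum>\<pi>\<in>overpartitions n. (1 / u) powi M2_rank \<pi>) * q ^ n) has_sum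
      (\<Sum>n. rank_coeff u n)) UNIV"
    by (rule has_sum_SigmaD)
  then show ?thesis by (rule has_sum_imp_sums)
qed

end

section \<open>Rank deviations\<close>

text \<open>A root-of-unity filter for the rank modulo \<open>M\<close>. Its term
  \<open>j = 0\<close> is exactly \<open>pbar n / M\<close>, so subtracting that number makes the
  sum start at \<open>j = 1\<close>.\<close>

lemma D2bar_summand:
  assumes "M > 0"
  shows "of_nat (N2bar a M n) - of_nat (pbar n) / of_nat M
    = (\<Sum>j\<in>{1..<M}. zeta M powi (- (a * int j)) / of_nat M
        * (\<Sum>\<pi>\<in>overpartitions n. (zeta M ^ j) powi M2_rank \<pi>))"
proof -
  have "of_nat (N2bar a M n) = (\<Sum>\<pi>\<in>overpartitions n. if int M dvd M2_rank \<pi> - a then 1 else 0 :: complex)"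
    by (simp add: N2bar_def cong_iff_dvd_diff Collect_conj_eq finite_overpartitions sum.If_cases
        flip: sum.inter_filter) 
  moreover have "of_nat (pbar n) / of_nat M = (\<Sum>\<pi>\<in>overpartitions n. 1 / of_nat M :: complex)"
    by (simp add: pbar_def)
  ultimately have "of_nat (N2bar a M n) - of_nat (pbar n) / of_nat M
      = (\<Sum>\<pi>\<in>overpartitions n. (if int M dvd M2_rank \<pi> - a then 1 else 0) - 1 / of_nat M :: complex)"
    by (simp only: sum_subtractf)
  also have "\<dots> = (\<Sum>\<pi>\<in>overpartitions n. \<Sum>j\<in>{1..<M}. zeta M powi ((M2_rank \<pi> - a) * int j) / of_nat M)"
  proof (rule sum.cong)
    fix \<pi>
    have "(\<Sum>j<M. zeta M powi ((M2_rank \<pi> - a) * int j))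
        = (if int M dvd M2_rank \<pi> - a then of_nat M else 0)"
      by (rule sum_zeta_powi[OF assms])
    moreover have "{..<M} = insert 0 {1..<M}" using assms by auto
    ultimately have "(\<Sum>j\<in>{1..<M}. zeta M powi ((M2_rank \<pi> - a) * int j))
        = (if int M dvd M2_rank \<pi> - a then of_nat M else 0) - 1"
      by (simp add: algebra_simps)
    then show "(if int M dvd M2_rank \<pi> - a then 1 else 0) - 1 / of_nat M
        = (\<Sum>j\<in>{1..<M}. zeta M powi ((M2_rank \<pi> - a) * int j) / of_nat M)"
      using assms by (simp add: diff_divide_distrib flip: sum_divide_distrib)
  qed simp
  also have "\<dots> = (\<Sum>j\<in>{1..<M}. \<Sum>\<pi>\<in>overpartitions n. zeta M powi ((M2_rank \<pi> - a) * int j) / of_nat M)"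
    by (rule sum.swap)
  also have "\<dots> = (\<Sum>j\<in>{1..<M}. zeta M powi (- (a * int j)) / of_nat M
        * (\<Sum>\<pi>\<in>overpartitions n. (zeta M ^ j) powi M2_rank \<pi>))"
    unfolding sum_distrib_left
  proof (intro sum.cong refl)
    fix j \<pi>
    have "zeta M powi ((M2_rank \<pi> - a) * int j) = zeta M powi (- (a * int j)) * zeta M powi (int j * M2_rank \<pi>)"
      by (simp add: algebra_simps flip: power_int_add)
    then show "zeta M powi ((M2_rank \<pi> - a) * int j) / of_nat M
      = zeta M powi (- (a * int j)) / of_nat M * (zeta M ^ j) powi M2_rank \<pi>"
      by (simp add: power_int_mult)
  qed
  finally show ?thesis .
qed

context nome_square
begin

lemma D2bar_eq:
  assumes "M > 0"
  shows "D2bar a M q = (\<Sum>j\<in>{1..<M}. zeta M powi (- (a * int j)) / of_nat M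
    * (\<Sum>n. rank_coeff (1 / zeta M ^ j) n))"
proof -
  have "(\<lambda>n. \<Sum>j\<in>{1..<M}. zeta M powi (- (a * int j)) / of_nat M
      * ((\<Sum>\<pi>\<in>overpartitions n. (1 / (1 / zeta M ^ j)) powi M2_rank \<pi>) * q ^ n)) sums
      (\<Sum>j\<in>{1..<M}. zeta M powi (- (a * int j)) / of_nat M * (\<Sum>n. rank_coeff (1 / zeta M ^ j) n))"
    by (intro sums_sum sums_mult M2_rank_series)
      (simp add: norm_divide norm_power norm_zeta)
  also have "(\<lambda>n. \<Sum>j\<in>{1..<M}. zeta M powi (- (a * int j)) / of_nat M
      * ((\<Sum>\<pi>\<in>overpartitions n. (1 / (1 / zeta M ^ j)) powi M2_rank \<pi>) * q ^ n))
    = (\<lambda>n. (of_nat (N2bar a M n) - of_nat (pbar n) / of_nat M) * q ^ n)"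
    unfolding D2bar_summand[OF assms]
    by (rule ext, subst sum_distrib_right) (simp add: mult.assoc)
  finally show ?thesis
    unfolding D2bar_def by (rule sums_unique[symmetric])
qed

text \<open>\<open>appell_num_change\<close> is not symmetric in its hypotheses, and
  \<open>-1\<close> has to play the role of \<open>w\<close>: \<open>|x * - 1| = |q|\<close> is not
  a power of \<open>|p|\<close>, whereas \<open>|x * q| = |p|\<close> is, so for \<open>q\<close>
  only the exact poles can be excluded.\<close>

lemma appell_lerch_q_to_minus_1:
  assumes x: "norm x = norm q" "\<And>k :: int. x * q \<noteq> p powi k"
  shows "appell_lerch x p q = appell_lerch x p (- 1) + Delta_quot x q (- 1) p"
proof -
  have x0: "x \<noteq> 0" using x(1) by auto
  have xm: "norm (x * - 1) \<noteq> norm p powi k" for k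
    using norm_neq_norm_square_powi x(1) by simp
  have jm: "jtheta (- 1) p \<noteq> 0"
    using p.jtheta_eq_0_iff[of "- 1"] unit_neq_powi[of "- 1"] by auto
  have ch: "jtheta q p * appell_num x p (- 1) - jtheta (- 1) p * appell_num x p q
    = q * qpoch_inf p p ^ 3 * jtheta (- 1 / q) p * jtheta (x * q * - 1) p /
      (jtheta (x * q) p * jtheta (x * - 1) p)"
    by (rule p.appell_num_change[OF x0 _ q_nz xm x(2) jm]) simp
  have "jtheta (- 1 / q) p = jtheta (- q) p / q"
    using p.jtheta_inverse[of "- q"] by simp
  then have "q * qpoch_inf p p ^ 3 * jtheta (- 1 / q) p * jtheta (x * q * - 1) p /
      (jtheta (x * q) p * jtheta (x * - 1) p)
    = - (Delta_quot x q (- 1) p) * (jtheta (- 1) p * jtheta q p)"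
    using jm jtheta_q_nz by (simp add: Delta_quot_def mult_ac)
  with ch have "jtheta q p * appell_num x p (- 1) - jtheta (- 1) p * appell_num x p q
      = - (Delta_quot x q (- 1) p) * (jtheta (- 1) p * jtheta q p)" by simp
  moreover have "J * A - K * B = - D * (K * J) \<Longrightarrow> J \<noteq> 0 \<Longrightarrow> K \<noteq> 0 \<Longrightarrow> B / J = A / K + D"
    for J K A B D :: complex
    by (simp add: field_simps)
  ultimately show ?thesis
    unfolding appell_lerch_eq using jm jtheta_q_nz by blast
qed

text \<open>Adding the deviation for \<open>a - 1\<close> contributes the factor
  \<open>1 + zeta M ^ j\<close>, to which \<open>rank_coeff_appell\<close> applies. Since nothing is
  divided by this factor, the root \<open>-1\<close>, present for even \<open>M\<close>, needs no
  separate treatment.\<close>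

lemma D2bar_pair:
  assumes M: "M > 0"
  shows "D2bar a M q + D2bar (a - 1) M q = (\<Sum>j\<in>{1..<M}. zeta M powi (- (a * int j)) / of_nat M
    * ((1 - zeta M ^ j) * (2 * appell_lerch (zeta M ^ j * q) p q - 1)))"
proof -
  have "zeta M powi (- (a * int j)) / of_nat M * (\<Sum>n. rank_coeff (1 / zeta M ^ j) n)
      + zeta M powi (- ((a - 1) * int j)) / of_nat M * (\<Sum>n. rank_coeff (1 / zeta M ^ j) n)
      = zeta M powi (- (a * int j)) / of_nat M
        * ((1 - zeta M ^ j) * (2 * appell_lerch (zeta M ^ j * q) p q - 1))"
    if "j \<in> {1..<M}" for j
  proof -
    define u where "u = 1 / zeta M ^ j"
    have z: "1 / u = zeta M ^ j" by (simp add: u_def)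
    have "zeta M ^ j \<noteq> 1"
      using zeta_powi_eq_1_iff[OF M, of "int j"] that nat_dvd_not_less[of j M] by auto
    then have u: "norm u = 1" "u \<noteq> 1"
      by (auto simp: u_def norm_divide norm_power norm_zeta)
    have e: "zeta M powi (- ((a - 1) * int j)) = zeta M powi (- (a * int j)) * zeta M ^ j"
      by (simp add: algebra_simps flip: power_int_add power_int_of_nat)
    have "q / u = zeta M ^ j * q" by (simp add: u_def)
    then have "(1 + zeta M ^ j) * (\<Sum>n. rank_coeff u n)
        = (1 - zeta M ^ j) * (2 * appell_lerch (zeta M ^ j * q) p q - 1)"
      using rank_coeff_appell[OF u] by (simp only: z)
    then have "zeta M powi (- (a * int j)) / of_nat M * ((1 + zeta M ^ j) * (\<Sum>n. rank_coeff u n))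
        = zeta M powi (- (a * int j)) / of_nat M
          * ((1 - zeta M ^ j) * (2 * appell_lerch (zeta M ^ j * q) p q - 1))" by simp
    then show ?thesis
      unfolding e u_def[symmetric] by (simp only: distrib_right distrib_left mult_1_left
          times_divide_eq_left mult.assoc)
  qed
  then show ?thesis
    unfolding D2bar_eq[OF M] sum.distrib[symmetric] by (rule sum.cong[OF refl])
qed

text \<open>The splitting in base \<open>q^2\<close> with parameter \<open>q\<close> and last
  argument \<open>-1\<close>. Doubling the exponents of the base and adding those of
  \<open>q\<close> yields \<open>2 (M choose 2) - 2 M k + M = M^2 - 2 M k\<close> and
  \<open>- 2 (Suc k choose 2) + k = - k^2\<close>.\<close>

lemma dissection_base_q2:
  assumes k: "k < M" and gen: "generic M (int k) q z'"
  shows "(\<Sum>j<M. zeta M powi (- (int k * int j)) * appell_lerch (zeta M ^ j * q) p (- 1))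
    = of_nat M * ((-1) powi int k * q powi (- ((int k)\<^sup>2)) *
        appell_lerch ((-1) ^ (M + 1) * q powi ((int M)\<^sup>2 - 2 * int M * int k)) (q ^ (2 * M\<^sup>2)) z'
      + Psi_quot M (int k) q (- 1) z' p)"
proof -
  have Q: "p ^ M\<^sup>2 = q ^ (2 * M\<^sup>2)" by (simp add: p_def power_mult)
  have p_powi: "p powi i = q powi (2 * i)" for i by (simp add: p_def power_int_mult)
  have X: "p.dissect_x M k q = (-1) ^ (M + 1) * q powi ((int M)\<^sup>2 - 2 * int M * int k)"
  proof -
    have "2 * (int (M choose 2) - int M * int k) + int M = (int M)\<^sup>2 - 2 * int M * int k"
      using two_tri[of "int M"] unfolding choose_two_tri
      by (simp add: algebra_simps power2_eq_square)
    then have "q powi (2 * (int (M choose 2) - int M * int k)) * q ^ M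
        = q powi ((int M)\<^sup>2 - 2 * int M * int k)"
      by (metis power_int_add power_int_of_nat q_nz)
    moreover have "p.dissect_x M k q
        = (-1) ^ (M + 1) * (q powi (2 * (int (M choose 2) - int M * int k)) * q ^ M)"
      unfolding p.dissect_x_def p_powi by (subst power_minus) simp
    ultimately show ?thesis by simp
  qed
  have g: "z' \<noteq> 0" "\<And>l :: int. z' \<noteq> (p ^ M\<^sup>2) powi l"
    "\<And>l :: int. p.dissect_x M k q * z' \<noteq> (p ^ M\<^sup>2) powi l"
    using gen unfolding generic_def appell_lerch_defined_def Q X by auto
  have jm: "jtheta (- 1) p \<noteq> 0"
    using p.jtheta_eq_0_iff[of "- 1"] unit_neq_powi[of "- 1"] by auto
  have xz: "norm (q * - 1) \<noteq> norm p powi l" for l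
    using norm_neq_norm_square_powi by simp
  have zn: "- ((- (- 1)) ^ M) \<noteq> p powi l" for l
    using unit_neq_powi[of "- 1" l] by simp
  have c: "p powi (- int (Suc k choose 2)) * (- q) ^ k = (-1) powi int k * q powi (- ((int k)\<^sup>2))"
  proof -
    have "2 * (- int (Suc k choose 2)) + int k = - ((int k)\<^sup>2)"
      using two_tri[of "int (Suc k)"] unfolding choose_two_tri
      by (simp add: algebra_simps power2_eq_square)
    then have "q powi (2 * (- int (Suc k choose 2))) * q ^ k = q powi (- ((int k)\<^sup>2))"
      by (metis power_int_add power_int_of_nat q_nz)
    then show ?thesis unfolding p_powi by (subst power_minus) (simp add: mult_ac)
  qed
  show ?thesis
    using p.appell_lerch_dissection[OF q_nz _ g(1) k jm xz zn g(2,3)] unfolding c X Q by simp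
qed

end

theorem theorem1p2:
  fixes M :: nat and a :: int and q z' z'' :: complex
  assumes "0 < norm q" and "norm q < 1"
    and "M \<ge> 2" and "1 \<le> a" and "a \<le> int M - 1"
    and "generic M a q z'" and "generic M (a - 1) q z''"
  shows "D2bar a M q + D2bar (a - 1) M q =
      of_bool (a = 1)
    + 2 * (-1) powi a * q powi (- (a\<^sup>2)) *
        appell_lerch ((-1) ^ (M + 1) * q powi ((int M)\<^sup>2 - 2 * int M * a)) (q ^ (2 * M\<^sup>2)) z'
    + 2 * (-1) powi a * q powi (- (a\<^sup>2) + 2 * a - 1) *
        appell_lerch ((-1) ^ (M + 1) * q powi ((int M)\<^sup>2 - 2 * int M * (a - 1))) (q ^ (2 * M\<^sup>2)) z''
    + 2 * Psi_quot M a q (-1) z' (q\<^sup>2)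
    - 2 * Psi_quot M (a - 1) q (-1) z'' (q\<^sup>2)
    + 2 / of_nat M *
        (\<Sum>j = 1..M - 1. zeta M powi (- a * int j) * (1 - zeta M ^ j) *
           Delta_quot (zeta M ^ j * q) q (-1) (q\<^sup>2))"
proof -
  interpret nome_square q "q\<^sup>2" using assms(1,2) by unfold_locales auto
  have M: "M > 0" using assms(3) by simp
  define c where "c j = zeta M powi (- (a * int j)) * (1 - zeta M ^ j)" for j :: nat
  define m where "m j = appell_lerch (zeta M ^ j * q) (q\<^sup>2) (- 1)" for j :: nat
  define \<Delta> where "\<Delta> j = Delta_quot (zeta M ^ j * q) q (-1) (q\<^sup>2)" for j :: nat
  \<comment> \<open>Because of this zero, the sums with last argument \<open>-1\<close> can be
    extended to \<open>j = 0\<close>, as the averaging over all roots of unity requires.\<close>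
  have c0: "c 0 = 0" by (simp add: c_def)
  have split: "{..<M} = insert 0 {1..<M}" using M by auto
  have c_eq: "c j = zeta M powi (- (a * int j)) - zeta M powi (- ((a - 1) * int j))" for j
  proof -
    have "zeta M powi (- ((a - 1) * int j)) = zeta M powi (- (a * int j)) * zeta M ^ j"
      by (simp add: algebra_simps flip: power_int_add power_int_of_nat)
    then show ?thesis by (simp add: c_def algebra_simps)
  qed
  have ap: "appell_lerch (zeta M ^ j * q) (q\<^sup>2) q = m j + \<Delta> j" if "j \<in> {1..<M}" for j
    unfolding m_def \<Delta>_def
  proof (rule appell_lerch_q_to_minus_1)
    show "norm (zeta M ^ j * q) = norm q"
      by (simp add: norm_mult norm_power norm_zeta)
    show "zeta M ^ j * q * q \<noteq> (q\<^sup>2) powi k" for k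
    proof
      assume "zeta M ^ j * q * q = (q\<^sup>2) powi k"
      then have "zeta M ^ j = (q\<^sup>2) powi (k - 1)"
        by (simp add: power_int_diff field_simps power2_eq_square)
      moreover have "zeta M ^ j \<noteq> 1"
        using zeta_powi_eq_1_iff[OF M, of "int j"] that nat_dvd_not_less[of j M] by auto
      ultimately show False
        using unit_neq_powi[of "zeta M ^ j" "k - 1"] by (simp add: norm_power norm_zeta)
    qed
  qed
  have "D2bar a M q + D2bar (a - 1) M q
      = (\<Sum>j\<in>{1..<M}. c j * (2 * appell_lerch (zeta M ^ j * q) (q\<^sup>2) q - 1)) / of_nat M"
    unfolding D2bar_pair[OF M] sum_divide_distrib
    by (intro sum.cong) (simp_all add: c_def)
  also have "(\<Sum>j\<in>{1..<M}. c j * (2 * appell_lerch (zeta M ^ j * q) (q\<^sup>2) q - 1))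
      = 2 * (\<Sum>j\<in>{1..<M}. c j * m j) + 2 * (\<Sum>j\<in>{1..<M}. c j * \<Delta> j) - (\<Sum>j\<in>{1..<M}. c j)"
    unfolding sum_distrib_left sum.distrib[symmetric] sum_subtractf[symmetric]
    by (rule sum.cong[OF refl], subst ap, assumption) (simp add: algebra_simps)
  also have "(\<Sum>j\<in>{1..<M}. c j * m j) = (\<Sum>j<M. c j * m j)"
    unfolding split using c0 by simp
  also have "(\<Sum>j\<in>{1..<M}. c j) = (\<Sum>j<M. c j)"
    unfolding split using c0 by simp
  \<comment> \<open>By \<open>c_eq\<close> this is a difference of two complete character sums, with
    exponents \<open>a\<close> and \<open>a - 1\<close>. The first vanishes since
    \<open>0 < a < M\<close>; the second is \<open>M\<close> exactly when \<open>a = 1\<close>, the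
    source of the isolated summand in the theorem.\<close>
  also have "(\<Sum>j<M. c j) = - (of_nat M * of_bool (a = 1))"
  proof -
    have "(\<Sum>j<M. zeta M powi (- (b * int j))) = (if b = 0 then of_nat M else 0)"
      if "0 \<le> b" "b < int M" for b
    proof -
      have "int M dvd - b \<longleftrightarrow> b = 0" using that zdvd_not_zless[of b "int M"] by (cases "b = 0") auto
      then show ?thesis using sum_zeta_powi[OF M, of "- b"] by simp
    qed
    from this[of a] this[of "a - 1"] show ?thesis
      unfolding c_eq sum_subtractf using assms(4,5) by simp
  qed
  also have "(\<Sum>j<M. c j * m j) = of_nat M * ((-1) powi a * q powi (- (a\<^sup>2)) *
        appell_lerch ((-1) ^ (M + 1) * q powi ((int M)\<^sup>2 - 2 * int M * a)) (q ^ (2 * M\<^sup>2)) z'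
      + Psi_quot M a q (- 1) z' (q\<^sup>2))
    - of_nat M * ((-1) powi (a - 1) * q powi (- ((a - 1)\<^sup>2)) *
        appell_lerch ((-1) ^ (M + 1) * q powi ((int M)\<^sup>2 - 2 * int M * (a - 1))) (q ^ (2 * M\<^sup>2)) z''
      + Psi_quot M (a - 1) q (- 1) z'' (q\<^sup>2))"
  proof -
    \<comment> \<open>The splitting is used for the residues \<open>a\<close> and
      \<open>a - 1\<close>; the bounds on \<open>a\<close> make both natural numbers below
      \<open>M\<close>.\<close>
    have i: "int (nat a) = a" "int (nat (a - 1)) = a - 1" and l: "nat a < M" "nat (a - 1) < M"
      using assms(4,5) by auto
    have "(\<Sum>j<M. c j * m j) = (\<Sum>j<M. zeta M powi (- (a * int j)) * m j)
        - (\<Sum>j<M. zeta M powi (- ((a - 1) * int j)) * m j)"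
      unfolding sum_subtractf[symmetric] by (rule sum.cong[OF refl]) (simp only: c_eq left_diff_distrib)
    then show ?thesis
      using dissection_base_q2[OF l(1), unfolded i, OF assms(6)]
        dissection_base_q2[OF l(2), unfolded i, OF assms(7)]
      unfolding m_def by (simp only:)
  qed
  finally have main: "D2bar a M q + D2bar (a - 1) M q = (2 * (of_nat M * ((-1) powi a * q powi (- (a\<^sup>2)) *
        appell_lerch ((-1) ^ (M + 1) * q powi ((int M)\<^sup>2 - 2 * int M * a)) (q ^ (2 * M\<^sup>2)) z'
      + Psi_quot M a q (- 1) z' (q\<^sup>2))
    - of_nat M * ((-1) powi (a - 1) * q powi (- ((a - 1)\<^sup>2)) *
        appell_lerch ((-1) ^ (M + 1) * q powi ((int M)\<^sup>2 - 2 * int M * (a - 1))) (q ^ (2 * M\<^sup>2)) z''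
      + Psi_quot M (a - 1) q (- 1) z'' (q\<^sup>2)))
    + 2 * (\<Sum>j\<in>{1..<M}. c j * \<Delta> j) - - (of_nat M * of_bool (a = 1))) / of_nat M" .
  have alg: "(2 * (N * (s * e * A + P) - N * (s' * e' * B + P')) + 2 * D - - (N * b)) / N
      = b + 2 * s * e * A + 2 * - s' * e' * B + 2 * P - 2 * P' + 2 / N * D"
    if "N \<noteq> 0" for N s e A P s' e' B P' D b :: complex
    using that by (simp add: field_simps)
  \<comment> \<open>The minus sign between the two split sums turns \<open>(-1)^(a-1)\<close> into
    \<open>(-1)^a\<close>, so both Appell--Lerch series carry the same sign.\<close>
  have s: "(-1 :: complex) powi a = - ((-1) powi (a - 1))"
    by (simp add: power_int_diff)
  have e: "- ((a - 1)\<^sup>2) = - (a\<^sup>2) + 2 * a - 1"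
    by (simp add: power2_eq_square algebra_simps)
  have D: "(\<Sum>j = 1..M - 1. zeta M powi (- a * int j) * (1 - zeta M ^ j) * \<Delta> j)
      = (\<Sum>j\<in>{1..<M}. c j * \<Delta> j)"
    using M by (intro sum.cong) (auto simp: c_def)
  have N: "of_nat M \<noteq> (0 :: complex)" using M by simp
  show ?thesis
    unfolding main alg[OF N] \<Delta>_def[symmetric] D e s[symmetric] ..
qed

end
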